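(* Let $n\geq3$, let $p=\infty$ or $p\in\big[\frac{2K_{1}+n-1}{2K_{1}},\frac{2K_{1}+n-2}{2K_{1}-1}\big]$ for some $K_{1}\in\mathbb{Z}^{+}=\{1,2,3,\ldots\}$, and let $q$ be the conjugate exponent of $p$. (1) If $u=\mathcal{P}_{\mathbb{B}^{n}}[\phi]$ with $\phi\in L^{p}(\mathbb{S}^{n-1},\mathbb{R})$, then for any $x\in\mathbb{B}^{n}$ the following sharp inequality holds: $$|\nabla u(x)|\leq 2(n-1)\left(\frac{\Gamma(\frac{n}{2})\Gamma(\frac{q+1}{2})(1+|x|^{2})^{(n-1)(q-1)}}{\sqrt{\pi}\,\Gamma(\frac{q+n}{2})(1-|x|^2)^{n(q-1)+1}}\right)^{\frac1q}\left({}_{3}F_{2}\Big(\tfrac{(n-1)(1-q)}{2},\tfrac{1-(n-1)(q-1)}{2},\tfrac{q+1}{2};\tfrac12,\tfrac{q+n}{2};\tfrac{4|x|^{2}}{(1+|x|^{2})^{2}}\Big)\right)^{\frac1q}\|\phi\|_{L^{p}(\mathbb{S}^{n-1},\mathbb{R})}.$$ (2) If $u=\mathcal{P}_{\mathbb{H}^{n}}[\phi]$ with $\phi\in L^{p}(\mathbb{R}^{n-1},\mathbb{R})$, then for any $x\in\mathbb{H}^{n}$ the following sharp inequality holds: $$|\nabla u(x)|\leq\frac{(n-1)\Gamma(\frac{n}{2})}{2^{\frac{q-1}{q}}\pi^{\frac{nq-n+1}{2q}}x_{n}^{\frac{n(q-1)+1}{q}}}\left(\frac{\Gamma(\frac{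q+1}{2})}{\Gamma(\frac{q+n}{2})}\;{}_{3}F_{2}\Big(\tfrac{(n-1)(1-q)}{2},\tfrac{1-(n-1)(q-1)}{2},\tfrac{q+1}{2};\tfrac12,\tfrac{q+n}{2};1\Big)\right)^{\frac1q}\|\phi\|_{L^{p}(\mathbb{R}^{n-1},\mathbb{R})}.$$
   Context: $|\cdot|$ is the Euclidean norm on $\mathbb{R}^n$; $\mathbb{B}^n=\{|x|<1\}$, $\mathbb{S}^{n-1}=\{|x|=1\}$, $\mathbb{H}^n=\{x=(x',x_n): x'\in\mathbb{R}^{n-1},\,x_n>0\}$. $\Gamma$ is the Gamma function. $\sigma$ is the surface measure on $\mathbb{S}^{n-1}$ normalized so that $\sigma(\mathbb{S}^{n-1})=1$, and $V_{n-1}$ is Lebesgue measure on $\mathbb{R}^{n-1}$. $L^p(\mathbb{S}^{n-1},\mathbb{R})$ and $L^p(\mathbb{R}^{n-1},\mathbb{R})$ are taken with respect to $\sigma$ and $V_{n-1}$ respectively. Conjugate exponent: $1/p+1/q=1$ (so $q=1$ if $p=\infty$). Poisson–Szegő integrals (for the hyperbolic Laplacian): $$\mathcal{P}_{\mathbb{B}^n}[\phi](x)=\int_{\mathbb{S}^{n-1}}\Big(\frac{1-|x|^2}{|x-\zeta|^2}\Big)^{n-1}\phi(\zeta)\,d\sigma(\zeta),\quad x\in\mathbb{B}^n,$$ $$\mathcal{P}_{\mathbb{H}^n}[\phi](x)=c_n\int_{\mathbb{R}^{n-1}}\Big(\frac{x_n}{|x'-y'|^2+x_n^2}\Big)^{n-1}\phi(y')\,dV_{n-1}(y'),\quad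 x\in\mathbb{H}^n,\qquad c_n=\frac{2^{n-2}\Gamma(n/2)}{\pi^{n/2}}.$$ "Sharp" means that, for each fixed $x$, the coefficient multiplying $\|\phi\|_{L^p}$ is the smallest constant for which the inequality holds for all $\phi\in L^p$. The generalized hypergeometric series is ${}_3F_2(a_1,a_2,a_3;b_1,b_2;t)=\sum_{k=0}^\infty\frac{(a_1)_k(a_2)_k(a_3)_k}{k!\,(b_1)_k(b_2)_k}t^k$, where $(a)_0=1$, $(a)_k=a(a+1)\cdots(a+k-1)$ (with $t=1$ meaning the sum of the series at $1$). *)

theory Defs
  imports "HOL-Probability.Probability" "HOL-Probability.Essential_Supremum"
begin

text \<open>
  The normalized surface measure on the unit sphere, as the cone measure: for a Borel set
  \<open>A\<close> of unit vectors, \<open>\<sigma>(A) = |{x \<in> B. x / |x| \<in> A}| / |B|\<close>, where \<open>B\<close> is the unit ball and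
  \<open>|_|\<close> is Lebesgue measure (lemma \<open>emeasure_sphere_measure\<close> below). In a normed vector space
  \<open>sgn x\<close> is \<open>x / |x|\<close>, with \<open>sgn 0 = 0\<close>. The measure is completed, in
  parallel with \<open>lebesgue\<close> being the completion of \<open>lborel\<close>.
\<close>
definition sphere_measure :: "'a::euclidean_space measure" where
  "sphere_measure =
     completion (restrict_space (distr (uniform_measure lborel (ball 0 1)) borel sgn) (sphere 0 1))"

lemma sgn_borel_measurable: "(sgn :: 'a::euclidean_space \<Rightarrow> 'a) \<in> borel_measurable borel"
  unfolding sgn_div_norm by measurable

lemma space_sphere_measure: "space (sphere_measure :: 'a::euclidean_space measure) = sphere 0 1"
  by (simp add: sphere_measure_def space_restrict_space)

lemma emeasure_sphere_measure:
  fixes A :: "'a::euclidean_space set"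
  assumes A: "A \<in> sets borel" "A \<subseteq> sphere 0 1"
  shows "emeasure sphere_measure A =
    emeasure lborel {x \<in> ball 0 1. x /\<^sub>R norm x \<in> A} / emeasure lborel (ball (0::'a) 1)"
proof -
  let ?D = "distr (uniform_measure lborel (ball 0 1)) borel (sgn :: 'a \<Rightarrow> 'a)"
  have S: "sphere (0::'a) 1 \<in> sets borel" by simp
  have AR: "A \<in> sets (restrict_space ?D (sphere 0 1))"
    using A S by (simp add: sets_restrict_space_iff)
  have m: "(sgn :: 'a \<Rightarrow> 'a) \<in> measurable (uniform_measure lborel (ball 0 1)) borel"
    by (subst measurable_cong_sets[of _ borel _ borel]) (auto intro: sgn_borel_measurable)
  have pre: "sgn -` A \<in> sets (lborel :: 'a measure)"
    using measurable_sets[OF sgn_borel_measurable A(1)] by simp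
  have "emeasure sphere_measure A = emeasure ?D A"
    unfolding sphere_measure_def using AR A S by (simp add: emeasure_restrict_space)
  also have "\<dots> = emeasure (uniform_measure lborel (ball 0 1)) (sgn -` A)"
    using emeasure_distr[OF m A(1)] by simp
  also have "\<dots> = emeasure lborel (ball 0 1 \<inter> sgn -` A) / emeasure lborel (ball (0::'a) 1)"
    using pre by (intro emeasure_uniform_measure) auto
  also have "ball 0 1 \<inter> sgn -` A = {x \<in> ball 0 1. x /\<^sub>R norm x \<in> A}"
    by (auto simp: sgn_div_norm)
  finally show ?thesis .
qed

lemma emeasure_sphere_measure_total:
  "emeasure sphere_measure (sphere (0::'a::euclidean_space) 1) = 1"
proof -
  have S: "sphere (0::'a) 1 \<in> sets borel" by simp
  have eq: "{x \<in> ball 0 1. x /\<^sub>R norm x \<in> sphere 0 1} = ball (0::'a) 1 - {0}"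
    by auto
  have e: "emeasure lborel (ball (0::'a) 1 - {0}) = emeasure lborel (ball (0::'a) 1)"
    by (subst emeasure_Diff_null_set) auto
  have "emeasure lborel (ball (0::'a) 1) \<noteq> 0"
    using content_ball_pos[of 1 "0::'a"] by (auto simp: measure_def)
  moreover have "emeasure lborel (ball (0::'a) 1) < \<infinity>"
    by (rule emeasure_lborel_ball_finite)
  ultimately show ?thesis
    using emeasure_sphere_measure[OF S order_refl, unfolded eq e] by (simp add: ennreal_divide_self)
qed

definition Lp :: "'a measure \<Rightarrow> ereal \<Rightarrow> ('a \<Rightarrow> real) set" where
  "Lp M p = {\<phi> \<in> borel_measurable M.
     if p = \<infinity> then esssup M (\<lambda>z. ereal \<bar>\<phi> z\<bar>) < \<infinity>
     else integrable M (\<lambda>z. \<bar>\<phi> z\<bar> powr real_of_ereal p)}"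

definition Lp_norm :: "'a measure \<Rightarrow> ereal \<Rightarrow> ('a \<Rightarrow> real) \<Rightarrow> real" where
  "Lp_norm M p \<phi> =
     (if p = \<infinity> then real_of_ereal (esssup M (\<lambda>z. ereal \<bar>\<phi> z\<bar>))
      else (\<integral>z. \<bar>\<phi> z\<bar> powr real_of_ereal p \<partial>M) powr (1 / real_of_ereal p))"

definition gradient :: "('a::euclidean_space \<Rightarrow> real) \<Rightarrow> 'a \<Rightarrow> 'a" where
  "gradient f x = (THE D. GDERIV f x :> D)"

definition poisson_szego_ball :: "('a::euclidean_space \<Rightarrow> real) \<Rightarrow> 'a \<Rightarrow> real" where
  "poisson_szego_ball \<phi> x =
     (\<integral>\<zeta>. ((1 - norm x ^ 2) / norm (x - \<zeta>) ^ 2) ^ (DIM('a) - 1) * \<phi> \<zeta> \<partial>sphere_measure)"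

text \<open>
  Points of \<open>\<real>\<^sup>n = \<real>\<^sup>n\<^sup>-\<^sup>1 \<times> \<real>\<close> are pairs \<open>(x', x\<^sub>n)\<close>; the norm of the product type is the Euclidean one.
  So \<open>n = DIM('b \<times> real) = DIM('b) + 1\<close> when \<open>'b\<close> plays the role of \<open>\<real>\<^sup>n\<^sup>-\<^sup>1\<close>.
\<close>
definition upper_half_space :: "('b::euclidean_space \<times> real) set" where
  "upper_half_space = {x. snd x > 0}"

definition half_space_const :: "nat \<Rightarrow> real" where
  "half_space_const n = 2 ^ (n - 2) * Gamma (real n / 2) / pi powr (real n / 2)"

definition poisson_szego_half_space ::
    "('b::euclidean_space \<Rightarrow> real) \<Rightarrow> 'b \<times> real \<Rightarrow> real" where
  "poisson_szego_half_space \<phi> x =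
     half_space_const (DIM('b \<times> real)) *
     (\<integral>y. (snd x / (norm (fst x - y) ^ 2 + snd x ^ 2)) ^ (DIM('b \<times> real) - 1) * \<phi> y \<partial>lebesgue)"

definition hypergeometric_3F2 ::
    "real \<Rightarrow> real \<Rightarrow> real \<Rightarrow> real \<Rightarrow> real \<Rightarrow> real \<Rightarrow> real" where
  "hypergeometric_3F2 a1 a2 a3 b1 b2 t =
     (\<Sum>k. pochhammer a1 k * pochhammer a2 k * pochhammer a3 k /
           (fact k * pochhammer b1 k * pochhammer b2 k) * t ^ k)"

text \<open>
  The inequality \<open>F \<phi> \<le> C * N \<phi>\<close> holds for all \<open>\<phi> \<in> A\<close>, and \<open>C\<close> is the smallest constant with
  this property.
\<close>
definition sharp_inequality :: "'f set \<Rightarrow> ('f \<Rightarrow> real) \<Rightarrow> ('f \<Rightarrow> real) \<Rightarrow> real \<Rightarrow> bool" where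
  "sharp_inequality A F N C \<longleftrightarrow>
     (\<forall>\<phi>\<in>A. F \<phi> \<le> C * N \<phi>) \<and>
     (\<forall>C'. (\<forall>\<phi>\<in>A. F \<phi> \<le> C' * N \<phi>) \<longrightarrow> C \<le> C')"

end

theory Submission
  imports Defs
begin

text \<open>
  For both kernels \<open>\<nabla>P(x, \<zeta>)\<close> is a scalar multiple of \<open>P(x, \<zeta>) \<eta>\<close>, where \<open>\<eta>\<close> is the image of \<open>\<zeta>\<close>
  under a conformal map onto the unit sphere. By \<open>L\<^sup>p\<close> duality the sharp constant is the supremum over unit
  vectors \<open>l\<close> of the \<open>L\<^sup>q\<close> norm of \<open>\<nabla>P(x, \<zeta>) \<bullet> l\<close>. That conformal map carries \<open>P(x, \<zeta>) d\<zeta>\<close> to the normalized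
  surface measure \<open>\<sigma>\<close>, and \<open>P\<close> is a power of \<open>1 - w (\<eta> \<bullet> e)\<close> in the new variable, so that
  the question is to maximize over \<open>l\<close> the integral \<open>\<integral> (1 - w (\<eta> \<bullet> e))\<^sup>s \<bar>\<eta> \<bullet> l\<bar>\<^sup>q d\<sigma>(\<eta>)\<close> with
  \<open>s = (n - 1)(q - 1)\<close>, where \<open>w = 2|x| / (1 + |x|\<^sup>2)\<close> for the ball and \<open>w = 1\<close> for the half-space. Only the even
  terms of the binomial series contribute. Their coefficients are all nonnegative precisely
  because \<open>2K - 1 \<le> s \<le> 2K\<close> (or \<open>s = 0\<close>), and by Young's inequality and rotation
  invariance each term is largest at \<open>l = e\<close>, where the moments of \<open>\<sigma>\<close> sum to the hypergeometric series.
\<close>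

subsection \<open>Change of variables for maps with one unstretched direction\<close>

text \<open>The surface measure is a cone measure, defined through Lebesgue measure on the ball, so
  the changes of variables take place on solid sets. Each boundary map is extended by one dimension
  to a map that is isometric along one direction (the radius of the ball, or the axis of a cylinder
  over the boundary of the half-space) and stretches by a factor \<open>c\<close> across it; the
  Jacobian is \<open>c ^ (n - 1)\<close>. The stretch is not read off an explicit derivative: both
  boundary maps are inversions, so distances between image points have a closed form, and this chord
  identity gives the stretch in the limit. The exponent \<open>s\<close> arises because
  \<open>\<bar>\<nabla>P \<bullet> l\<bar>\<close> is a constant times
  \<open>P * \<bar>\<eta> \<bullet> l\<bar>\<close>: of its power \<open>P powr q\<close>, one
  factor \<open>P\<close> is used up as the Jacobian, and what remains is the conformal factor to
  the power \<open>(n - 1) * (q - 1)\<close>. Since \<open>(p - 1) * (q - 1) = 1\<close>, this is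
  \<open>(n - 1) / (p - 1)\<close>, which turns the interval for \<open>s\<close> into the one for
  \<open>p\<close>. For \<open>w = 1\<close> the series sits at its radius of convergence.
  Nonnegativity of the coefficients settles this too: monotone convergence identifies the sum with a
  finite integral.\<close>

text \<open>The change of variables theorem of the library needs an index type of class
  \<open>wellorder\<close>. The orthonormal basis, well-ordered arbitrarily, provides one for every Euclidean space.\<close>
typedef (overloaded) 'a basis_index = "Basis :: 'a::euclidean_space set"
  using SOME_Basis by blast

instance basis_index :: (euclidean_space) finite
proof
  have "finite (Abs_basis_index ` (Basis :: 'a set))" by simp
  moreover have "Abs_basis_index ` (Basis :: 'a set) = UNIV"
    by (rule type_definition.Abs_image[OF type_definition_basis_index])
  ultimately show "finite (UNIV :: 'a basis_index set)" by simp
qed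

definition basis_rank :: "'a::euclidean_space basis_index \<Rightarrow> nat" where
  "basis_rank = (SOME f. inj f)"

lemma inj_basis_rank: "inj (basis_rank :: 'a::euclidean_space basis_index \<Rightarrow> nat)"
proof -
  obtain f :: "'a basis_index \<Rightarrow> nat" where "inj f"
    using finite_imp_inj_to_nat_seg[OF finite_class.finite_UNIV] by blast
  then show ?thesis unfolding basis_rank_def by (rule someI[of inj])
qed

lemma basis_rank_eqD: "(x::'a::euclidean_space basis_index) = y" if "basis_rank x = basis_rank y"
  using that injD[OF inj_basis_rank] by blast
instantiation basis_index :: (euclidean_space) wellorder
begin

definition less_eq_basis_index :: "'a basis_index \<Rightarrow> 'a basis_index \<Rightarrow> bool" where
  "i \<le> j \<longleftrightarrow> basis_rank i \<le> basis_rank j"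

definition less_basis_index :: "'a basis_index \<Rightarrow> 'a basis_index \<Rightarrow> bool" where
  "i < j \<longleftrightarrow> basis_rank i < basis_rank j"

instance
proof
  fix x y z :: "'a basis_index"
  show "(x < y) = (x \<le> y \<and> \<not> y \<le> x)" unfolding less_eq_basis_index_def less_basis_index_def by linarith
  show "x \<le> x" unfolding less_eq_basis_index_def by simp
  show "x \<le> y \<Longrightarrow> y \<le> z \<Longrightarrow> x \<le> z" unfolding less_eq_basis_index_def by simp
  show "x \<le> y \<Longrightarrow> y \<le> x \<Longrightarrow> x = y" unfolding less_eq_basis_index_def by (rule basis_rank_eqD) simp
  show "x \<le> y \<or> y \<le> x" unfolding less_eq_basis_index_def by linarith
next
  fix P :: "'a basis_index \<Rightarrow> bool" and a
  assume *: "\<And>x. (\<And>y. y < x \<Longrightarrow> P y) \<Longrightarrow> P x"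
  show "P a"
  proof (induction a rule: measure_induct_rule[where f = basis_rank])
    case (less x)
    show ?case by (rule *, rule less) (simp add: less_basis_index_def)
  qed
qed

end

section \<open>Orthonormal coordinates as a measure-preserving isometry\<close>

lemma Rep_basis_index_Basis [simp]: "Rep_basis_index i \<in> Basis"
  using Rep_basis_index by blast

lemma bij_betw_Rep_basis_index:
  "bij_betw Rep_basis_index (UNIV :: 'a::euclidean_space basis_index set) Basis"
  unfolding bij_betw_def
proof
  show "inj (Rep_basis_index :: 'a basis_index \<Rightarrow> 'a)"
    by (rule injI) (simp add: Rep_basis_index_inject)
  show "range (Rep_basis_index :: 'a basis_index \<Rightarrow> 'a) = Basis"
    by (rule type_definition.Rep_range[OF type_definition_basis_index])
qed

lemma CARD_basis_index: "CARD('a::euclidean_space basis_index) = DIM('a)"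
  by (rule bij_betw_same_card[OF bij_betw_Rep_basis_index])

definition to_vec :: "'a::euclidean_space \<Rightarrow> real ^ ('a basis_index)" where
  "to_vec x = (\<chi> i. x \<bullet> Rep_basis_index i)"

definition of_vec :: "real ^ ('a::euclidean_space basis_index) \<Rightarrow> 'a" where
  "of_vec v = (\<Sum>i\<in>UNIV. (v $ i) *\<^sub>R Rep_basis_index i)"

lemma linear_to_vec: "linear to_vec"
  by (rule linearI) (simp_all add: to_vec_def vec_eq_iff inner_add_left)

lemma linear_of_vec: "linear of_vec"
  by (rule linearI) (simp_all add: of_vec_def sum.distrib scaleR_add_left scaleR_sum_right)

lemma of_vec_inner_Rep: "of_vec v \<bullet> Rep_basis_index i = v $ i"
proof -
  have "of_vec v \<bullet> Rep_basis_index i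
      = (\<Sum>j\<in>UNIV. v $ j * (Rep_basis_index j \<bullet> Rep_basis_index i))"
    by (simp add: of_vec_def inner_sum_left)
  also have "\<dots> = (\<Sum>j\<in>UNIV. if j = i then v $ j else 0)"
    by (intro sum.cong refl) (auto simp: inner_Basis Rep_basis_index_inject)
  finally show ?thesis by simp
qed

lemma to_vec_of_vec [simp]: "to_vec (of_vec v) = v"
  by (simp add: to_vec_def of_vec_inner_Rep)

lemma of_vec_to_vec [simp]: "of_vec (to_vec x) = x"
proof (rule euclidean_eqI)
  fix b :: 'a assume "b \<in> Basis"
  then obtain i where "b = Rep_basis_index i"
    using bij_betw_imp_surj_on[OF bij_betw_Rep_basis_index] by blast
  then show "of_vec (to_vec x) \<bullet> b = x \<bullet> b"
    by (simp add: of_vec_inner_Rep) (simp add: to_vec_def)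
qed

lemma inner_to_vec [simp]: "to_vec x \<bullet> to_vec y = x \<bullet> y"
proof -
  have "to_vec x \<bullet> to_vec y = (\<Sum>i\<in>UNIV. (x \<bullet> Rep_basis_index i) * (y \<bullet> Rep_basis_index i))"
    by (simp add: inner_vec_def to_vec_def)
  also have "\<dots> = (\<Sum>b\<in>Basis. (x \<bullet> b) * (y \<bullet> b))"
    by (rule sum.reindex_bij_betw[OF bij_betw_Rep_basis_index])
  finally show ?thesis unfolding euclidean_inner[of x y] .
qed

lemma norm_to_vec [simp]: "norm (to_vec x) = norm x"
  by (simp add: norm_eq_sqrt_inner)

lemma norm_of_vec [simp]: "norm (of_vec v) = norm v"
  using norm_to_vec[of "of_vec v"] by simp

lemma inner_of_vec: "of_vec v \<bullet> x = v \<bullet> to_vec x"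
  using inner_to_vec[of "of_vec v" x] by simp

lemma of_vec_borel [measurable]: "of_vec \<in> borel_measurable borel"
proof (rule borel_measurable_continuous_onI)
  show "continuous_on UNIV of_vec"
    by (rule linear_continuous_on) (simp add: linear_of_vec linear_linear)
qed

text \<open>Lebesgue measure is determined by its values on boxes, and the coordinate map turns
  boxes into boxes with the same side lengths.\<close>

lemma lborel_distr_of_vec: "distr lborel borel of_vec = (lborel :: 'a::euclidean_space measure)"
proof (rule lborel_eqI[symmetric])
  fix l u :: 'a assume lu: "\<And>b. b \<in> Basis \<Longrightarrow> l \<bullet> b \<le> u \<bullet> b"
  have "of_vec -` box l u = box (to_vec l) (to_vec u)"
  proof (rule set_eqI)
    fix v :: "real ^ ('a basis_index)"
    have "(of_vec v \<in> box l u) \<longleftrightarrow> (\<forall>i. l \<bullet> Rep_basis_index i < v $ i \<and> v $ i < u \<bullet> Rep_basis_index i)"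
      unfolding mem_box bij_betw_imp_surj_on[OF bij_betw_Rep_basis_index, symmetric]
      by (simp add: of_vec_inner_Rep)
    then show "v \<in> of_vec -` box l u \<longleftrightarrow> v \<in> box (to_vec l) (to_vec u)"
      by (auto simp: mem_box_cart to_vec_def)
  qed
  then have "emeasure (distr lborel borel of_vec) (box l u) = emeasure lborel (box (to_vec l) (to_vec u))"
    by (subst emeasure_distr) auto
  also have "\<dots> = (\<Prod>b\<in>Basis. (to_vec u - to_vec l) \<bullet> b)"
    by (rule emeasure_lborel_box) (auto simp: Basis_vec_def inner_axis' to_vec_def lu inner_axis)
  also have "(\<Prod>b\<in>Basis. (to_vec u - to_vec l) \<bullet> b)
      = (\<Prod>i\<in>UNIV. (to_vec u - to_vec l) $ i)"
    unfolding Basis_vec_def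
    by (simp add: UNION_singleton_eq_range, subst prod.reindex)
       (auto simp: inj_on_def axis_eq_axis inner_axis)
  also have "\<dots> = (\<Prod>i\<in>UNIV. (u - l) \<bullet> Rep_basis_index i)"
    by (simp add: to_vec_def inner_diff_left)
  also have "\<dots> = (\<Prod>b\<in>Basis. (u - l) \<bullet> b)"
    by (rule prod.reindex_bij_betw[OF bij_betw_Rep_basis_index])
  finally show "emeasure (distr lborel borel of_vec) (box l u) = ennreal (\<Prod>b\<in>Basis. (u - l) \<bullet> b)" .
qed simp

text \<open>The quadratic form in \<open>q\<close> says that \<open>A\<close> stretches by 1 along
  \<open>e\<close> and by \<open>k\<close> across it. Precomposing with a rotation \<open>R\<close>
  onto \<open>e\<close> and a diagonal map \<open>D\<close> that divides by \<open>k\<close> off one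
  axis undoes the stretch: \<open>A \<circ> (R \<circ> D)\<close> is orthogonal, so the determinant
  of \<open>A\<close> is read off from that of \<open>D\<close>.\<close>

lemma abs_det_conformal:
  fixes A :: "real ^ 'k \<Rightarrow> real ^ 'k"
  assumes A: "linear A" and e: "norm e = 1" and k: "k > 0"
    and q: "\<And>v. (norm (A v))\<^sup>2 = (v \<bullet> e)\<^sup>2 + k\<^sup>2 * ((norm v)\<^sup>2 - (v \<bullet> e)\<^sup>2)"
  shows "\<bar>det (matrix A)\<bar> = k ^ (CARD('k) - 1)"
proof -
  obtain i :: 'k where True by simp
  obtain R :: "real ^ 'k \<Rightarrow> real ^ 'k" where R: "orthogonal_transformation R" "R (axis i 1) = e"
    using orthogonal_transformation_exists[of "axis i 1 :: real ^ 'k" e] e by (auto simp: norm_axis_1)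
  define d where "d = (\<lambda>j. if j = i then 1 else 1 / k)"
  define D where "D = (\<lambda>v :: real ^ 'k. \<chi> j. d j * v $ j)"
  have lR: "linear R" using R(1) by (simp add: orthogonal_transformation_linear)
  have lD: "linear D"
    by (rule linearI) (simp_all add: D_def vec_eq_iff algebra_simps)
  have nsq: "(norm v)\<^sup>2 = (v $ i)\<^sup>2 + (\<Sum>j\<in>UNIV - {i}. (v $ j)\<^sup>2)" for v :: "real ^ 'k"
    unfolding power2_norm_eq_inner inner_vec_def
    by (subst sum.remove[of _ i]) (auto simp: power2_eq_square)
  have nD: "(norm (D v))\<^sup>2 = (v $ i)\<^sup>2 + ((norm v)\<^sup>2 - (v $ i)\<^sup>2) / k\<^sup>2" for v
    unfolding nsq by (simp add: D_def d_def power_divide sum_divide_distrib)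
  have inn: "R u \<bullet> e = u $ i" for u
    using R orthogonal_transformation_def[of R] inner_axis[of u i 1] by (metis inner_real_def mult.right_neutral)
  have "(norm (A (R (D v))))\<^sup>2 = (norm v)\<^sup>2" for v
  proof -
    have "(norm (R (D v)))\<^sup>2 = (norm (D v))\<^sup>2"
      using R(1) by (simp add: orthogonal_transformation)
    moreover have "D v $ i = v $ i" by (simp add: D_def d_def)
    ultimately show ?thesis using k by (simp add: q inn nD)
  qed
  then have nO: "norm ((A \<circ> (R \<circ> D)) v) = norm v" for v
    by (simp add: power2_eq_iff_nonneg)
  have "orthogonal_transformation (A \<circ> (R \<circ> D))"
    unfolding orthogonal_transformation using nO A lR lD by (auto intro!: linear_compose)
  then have "\<bar>det (matrix (A \<circ> (R \<circ> D)))\<bar> = 1" by (rule orthogonal_transformation_det)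
  moreover have "\<bar>det (matrix R)\<bar> = 1" using R(1) by (rule orthogonal_transformation_det)
  moreover have "matrix (A \<circ> (R \<circ> D)) = matrix A ** (matrix R ** matrix D)"
    using A lR lD by (simp add: matrix_compose linear_compose)
  moreover have "det (matrix D) = (1 / k) ^ (CARD('k) - 1)"
  proof -
    have "det (matrix D) = (\<Prod>j\<in>UNIV. matrix D $ j $ j)"
      by (rule det_diagonal) (simp add: matrix_def D_def axis_def)
    also have "\<dots> = (\<Prod>j\<in>UNIV. d j)" by (simp add: matrix_def D_def)
    also have "\<dots> = d i * (\<Prod>j\<in>UNIV - {i}. d j)" by (rule prod.remove) auto
    also have "\<dots> = (1 / k) ^ (CARD('k) - 1)" by (simp add: d_def card_Diff_singleton)
    finally show ?thesis .
  qed
  ultimately have "\<bar>det (matrix A)\<bar> * (1 / k) ^ (CARD('k) - 1) = 1"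
    using k by (simp add: det_mul abs_mult)
  then show ?thesis using k by (simp add: power_one_over field_simps)
qed

text \<open>The change of variables formula in coordinates, with the Jacobian from
  \<open>abs_det_conformal\<close>. Boundedness of the image makes its measure finite, so that the
  formula can be stated as an integral with a real value.\<close>

lemma emeasure_conformal_image:
  fixes f :: "'a::euclidean_space \<Rightarrow> 'a"
  assumes S: "S \<in> sets borel" and im: "f ` S \<in> sets borel" "bounded (f ` S)" and inj: "inj_on f S"
    and der: "\<And>x. x \<in> S \<Longrightarrow> (f has_derivative f' x) (at x within S)"
    and q: "\<And>x v. x \<in> S \<Longrightarrow>
      (norm (f' x v))\<^sup>2 = (v \<bullet> e x)\<^sup>2 + (c x)\<^sup>2 * ((norm v)\<^sup>2 - (v \<bullet> e x)\<^sup>2)"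
    and e: "\<And>x. x \<in> S \<Longrightarrow> norm (e x) = 1" and c: "\<And>x. x \<in> S \<Longrightarrow> c x > 0"
    and cm [measurable]: "c \<in> borel_measurable borel"
  shows "emeasure lborel (f ` S) = (\<integral>\<^sup>+x\<in>S. ennreal (c x ^ (DIM('a) - 1)) \<partial>lborel)"
proof -
  define S' where "S' = of_vec -` S"
  define F where "F = (to_vec \<circ> f \<circ> of_vec :: real ^ 'a basis_index \<Rightarrow> _)"
  define F' where "F' = (\<lambda>z. to_vec \<circ> f' (of_vec z) \<circ> (of_vec :: real ^ 'a basis_index \<Rightarrow> 'a))"
  have bl: "bounded_linear (to_vec :: 'a \<Rightarrow> _)" "bounded_linear (of_vec :: _ \<Rightarrow> 'a)"
    using linear_to_vec linear_of_vec by (auto simp: linear_linear)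
  have [measurable]: "S' \<in> sets borel"
    using measurable_sets[OF of_vec_borel S] by (simp add: S'_def)
  have ov: "of_vec ` S' = S" unfolding S'_def
    by (metis of_vec_to_vec surj_def surj_image_vimage_eq)
  have dF: "(F has_derivative F' z) (at z within S')" if "z \<in> S'" for z
  proof -
    have "(of_vec has_derivative of_vec) (at z within S')"
      by (rule bounded_linear_imp_has_derivative[OF bl(2)])
    moreover have "(f has_derivative f' (of_vec z)) (at (of_vec z) within of_vec ` S')"
      unfolding ov using that by (intro der) (simp add: S'_def)
    ultimately have "(f \<circ> of_vec has_derivative f' (of_vec z) \<circ> of_vec) (at z within S')"
      by (rule diff_chain_within)
    then have "((\<lambda>z. to_vec ((f \<circ> of_vec) z)) has_derivative (\<lambda>h. to_vec ((f' (of_vec z) \<circ> of_vec) h))) (at z within S')"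
      by (rule bounded_linear.has_derivative[OF bl(1)])
    then show ?thesis by (simp add: F_def F'_def o_def)
  qed
  have det: "\<bar>det (matrix (F' z))\<bar> = c (of_vec z) ^ (DIM('a) - 1)" if "z \<in> S'" for z
  proof -
    have zS: "of_vec z \<in> S" using that by (simp add: S'_def)
    have "\<bar>det (matrix (F' z))\<bar> = c (of_vec z) ^ (CARD('a basis_index) - 1)"
    proof (rule abs_det_conformal)
      show "linear (F' z)" using dF[OF that] has_derivative_linear by blast
      show "norm (to_vec (e (of_vec z))) = 1" using e[OF zS] by simp
      show "c (of_vec z) > 0" using c[OF zS] .
      show "(norm (F' z v))\<^sup>2 = (v \<bullet> to_vec (e (of_vec z)))\<^sup>2 +
          (c (of_vec z))\<^sup>2 * ((norm v)\<^sup>2 - (v \<bullet> to_vec (e (of_vec z)))\<^sup>2)" for v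
        using q[OF zS, of "of_vec v"] by (simp add: F'_def inner_of_vec)
    qed
    then show ?thesis by (simp add: CARD_basis_index)
  qed
  have injF: "inj_on F S'"
  proof (rule inj_onI)
    fix a b assume *: "a \<in> S'" "b \<in> S'" "F a = F b"
    have "f (of_vec a) = f (of_vec b)"
      using arg_cong[OF *(3), of of_vec] by (simp add: F_def)
    then have "of_vec a = of_vec b" using inj * by (auto simp: S'_def inj_on_def)
    then show "a = b" by (metis to_vec_of_vec)
  qed
  have FS: "F ` S' = of_vec -` (f ` S)"
  proof -
    have "F ` S' = to_vec ` (f ` S)" unfolding F_def by (simp only: image_comp[symmetric] ov)
    also have "\<dots> = of_vec -` (f ` S)"
      by (auto simp: image_iff) (metis to_vec_of_vec)
    finally show ?thesis .
  qed
  have mFS: "F ` S' \<in> sets borel" unfolding FS using measurable_sets[OF of_vec_borel im(1)] by simp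
  have bFS: "bounded (F ` S')"
    using im(2) unfolding F_def bounded_iff by (auto simp: S'_def)
  have lm: "F ` S' \<in> lmeasurable"
    using bFS mFS by (intro bounded_set_imp_lmeasurable) auto
  have "((\<lambda>x. \<bar>det (matrix (F' x))\<bar>) has_integral measure lebesgue (F ` S')) S'"
    using has_measure_differentiable_image[of S' F F', OF _ dF injF] lm by auto
  then have hi: "((\<lambda>x. c (of_vec x) ^ (DIM('a) - 1)) has_integral measure lebesgue (F ` S')) S'"
    by (rule has_integral_eq[rotated]) (simp add: det)
  define h where "h = (\<lambda>x. indicator S x * c x ^ (DIM('a) - 1))"
  have [measurable]: "h \<in> borel_measurable borel"
    unfolding h_def using S by measurable
  have h0: "h x \<ge> 0" for x
    using c[of x] by (auto simp: h_def indicator_def)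
  have "((\<lambda>x. h (of_vec x)) has_integral measure lebesgue (F ` S')) UNIV"
    using hi by (subst (asm) has_integral_restrict_UNIV[symmetric])
      (rule has_integral_eq[rotated], assumption, auto simp: h_def S'_def indicator_def)
  then have "(\<integral>\<^sup>+x. ennreal (h (of_vec x)) \<partial>lborel) = ennreal (measure lebesgue (F ` S'))"
    using h0 by (intro nn_integral_has_integral_lborel) auto
  also have "\<dots> = emeasure lborel (F ` S')"
    using emeasure_eq_measure2[OF lm] mFS by simp
  also have "\<dots> = emeasure (distr lborel borel of_vec) (f ` S)"
    unfolding FS using im(1) by (subst emeasure_distr) auto
  finally have "emeasure lborel (f ` S) = (\<integral>\<^sup>+x. ennreal (h (of_vec x)) \<partial>lborel)"
    by (simp add: lborel_distr_of_vec)
  also have "\<dots> = (\<integral>\<^sup>+x. ennreal (h x) \<partial>distr lborel borel of_vec)"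
    by (subst nn_integral_distr) auto
  finally show ?thesis
    by (simp add: lborel_distr_of_vec h_def mult.commute ennreal_mult' ennreal_indicator[symmetric])
qed

text \<open>The image under \<open>f\<close> of the measure with density \<open>c ^ (n - 1)\<close>
  on \<open>S\<close> is Lebesgue measure on \<open>T\<close>: for each Borel set \<open>A\<close>
  this is \<open>emeasure_conformal_image\<close> on the part of \<open>S\<close> that
  \<open>f\<close> sends into \<open>A\<close>.\<close>

lemma nn_integral_conformal_change:
  fixes f :: "'a::euclidean_space \<Rightarrow> 'a"
  assumes S: "S \<in> sets borel" and T: "T \<in> sets borel" "bounded T" and bij: "bij_betw f S T"
    and fm [measurable]: "f \<in> borel_measurable borel"
    and der: "\<And>x. x \<in> S \<Longrightarrow> (f has_derivative f' x) (at x)"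
    and q: "\<And>x v. x \<in> S \<Longrightarrow>
      (norm (f' x v))\<^sup>2 = (v \<bullet> e x)\<^sup>2 + (c x)\<^sup>2 * ((norm v)\<^sup>2 - (v \<bullet> e x)\<^sup>2)"
    and e: "\<And>x. x \<in> S \<Longrightarrow> norm (e x) = 1" and c: "\<And>x. x \<in> S \<Longrightarrow> c x > 0"
    and cm [measurable]: "c \<in> borel_measurable borel"
    and gm [measurable]: "g \<in> borel_measurable borel"
  shows "(\<integral>\<^sup>+x\<in>S. ennreal (c x ^ (DIM('a) - 1)) * g (f x) \<partial>lborel) = (\<integral>\<^sup>+x\<in>T. g x \<partial>lborel)"
proof -
  note [measurable] = S T(1)
  define M where "M = density lborel (\<lambda>x. ennreal (c x ^ (DIM('a) - 1)) * indicator S x)"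
  have "distr M borel f = density lborel (indicator T)"
  proof (rule measure_eqI)
    fix A assume "A \<in> sets (distr M borel f)"
    then have A [measurable]: "A \<in> sets borel" by simp
    have fA: "f -` A \<in> sets borel" using measurable_sets[OF fm A] by simp
    have im: "f ` (S \<inter> f -` A) = T \<inter> A" using bij by (auto simp: bij_betw_def)
    have "emeasure (distr M borel f) A = emeasure M (f -` A)"
      by (subst emeasure_distr) (auto simp: M_def)
    also have "\<dots> = (\<integral>\<^sup>+x\<in>S \<inter> f -` A. ennreal (c x ^ (DIM('a) - 1)) \<partial>lborel)"
      unfolding M_def using fA by (subst emeasure_density) (auto simp: indicator_def intro!: nn_integral_cong)
    also have "\<dots> = emeasure lborel (f ` (S \<inter> f -` A))"
    proof (rule emeasure_conformal_image[symmetric, where f' = f' and e = e])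
      show "S \<inter> f -` A \<in> sets borel" using fA by auto
      show "f ` (S \<inter> f -` A) \<in> sets borel" unfolding im by auto
      show "bounded (f ` (S \<inter> f -` A))" unfolding im using T(2) by (rule bounded_Int[OF disjI1])
      show "inj_on f (S \<inter> f -` A)" using bij by (auto simp: bij_betw_def inj_on_def)
    qed (use der q e c in \<open>auto intro: has_derivative_at_withinI\<close>)
    also have "\<dots> = emeasure (density lborel (indicator T)) A"
      unfolding im by (subst emeasure_density) (auto simp: indicator_inter_arith[symmetric])
    finally show "emeasure (distr M borel f) A = emeasure (density lborel (indicator T)) A" .
  qed simp
  then have "(\<integral>\<^sup>+x. g x \<partial>distr M borel f) = (\<integral>\<^sup>+x. g x \<partial>density lborel (indicator T))" by simp
  also have "(\<integral>\<^sup>+x. g x \<partial>density lborel (indicator T)) = (\<integral>\<^sup>+x\<in>T. g x \<partial>lborel)"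
    by (subst nn_integral_density) (auto simp: mult.commute)
  also have "(\<integral>\<^sup>+x. g x \<partial>distr M borel f) = (\<integral>\<^sup>+x. g (f x) \<partial>M)"
    by (subst nn_integral_distr) (auto simp: M_def)
  also have "\<dots> = (\<integral>\<^sup>+x\<in>S. ennreal (c x ^ (DIM('a) - 1)) * g (f x) \<partial>lborel)"
    unfolding M_def by (subst nn_integral_density) (auto simp: mult_ac)
  finally show ?thesis .
qed

lemma derivative_chord_limit:
  fixes f :: "'a::real_normed_vector \<Rightarrow> 'b::real_normed_vector"
  assumes "(f has_derivative A) (at z)"
  shows "((\<lambda>t. (f (z + t *\<^sub>R v) - f z) /\<^sub>R t) \<longlongrightarrow> A v) (at 0)"
proof -
  have l: "((\<lambda>t. z + t *\<^sub>R v) has_derivative (\<lambda>t. t *\<^sub>R v)) (at 0)"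
    by (auto intro!: derivative_eq_intros)
  have A: "linear A" using assms has_derivative_linear by blast
  have "((\<lambda>t. f (z + t *\<^sub>R v)) has_derivative (\<lambda>t. A (t *\<^sub>R v))) (at 0)"
    using assms by (intro has_derivative_compose[OF l]) simp
  then have "((\<lambda>t. f (z + t *\<^sub>R v)) has_vector_derivative A v) (at 0)"
    by (simp add: has_vector_derivative_def linear_scale[OF A])
  then have "((\<lambda>t. norm (f (z + t *\<^sub>R v) - f z - t *\<^sub>R A v) / norm t) \<longlongrightarrow> 0) (at 0)"
    by (simp add: has_vector_derivative_def has_derivative_at)
  then have "((\<lambda>t. norm ((f (z + t *\<^sub>R v) - f z) /\<^sub>R t - A v)) \<longlongrightarrow> 0) (at 0)"
  proof (rule Lim_transform_eventually)
    have "\<forall>\<^sub>F t in at (0::real). t \<noteq> 0" by (rule eventually_neq_at_within)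
    then show "\<forall>\<^sub>F t in at 0. norm (f (z + t *\<^sub>R v) - f z - t *\<^sub>R A v) / norm t
        = norm ((f (z + t *\<^sub>R v) - f z) /\<^sub>R t - A v)"
    proof eventually_elim
      case (elim t)
      then have "(f (z + t *\<^sub>R v) - f z) /\<^sub>R t - A v = (f (z + t *\<^sub>R v) - f z - t *\<^sub>R A v) /\<^sub>R t"
        by (simp add: scaleR_diff_right)
      then show ?case by (simp add: divide_inverse mult.commute)
    qed
  qed
  then show ?thesis using Lim_null tendsto_norm_zero_iff by blast
qed

text \<open>A function whose chords satisfy this identity stretches by the factor 1 in the direction
  \<open>e\<close> and by \<open>c z\<close> orthogonally to it.\<close>
lemma chord_identity_derivative:
  fixes f :: "'a::real_inner \<Rightarrow> 'b::real_inner"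
  assumes S: "open S" "z \<in> S" and f: "(f has_derivative A) (at z)"
    and n: "(\<nu> has_derivative (\<lambda>v. v \<bullet> e)) (at z)" and c: "isCont c z"
    and chord: "\<And>w. w \<in> S \<Longrightarrow> (norm (f w - f z))\<^sup>2
      = (\<nu> w - \<nu> z)\<^sup>2 + c w * c z * ((norm (w - z))\<^sup>2 - (\<nu> w - \<nu> z)\<^sup>2)"
  shows "(norm (A v))\<^sup>2 = (v \<bullet> e)\<^sup>2 + (c z)\<^sup>2 * ((norm v)\<^sup>2 - (v \<bullet> e)\<^sup>2)"
proof (rule tendsto_unique)
  let ?w = "\<lambda>t::real. z + t *\<^sub>R v"
  let ?d = "\<lambda>t. (\<nu> (?w t) - \<nu> z) /\<^sub>R t"
  have cw: "(?w \<longlongrightarrow> z) (at 0)" by (auto intro!: tendsto_eq_intros)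
  show "((\<lambda>t. (norm ((f (?w t) - f z) /\<^sub>R t))\<^sup>2) \<longlongrightarrow> (norm (A v))\<^sup>2) (at 0)"
    by (intro tendsto_intros derivative_chord_limit f)
  \<comment> \<open>The chord identity at \<open>w = z + t v\<close> is divided by
    \<open>t\<^sup>2\<close>. As \<open>t\<close> tends to 0, continuity turns
    \<open>c w * c z\<close> into \<open>(c z)\<^sup>2\<close>.\<close>
  have "((\<lambda>t. (?d t)\<^sup>2 + c (?w t) * c z * ((norm v)\<^sup>2 - (?d t)\<^sup>2))
      \<longlongrightarrow> (v \<bullet> e)\<^sup>2 + c z * c z * ((norm v)\<^sup>2 - (v \<bullet> e)\<^sup>2)) (at 0)"
    by (intro tendsto_intros derivative_chord_limit n isCont_tendsto_compose[OF c cw])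
  moreover have "\<forall>\<^sub>F t in at 0. (?d t)\<^sup>2 + c (?w t) * c z * ((norm v)\<^sup>2 - (?d t)\<^sup>2)
      = (norm ((f (?w t) - f z) /\<^sub>R t))\<^sup>2"
  proof -
    have "\<forall>\<^sub>F t in at 0. ?w t \<in> S" using topological_tendstoD[OF cw S] .
    moreover have "\<forall>\<^sub>F t in at (0::real). t \<noteq> 0" by (rule eventually_neq_at_within)
    ultimately show ?thesis
    proof eventually_elim
      case (elim t)
      have "(norm ((f (?w t) - f z) /\<^sub>R t))\<^sup>2 = (norm (f (?w t) - f z))\<^sup>2 / t\<^sup>2"
        by (simp add: power_mult_distrib power_inverse divide_inverse mult.commute)
      also have "\<dots> = ((\<nu> (?w t) - \<nu> z)\<^sup>2
          + c (?w t) * c z * (t\<^sup>2 * (norm v)\<^sup>2 - (\<nu> (?w t) - \<nu> z)\<^sup>2)) / t\<^sup>2"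
        using chord[OF elim(1)] by (simp add: power_mult_distrib)
      also have "\<dots> = (?d t)\<^sup>2 + c (?w t) * c z * ((norm v)\<^sup>2 - (?d t)\<^sup>2)"
        using elim(2) by (simp add: divide_simps power_mult_distrib power_inverse)
      finally show ?case by simp
    qed
  qed
  ultimately show "((\<lambda>t. (norm ((f (?w t) - f z) /\<^sub>R t))\<^sup>2)
      \<longlongrightarrow> (v \<bullet> e)\<^sup>2 + (c z)\<^sup>2 * ((norm v)\<^sup>2 - (v \<bullet> e)\<^sup>2)) (at 0)"
    unfolding power2_eq_square[of "c z"] by (rule Lim_transform_eventually)
qed simp

subsection \<open>The surface measure and its moments\<close>

lemma nn_integral_sphere_measure:
  fixes g :: "'a::euclidean_space \<Rightarrow> ennreal"
  assumes [measurable]: "g \<in> borel_measurable borel"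
  shows "(\<integral>\<^sup>+z. g z \<partial>sphere_measure)
    = (\<integral>\<^sup>+z\<in>ball 0 1. g (sgn z) \<partial>lborel) / emeasure lborel (ball (0::'a) 1)"
proof -
  note [measurable] = sgn_borel_measurable
  have [measurable]: "sphere (0::'a) 1 \<in> sets borel" "ball (0::'a) 1 \<in> sets borel" by simp_all
  let ?U = "uniform_measure lborel (ball (0::'a) 1)"
  have m [measurable]: "(sgn :: 'a \<Rightarrow> 'a) \<in> measurable ?U borel"
    by (subst measurable_cong_sets[of _ borel _ borel]) auto
  have "(\<integral>\<^sup>+z. g z \<partial>sphere_measure) = (\<integral>\<^sup>+z. g z * indicator (sphere 0 1) z \<partial>distr ?U borel sgn)"
    unfolding sphere_measure_def nn_integral_completion
    by (subst nn_integral_restrict_space) auto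
  also have "\<dots> = (\<integral>\<^sup>+z. g (sgn z) * indicator (sphere 0 1) (sgn z) \<partial>?U)"
    by (subst nn_integral_distr) auto
  also have "\<dots> = (\<integral>\<^sup>+z\<in>ball 0 1. (g (sgn z) * indicator (sphere 0 1) (sgn z)) \<partial>lborel)
      / emeasure lborel (ball (0::'a) 1)"
    by (subst nn_integral_uniform_measure) auto
  also have "(\<integral>\<^sup>+z\<in>ball 0 1. (g (sgn z) * indicator (sphere 0 1) (sgn z)) \<partial>lborel)
      = (\<integral>\<^sup>+z\<in>ball 0 1. g (sgn z) \<partial>lborel)"
    using AE_lborel_singleton[of "0::'a"]
    by (intro nn_integral_cong_AE, eventually_elim) (auto simp: norm_sgn indicator_def)
  finally show ?thesis .
qed

lemma emeasure_unit_ball: "emeasure lborel (ball (0::'a::euclidean_space) 1) = ennreal (unit_ball_vol DIM('a))"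
  by (simp add: emeasure_ball)

lemma nn_integral_sphere_measure_times:
  fixes g :: "'a::euclidean_space \<Rightarrow> ennreal"
  assumes [measurable]: "g \<in> borel_measurable borel"
  shows "(\<integral>\<^sup>+z\<in>ball 0 1. g (sgn z) \<partial>lborel)
    = ennreal (unit_ball_vol DIM('a)) * (\<integral>\<^sup>+z. g z \<partial>sphere_measure)"
  unfolding nn_integral_sphere_measure[OF assms] emeasure_unit_ball
  by (subst ennreal_times_divide, subst mult.commute, subst mult_divide_eq_ennreal)
     (use less_imp_neq[OF unit_ball_vol_pos[of "real DIM('a)"]] in auto)

section \<open>Rotation invariance of the surface measure\<close>

lemma nn_integral_sphere_orthogonal:
  fixes f :: "'a::euclidean_space \<Rightarrow> 'a"
  assumes f: "orthogonal_transformation f" and g [measurable]: "g \<in> borel_measurable borel"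
  shows "(\<integral>\<^sup>+z. g (f z) \<partial>sphere_measure) = (\<integral>\<^sup>+z. g z \<partial>sphere_measure)"
proof -
  note [measurable] = sgn_borel_measurable
  have lf: "linear f" using f by (simp add: orthogonal_transformation_linear)
  then have bl: "bounded_linear f" by (simp add: linear_linear)
  have [measurable]: "f \<in> borel_measurable borel"
    by (intro borel_measurable_continuous_onI linear_continuous_on bl)
  have nf: "norm (f z) = norm z" for z using f by (simp add: orthogonal_transformation)
  have sf: "f (sgn z) = sgn (f z)" for z
    by (simp add: sgn_div_norm nf linear_scale[OF lf])
  \<comment> \<open>With \<open>c = 1\<close> the stretch condition just says that \<open>f\<close>
    is an isometry, so any unit vector can serve as the unstretched direction.\<close>
  obtain b :: 'a where b: "b \<in> Basis" using SOME_Basis by blast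
  have bij: "bij_betw f (ball 0 1) (ball 0 1)"
    unfolding bij_betw_def
    using image_orthogonal_transformation_ball[OF f, of 0 1] orthogonal_transformation_inj[OF f] lf
    by (auto simp: linear_0 intro: inj_on_subset)
  have "(\<integral>\<^sup>+z\<in>ball 0 1. ennreal (1 ^ (DIM('a) - 1)) * g (sgn (f z)) \<partial>lborel)
      = (\<integral>\<^sup>+z\<in>ball 0 1. g (sgn z) \<partial>lborel)"
    by (rule nn_integral_conformal_change[where f' = "\<lambda>_. f" and e = "\<lambda>_. b" and g = "\<lambda>x. g (sgn x)"])
       (use bij b in \<open>auto simp: nf bounded_linear_imp_has_derivative[OF bl]\<close>)
  then show ?thesis by (simp add: nn_integral_sphere_measure sf)
qed

text \<open>The Householder reflection in the hyperplane orthogonal to \<open>w\<close>; for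
  \<open>w = 0\<close> it is the identity.\<close>

definition reflect :: "'a::real_inner \<Rightarrow> 'a \<Rightarrow> 'a" where
  "reflect w z = z - (2 * (z \<bullet> w) / (w \<bullet> w)) *\<^sub>R w"

lemma orthogonal_transformation_reflect: "orthogonal_transformation (reflect (w::'a::euclidean_space))"
proof -
  have "linear (reflect w)"
    by (rule linearI) (simp_all add: reflect_def inner_add_left algebra_simps add_divide_distrib)
  moreover have "reflect w v \<bullet> reflect w v = v \<bullet> v" for v
    by (cases "w = 0")
       (simp_all add: reflect_def inner_diff_left inner_diff_right inner_commute field_simps)
  ultimately show ?thesis
    by (simp add: orthogonal_transformation norm_eq_sqrt_inner)
qed

lemma reflect_swap:
  assumes "norm a = norm b"
  shows "reflect (a - b) a = b"
proof (cases "a = b")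
  case False
  have "a \<bullet> a = b \<bullet> b" using assms by (simp add: norm_eq_sqrt_inner)
  then have *: "2 * (a \<bullet> (a - b)) = (a - b) \<bullet> (a - b)"
    by (simp add: inner_diff_left inner_diff_right inner_commute)
  then show ?thesis using False unfolding reflect_def * by simp
qed (simp add: reflect_def)

lemma nn_integral_sphere_minus:
  fixes g :: "'a::euclidean_space \<Rightarrow> ennreal"
  assumes "g \<in> borel_measurable borel"
  shows "(\<integral>\<^sup>+z. g (- z) \<partial>sphere_measure) = (\<integral>\<^sup>+z. g z \<partial>sphere_measure)"
  by (rule nn_integral_sphere_orthogonal[OF _ assms]) (simp add: orthogonal_transformation linear_uminus)

text \<open>The reflection along \<open>e - e'\<close> carries \<open>e\<close> to
  \<open>e'\<close>, and the surface measure is invariant under it.\<close>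

lemma nn_integral_sphere_zonal:
  fixes e e' :: "'a::euclidean_space" and g :: "real \<Rightarrow> ennreal"
  assumes "norm e = 1" "norm e' = 1" and [measurable]: "g \<in> borel_measurable borel"
  shows "(\<integral>\<^sup>+z. g (z \<bullet> e) \<partial>sphere_measure) = (\<integral>\<^sup>+z. g (z \<bullet> e') \<partial>sphere_measure)"
proof -
  let ?R = "reflect (e - e')"
  note R = orthogonal_transformation_reflect[of "e - e'"]
  have "z \<bullet> e = ?R z \<bullet> e'" for z
    using R reflect_swap[of e e'] assms by (metis orthogonal_transformation_def)
  then show ?thesis
    using nn_integral_sphere_orthogonal[OF R, of "\<lambda>z. g (z \<bullet> e')"] by simp
qed

section \<open>Polar coordinates and Gaussian integrals\<close>

lemma nn_integral_ball_scale:
  fixes g :: "'a::euclidean_space \<Rightarrow> ennreal"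
  assumes g [measurable]: "g \<in> borel_measurable borel" and r: "r > 0"
  shows "(\<integral>\<^sup>+z\<in>ball 0 r. g (sgn z) \<partial>lborel)
    = ennreal (r ^ DIM('a) * unit_ball_vol DIM('a)) * (\<integral>\<^sup>+z. g z \<partial>sphere_measure)"
proof -
  note [measurable] = sgn_borel_measurable
  have [measurable]: "ball (0::'a) r \<in> sets borel" by simp
  have "(\<integral>\<^sup>+z\<in>ball 0 r. g (sgn z) \<partial>lborel)
    = (\<integral>\<^sup>+z\<in>ball 0 r. g (sgn z) \<partial>density (distr lborel borel (\<lambda>x. 0 + r *\<^sub>R x)) (\<lambda>_. ennreal (\<bar>r\<bar> ^ DIM('a))))"
    using lborel_affine[of r "0::'a"] r by simp
  also have "\<dots> = (\<integral>\<^sup>+z. ennreal (r ^ DIM('a)) * (g (sgn (r *\<^sub>R z)) * indicator (ball 0 r) (r *\<^sub>R z)) \<partial>lborel)"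
    using r by (subst nn_integral_density, measurable, subst nn_integral_distr) auto
  also have "\<dots> = ennreal (r ^ DIM('a)) * (\<integral>\<^sup>+z. g (sgn (r *\<^sub>R z)) * indicator (ball 0 r) (r *\<^sub>R z) \<partial>lborel)"
    by (subst nn_integral_cmult) auto
  also have "(\<integral>\<^sup>+z. g (sgn (r *\<^sub>R z)) * indicator (ball 0 r) (r *\<^sub>R z) \<partial>lborel)
      = (\<integral>\<^sup>+z\<in>ball 0 1. g (sgn z) \<partial>lborel)"
    using r by (intro nn_integral_cong) (auto simp: sgn_scaleR indicator_def)
  finally show ?thesis
    using r by (simp add: nn_integral_sphere_measure_times ennreal_mult mult.assoc unit_ball_vol_nonneg)
qed

lemma nn_integral_monomial:
  fixes r :: real
  assumes "r \<ge> 0" "n > 0"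
  shows "(\<integral>\<^sup>+\<rho>\<in>{0<..<r}. ennreal (real n * \<rho> ^ (n - 1)) \<partial>lborel) = ennreal (r ^ n)"
proof -
  have "(\<integral>\<^sup>+\<rho>\<in>{0<..<r}. ennreal (real n * \<rho> ^ (n - 1)) \<partial>lborel)
      = (\<integral>\<^sup>+\<rho>. ennreal (real n * \<rho> ^ (n - 1)) * indicator {0..r} \<rho> \<partial>lborel)"
    using AE_lborel_singleton[of "0::real"] AE_lborel_singleton[of r]
    by (intro nn_integral_cong_AE, eventually_elim) (auto simp: indicator_def)
  also have "\<dots> = ennreal (r ^ n - 0 ^ n)"
    using assms by (intro nn_integral_FTC_Icc) (auto intro!: derivative_eq_intros)
  finally show ?thesis using assms by simp
qed

text \<open>For fixed \<open>g\<close> both sides integrate \<open>h\<close> against a measure on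
  the line, called \<open>M\<close> and \<open>density lborel D\<close> below. By homogeneity of
  balls the two agree on all half-lines \<open>{..<r}\<close>, which form an intersection-stable
  generator. The bound \<open>g \<le> 1\<close> keeps these values finite, as uniqueness of measures
  requires.\<close>

lemma nn_integral_polar:
  fixes g :: "'a::euclidean_space \<Rightarrow> ennreal" and h :: "real \<Rightarrow> ennreal"
  assumes g [measurable]: "g \<in> borel_measurable borel" and g1: "\<And>z. z \<in> sphere 0 1 \<Longrightarrow> g z \<le> 1"
    and h [measurable]: "h \<in> borel_measurable borel"
  shows "(\<integral>\<^sup>+z. h (norm z) * g (sgn z) \<partial>lborel)
    = ennreal (unit_ball_vol DIM('a)) * (\<integral>\<^sup>+z. g z \<partial>sphere_measure)
      * (\<integral>\<^sup>+\<rho>\<in>{0<..}. ennreal (real DIM('a) * \<rho> ^ (DIM('a) - 1)) * h \<rho> \<partial>lborel)"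
proof -
  note [measurable] = sgn_borel_measurable
  define V where "V = ennreal (unit_ball_vol DIM('a)) * (\<integral>\<^sup>+z. g z \<partial>(sphere_measure :: 'a measure))"
  define D where "D = (\<lambda>\<rho>. V * (ennreal (real DIM('a) * \<rho> ^ (DIM('a) - 1)) * indicator {0<..} \<rho>))"
  have [measurable]: "D \<in> borel_measurable borel" unfolding D_def by measurable
  define M where "M = distr (density lborel (\<lambda>z::'a. g (sgn z))) borel norm"
  have "(\<integral>\<^sup>+z. g z \<partial>(sphere_measure :: 'a measure)) \<le> (\<integral>\<^sup>+z. 1 \<partial>(sphere_measure :: 'a measure))"
    by (intro nn_integral_mono g1) (simp add: space_sphere_measure)
  also have "\<dots> = 1" using emeasure_sphere_measure_total[where 'a='a] by (simp add: space_sphere_measure)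
  finally have Vfin: "V < \<infinity>" unfolding V_def by (auto simp: ennreal_mult_less_top le_less_trans)
  have M: "emeasure M {..<r} = V * ennreal (max 0 r ^ DIM('a))" for r
  proof -
    have "emeasure M {..<r} = emeasure (density lborel (\<lambda>z::'a. g (sgn z))) (ball 0 r)"
      unfolding M_def by (subst emeasure_distr) (auto intro!: arg_cong[where f = "emeasure _"])
    also have "\<dots> = (\<integral>\<^sup>+z\<in>ball 0 r. g (sgn z) \<partial>lborel)"
      by (subst emeasure_density) auto
    also have "\<dots> = V * ennreal (max 0 r ^ DIM('a))"
    proof (cases "r > 0")
      case True
      then show ?thesis by (simp add: nn_integral_ball_scale V_def ennreal_mult unit_ball_vol_nonneg mult_ac)
    qed (simp add: ball_empty)
    finally show ?thesis .
  qed
  have N: "emeasure (density lborel D) {..<r} = V * ennreal (max 0 r ^ DIM('a))" for r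
  proof -
    have "emeasure (density lborel D) {..<r} = (\<integral>\<^sup>+\<rho>. D \<rho> * indicator {..<r} \<rho> \<partial>lborel)"
      by (subst emeasure_density) auto
    also have "\<dots> = (\<integral>\<^sup>+\<rho>. V * (ennreal (real DIM('a) * \<rho> ^ (DIM('a) - 1)) * indicator {0<..<max 0 r} \<rho>) \<partial>lborel)"
      unfolding D_def by (intro nn_integral_cong) (auto simp: indicator_def)
    also have "\<dots> = V * ennreal (max 0 r ^ DIM('a))"
      by (subst nn_integral_cmult, measurable, subst nn_integral_monomial) auto
    finally show ?thesis .
  qed
  have MN: "M = density lborel D"
  proof (rule measure_eqI_generator_eq[where E = "range (\<lambda>a::real. {..<a})" and \<Omega> = UNIV and A = "\<lambda>i. {..<real i}"])
    show "Int_stable (range (\<lambda>a::real. {..<a}))"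
    proof (rule Int_stableI_image)
      fix a b :: real
      have "{..<a} \<inter> {..<b} = {..<min a b}" by auto
      then show "\<exists>c\<in>UNIV. {..<a} \<inter> {..<b} = {..<c}" by blast
    qed
    show "sets M = sigma_sets UNIV (range (\<lambda>a::real. {..<a}))"
      "sets (density lborel D) = sigma_sets UNIV (range (\<lambda>a::real. {..<a}))"
      by (simp_all add: M_def borel_Iio)
    show "\<Union> (range (\<lambda>i. {..<real i})) = UNIV"
      using reals_Archimedean2 by auto
    show "emeasure M {..<real i} \<noteq> \<infinity>" for i
      unfolding M using Vfin by (auto simp: ennreal_mult_eq_top_iff)
  qed (auto simp: M N)
  have "(\<integral>\<^sup>+\<rho>. h \<rho> \<partial>M) = (\<integral>\<^sup>+z. h (norm z) * g (sgn z) \<partial>lborel)"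
    unfolding M_def by (subst nn_integral_distr) (auto simp: nn_integral_density mult.commute)
  moreover have "(\<integral>\<^sup>+\<rho>. h \<rho> \<partial>density lborel D)
      = (\<integral>\<^sup>+\<rho>. V * (ennreal (real DIM('a) * \<rho> ^ (DIM('a) - 1)) * h \<rho> * indicator {0<..} \<rho>) \<partial>lborel)"
    unfolding D_def by (subst nn_integral_density) (auto simp: mult_ac)
  moreover have "\<dots> = V * (\<integral>\<^sup>+\<rho>\<in>{0<..}. ennreal (real DIM('a) * \<rho> ^ (DIM('a) - 1)) * h \<rho> \<partial>lborel)"
    by (subst nn_integral_cmult) auto
  ultimately show ?thesis unfolding V_def[symmetric] using MN by simp
qed

text \<open>The substitution \<open>t = \<rho>\<^sup>2\<close> in Euler's integral for
  \<open>Gamma (s / 2)\<close>; the factor 1/2 compensates the Jacobian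
  \<open>2 * \<rho>\<close>.\<close>

lemma nn_integral_Gaussian_half_line:
  fixes s :: real
  assumes "s > 0"
  shows "(\<integral>\<^sup>+\<rho>\<in>{0<..}. ennreal (\<rho> powr (s - 1) * exp (- \<rho>\<^sup>2)) \<partial>lborel) = ennreal (Gamma (s / 2) / 2)"
proof -
  define f where "f = (\<lambda>t::real. t powr (s / 2 - 1) / exp t)"
  have "(f has_integral Gamma (s / 2)) {0..}"
    unfolding f_def using assms by (intro Gamma_integral_real) simp
  \<comment> \<open>The endpoint 0 is removed because the substitution is carried out on the open
    half-line.\<close>
  then have f: "(f has_integral Gamma (s / 2)) {0<..}"
    by (subst (asm) has_integral_spike_set_eq[of _ "{0<..}"])
      (auto intro: negligible_subset[of "{0::real}"])
  then have fa: "f absolutely_integrable_on {0<..}"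
    by (intro nonnegative_absolutely_integrable_1) (auto simp: f_def has_integral_iff)
  have im: "(\<lambda>\<rho>::real. \<rho>\<^sup>2) ` {0<..} = {0<..}"
  proof (intro equalityI subsetI)
    fix t :: real assume "t \<in> {0<..}"
    then show "t \<in> (\<lambda>\<rho>. \<rho>\<^sup>2) ` {0<..}" by (intro image_eqI[of _ _ "sqrt t"]) auto
  qed auto
  have inj: "inj_on (\<lambda>\<rho>::real. \<rho>\<^sup>2) {0<..}"
    by (auto intro!: inj_onI power2_eq_imp_eq)
  have der: "((\<lambda>\<rho>. \<rho>\<^sup>2) has_field_derivative 2 * \<rho>) (at \<rho> within {0<..})" for \<rho> :: real
    by (auto intro!: derivative_eq_intros)
  have "(\<lambda>\<rho>. \<bar>2 * \<rho>\<bar> * f (\<rho>\<^sup>2)) absolutely_integrable_on {0<..} \<and>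
      integral {0<..} (\<lambda>\<rho>. \<bar>2 * \<rho>\<bar> * f (\<rho>\<^sup>2)) = Gamma (s / 2)"
    unfolding has_absolute_integral_change_of_variables_1'[OF _ der inj, of f, simplified] im
    using fa integral_unique[OF f] by blast
  then have "((\<lambda>\<rho>. \<bar>2 * \<rho>\<bar> * f (\<rho>\<^sup>2)) has_integral Gamma (s / 2)) {0<..}"
    by (simp add: has_integral_iff set_lebesgue_integral_eq_integral(1))
  then have hi: "((\<lambda>\<rho>. 1/2 * (\<bar>2 * \<rho>\<bar> * f (\<rho>\<^sup>2))) has_integral 1/2 * Gamma (s / 2)) {0<..}"
    by (rule has_integral_mult_right)
  have eq: "1/2 * (\<bar>2 * \<rho>\<bar> * f (\<rho>\<^sup>2)) = \<rho> powr (s - 1) * exp (- \<rho>\<^sup>2)" if r: "\<rho> > 0" for \<rho> :: real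
  proof -
    have "(\<rho>\<^sup>2) powr (s / 2 - 1) = (\<rho> powr 2) powr (s / 2 - 1)" using r by simp
    also have "\<dots> = \<rho> powr (2 * (s / 2 - 1))" by (rule powr_powr)
    also have "2 * (s / 2 - 1) = s - 2" by simp
    finally have "(\<rho>\<^sup>2) powr (s / 2 - 1) = \<rho> powr (s - 2)" .
    moreover have "\<rho> * \<rho> powr (s - 2) = \<rho> powr (s - 1)"
      using r powr_add[of \<rho> 1 "s - 2"] by simp
    moreover have "1/2 * (\<bar>2 * \<rho>\<bar> * f (\<rho>\<^sup>2)) = \<rho> * (\<rho>\<^sup>2) powr (s / 2 - 1) * exp (- \<rho>\<^sup>2)"
      unfolding f_def exp_minus inverse_eq_divide using r by simp
    ultimately show ?thesis by simp
  qed
  have "((\<lambda>\<rho>. \<rho> powr (s - 1) * exp (- \<rho>\<^sup>2)) has_integral 1/2 * Gamma (s / 2)) {0<..}"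
    by (rule has_integral_eq[OF _ hi], rule eq, simp)
  from nn_integral_has_integral_lebesgue'[OF _ this] show ?thesis by simp
qed

lemma nn_integral_Gaussian_line:
  fixes a :: real
  assumes "a \<ge> 0"
  shows "(\<integral>\<^sup>+t. ennreal (\<bar>t\<bar> powr a * exp (- t\<^sup>2)) \<partial>lborel) = ennreal (Gamma ((a + 1) / 2))"
proof -
  let ?f = "\<lambda>t. ennreal (\<bar>t\<bar> powr a * exp (- t\<^sup>2))"
  have pos: "(\<integral>\<^sup>+t\<in>{0<..}. ?f t \<partial>lborel) = ennreal (Gamma ((a + 1) / 2) / 2)"
  proof -
    have "(\<integral>\<^sup>+t\<in>{0<..}. ?f t \<partial>lborel)
        = (\<integral>\<^sup>+t\<in>{0<..}. ennreal (t powr (a + 1 - 1) * exp (- t\<^sup>2)) \<partial>lborel)"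
      by (intro nn_integral_cong) (auto simp: indicator_def)
    then show ?thesis using nn_integral_Gaussian_half_line[of "a + 1"] assms by simp
  qed
  have neg: "(\<integral>\<^sup>+t\<in>{..<0}. ?f t \<partial>lborel) = (\<integral>\<^sup>+t\<in>{0<..}. ?f t \<partial>lborel)"
    by (subst nn_integral_real_affine[where c = "-1" and t = 0])
       (auto simp: indicator_def intro!: nn_integral_cong)
  have "(\<integral>\<^sup>+t. ?f t \<partial>lborel) = (\<integral>\<^sup>+t. ?f t * indicator {0<..} t + ?f t * indicator {..<0} t \<partial>lborel)"
    using AE_lborel_singleton[of "0::real"]
    by (intro nn_integral_cong_AE, eventually_elim) (auto simp: indicator_def)
  also have "\<dots> = (\<integral>\<^sup>+t\<in>{0<..}. ?f t \<partial>lborel) + (\<integral>\<^sup>+t\<in>{..<0}. ?f t \<partial>lborel)"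
    by (subst nn_integral_add) auto
  also have "\<dots> = ennreal (Gamma ((a + 1) / 2))"
    unfolding neg pos using assms by (subst ennreal_plus[symmetric]) (auto intro: Gamma_real_nonneg)
  finally show ?thesis .
qed

text \<open>The Gaussian integral of \<open>\<bar>z \<bullet> e\<bar> powr a\<close> is computed both as a product over the coordinates and
  in polar coordinates.\<close>
lemma nn_integral_sphere_abs_powr_Basis:
  fixes e :: "'a::euclidean_space" and a :: real
  assumes e: "e \<in> Basis" and a: "a \<ge> 0"
  shows "(\<integral>\<^sup>+z. ennreal (\<bar>z \<bullet> e\<bar> powr a) \<partial>sphere_measure)
    = ennreal (Gamma (DIM('a) / 2) * Gamma ((a + 1) / 2) / (sqrt pi * Gamma ((a + DIM('a)) / 2)))"
    (is "?I = _")
proof -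
  define n where "n = DIM('a)"
  have n: "n > 0" by (simp add: n_def)
  define V where "V = unit_ball_vol (real n)"
  have V: "V > 0" by (simp add: V_def)
  let ?G = "\<integral>\<^sup>+z. ennreal (\<bar>z \<bullet> e\<bar> powr a * exp (- (norm z)\<^sup>2)) \<partial>(lborel :: 'a measure)"
  define f where "f = (\<lambda>b t. ennreal ((if b = e then \<bar>t\<bar> powr a else 1) * exp (- t\<^sup>2)))"
  have "?G = (\<integral>\<^sup>+z. (\<Prod>b\<in>Basis. f b (z \<bullet> b)) \<partial>(lborel :: 'a measure))"
  proof (intro nn_integral_cong)
    fix z :: 'a
    have "(norm z)\<^sup>2 = (\<Sum>b\<in>Basis. (z \<bullet> b)\<^sup>2)"
      unfolding power2_norm_eq_inner euclidean_inner[of z z] by (simp add: power2_eq_square)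
    then have "exp (- (norm z)\<^sup>2) = (\<Prod>b\<in>Basis. exp (- (z \<bullet> b)\<^sup>2))"
      by (simp add: sum_negf[symmetric] exp_sum)
    moreover have "\<bar>z \<bullet> e\<bar> powr a = (\<Prod>b\<in>Basis. if b = e then \<bar>z \<bullet> b\<bar> powr a else 1)"
      using e by (simp add: prod.delta)
    ultimately show "ennreal (\<bar>z \<bullet> e\<bar> powr a * exp (- (norm z)\<^sup>2)) = (\<Prod>b\<in>Basis. f b (z \<bullet> b))"
      unfolding f_def by (subst prod_ennreal) (auto simp: prod.distrib)
  qed
  also have "\<dots> = (\<Prod>b\<in>Basis. (\<integral>\<^sup>+t. f b t \<partial>lborel))"
    by (rule nn_integral_lborel_prod) (auto simp: f_def)
  also have "\<dots> = (\<integral>\<^sup>+t. f e t \<partial>lborel) * (\<Prod>b\<in>Basis - {e}. (\<integral>\<^sup>+t. f b t \<partial>lborel))"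
    using e by (subst prod.remove) auto
  also have "(\<integral>\<^sup>+t. f e t \<partial>lborel) = ennreal (Gamma ((a + 1) / 2))"
    using a by (simp add: f_def nn_integral_Gaussian_line)
  also have "(\<Prod>b\<in>Basis - {e}. (\<integral>\<^sup>+t. f b t \<partial>lborel)) = (\<Prod>b\<in>Basis - {e}. ennreal (sqrt pi))"
  proof (intro prod.cong refl)
    fix b assume "b \<in> Basis - {e}"
    then have fb: "f b t = ennreal (exp (- t\<^sup>2))" for t by (simp add: f_def)
    \<comment> \<open>Writing 1 as \<open>\<bar>t\<bar> powr 0\<close> fails at the single point 0,
      where \<open>0 powr 0 = 0\<close>; hence equality only almost everywhere.\<close>
    have "(\<integral>\<^sup>+t. f b t \<partial>lborel) = (\<integral>\<^sup>+t. ennreal (\<bar>t\<bar> powr 0 * exp (- t\<^sup>2)) \<partial>lborel)"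
      using AE_lborel_singleton[of "0::real"]
      by (intro nn_integral_cong_AE, eventually_elim) (simp add: fb)
    then show "(\<integral>\<^sup>+t. f b t \<partial>lborel) = ennreal (sqrt pi)"
      by (simp only: nn_integral_Gaussian_line[OF order_refl]) (simp add: Gamma_one_half_real)
  qed
  also have "\<dots> = ennreal (sqrt pi ^ (n - 1))"
    using e by (simp add: n_def ennreal_power card_Diff_singleton)
  finally have G1: "?G = ennreal (Gamma ((a + 1) / 2) * sqrt pi ^ (n - 1))"
    by (simp add: ennreal_mult'')
  have "?G = (\<integral>\<^sup>+z. ennreal (norm z powr a * exp (- (norm z)\<^sup>2)) * ennreal (\<bar>sgn z \<bullet> e\<bar> powr a) \<partial>(lborel :: 'a measure))"
  proof (intro nn_integral_cong)
    fix z :: 'a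
    have "\<bar>z \<bullet> e\<bar> = norm z * \<bar>sgn z \<bullet> e\<bar>"
      by (cases "z = 0") (simp_all add: sgn_div_norm abs_mult)
    then have "\<bar>z \<bullet> e\<bar> powr a = norm z powr a * \<bar>sgn z \<bullet> e\<bar> powr a" by (simp add: powr_mult)
    then show "ennreal (\<bar>z \<bullet> e\<bar> powr a * exp (- (norm z)\<^sup>2))
        = ennreal (norm z powr a * exp (- (norm z)\<^sup>2)) * ennreal (\<bar>sgn z \<bullet> e\<bar> powr a)"
      by (simp add: ennreal_mult'[symmetric] mult_ac)
  qed
  also have "\<dots> = ennreal V * ?I
      * (\<integral>\<^sup>+\<rho>\<in>{0<..}. ennreal (real n * \<rho> ^ (n - 1)) * ennreal (\<rho> powr a * exp (- \<rho>\<^sup>2)) \<partial>lborel)"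
    unfolding V_def n_def
  proof (rule nn_integral_polar)
    fix z :: 'a assume "z \<in> sphere 0 1"
    then have "\<bar>z \<bullet> e\<bar> \<le> 1" using Cauchy_Schwarz_ineq2[of z e] e by simp
    then show "ennreal (\<bar>z \<bullet> e\<bar> powr a) \<le> 1" using a by (simp add: powr_le1)
  qed auto
  also have "(\<integral>\<^sup>+\<rho>\<in>{0<..}. ennreal (real n * \<rho> ^ (n - 1)) * ennreal (\<rho> powr a * exp (- \<rho>\<^sup>2)) \<partial>lborel)
      = (\<integral>\<^sup>+\<rho>. ennreal (real n) * (ennreal (\<rho> powr (a + n - 1) * exp (- \<rho>\<^sup>2)) * indicator {0<..} \<rho>) \<partial>lborel)"
  proof (intro nn_integral_cong)
    fix \<rho> :: real
    have "\<rho> ^ (n - 1) * \<rho> powr a = \<rho> powr (a + n - 1)" if "\<rho> > 0"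
      using that n by (simp add: powr_realpow[symmetric] powr_add[symmetric] of_nat_diff algebra_simps)
    then have "ennreal (real n * \<rho> ^ (n - 1)) * ennreal (\<rho> powr a * exp (- \<rho>\<^sup>2))
        = ennreal (real n) * ennreal (\<rho> powr (a + n - 1) * exp (- \<rho>\<^sup>2))" if "\<rho> > 0"
      using that by (simp add: ennreal_mult'[symmetric] mult.assoc[symmetric])
    then show "ennreal (real n * \<rho> ^ (n - 1)) * ennreal (\<rho> powr a * exp (- \<rho>\<^sup>2)) * indicator {0<..} \<rho>
      = ennreal (real n) * (ennreal (\<rho> powr (a + n - 1) * exp (- \<rho>\<^sup>2)) * indicator {0<..} \<rho>)"
      by (auto simp: indicator_def)
  qed
  also have "\<dots> = ennreal (real n) * ennreal (Gamma ((a + n) / 2) / 2)"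
    using nn_integral_Gaussian_half_line[of "a + n"] a n by (subst nn_integral_cmult) auto
  finally have G2: "?G = ennreal V * ?I * (ennreal (real n) * ennreal (Gamma ((a + n) / 2) / 2))" .
  have "ennreal (V * n * Gamma ((a + n) / 2) / 2) = ennreal V * (ennreal (real n) * ennreal (Gamma ((a + n) / 2) / 2))"
    using V by (simp add: ennreal_mult'[symmetric] mult.assoc del: ennreal_mult')
  then have "?G = ennreal (V * n * Gamma ((a + n) / 2) / 2) * ?I"
    unfolding G2 by (simp only: mult_ac)
  with G1 have eq: "ennreal (V * n * Gamma ((a + n) / 2) / 2) * ?I = ennreal (Gamma ((a + 1) / 2) * sqrt pi ^ (n - 1))"
    by simp
  \<comment> \<open>\<open>C\<close> is the product of the volume and the radial integral in polar
    coordinates. It is positive and finite, so the spherical integral can be solved for.\<close>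
  define C where "C = V * n * Gamma ((a + n) / 2) / 2"
  have Gpos: "Gamma ((a + n) / 2) > 0" "Gamma (n / 2) > 0" using a n by (auto intro!: Gamma_real_pos)
  then have C: "C > 0" using V n by (simp add: C_def)
  have "?I = ennreal (Gamma ((a + 1) / 2) * sqrt pi ^ (n - 1)) / ennreal C"
    unfolding eq[folded C_def, symmetric] using C
    by (subst mult.commute, subst mult_divide_eq_ennreal) auto
  also have "\<dots> = ennreal (Gamma ((a + 1) / 2) * sqrt pi ^ (n - 1) / C)"
    using C a by (intro divide_ennreal) (auto intro!: mult_nonneg_nonneg Gamma_real_nonneg)
  also have "Gamma ((a + 1) / 2) * sqrt pi ^ (n - 1) / C
      = Gamma (n / 2) * Gamma ((a + 1) / 2) / (sqrt pi * Gamma ((a + n) / 2))"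
  proof -
    have "Gamma (n / 2 + 1) = n / 2 * Gamma (n / 2)"
      using n by (intro Gamma_plus1) (auto simp: nonpos_Ints_def)
    moreover have "pi powr (n / 2) = sqrt pi ^ n"
      by (simp add: powr_realpow[symmetric] powr_half_sqrt[symmetric] powr_powr)
    moreover have "sqrt pi ^ n = sqrt pi * sqrt pi ^ (n - 1)"
      using n by (cases n) auto
    ultimately show ?thesis
      using Gpos n unfolding C_def V_def unit_ball_vol_def by (simp add: field_simps)
  qed
  finally show ?thesis unfolding n_def .
qed

lemma nn_integral_sphere_abs_powr:
  fixes e :: "'a::euclidean_space" and a :: real
  assumes e: "norm e = 1" and a: "a \<ge> 0"
  shows "(\<integral>\<^sup>+z. ennreal (\<bar>z \<bullet> e\<bar> powr a) \<partial>sphere_measure)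
    = ennreal (Gamma (DIM('a) / 2) * Gamma ((a + 1) / 2) / (sqrt pi * Gamma ((a + DIM('a)) / 2)))"
proof -
  obtain b :: 'a where b: "b \<in> Basis" using SOME_Basis by blast
  show ?thesis
    using nn_integral_sphere_zonal[of e b "\<lambda>t. ennreal (\<bar>t\<bar> powr a)"] e b
      nn_integral_sphere_abs_powr_Basis[OF b a] by simp
qed

text \<open>From dimension 2 on some nonzero \<open>y\<close> is orthogonal to \<open>e\<close>, and
  the ray lies in the hyperplane orthogonal to \<open>y\<close>. Such rays are the exceptional sets
  of the stereographic change of variables and of the binomial expansion.\<close>

lemma negligible_ray:
  fixes e :: "'a::euclidean_space"
  assumes "DIM('a) \<ge> 2" "norm e = 1"
  shows "negligible {z. sgn z = e}"
proof -
  obtain y where y: "y \<noteq> 0" "orthogonal e y"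
    using orthogonal_to_vector_exists[of e] assms(1) by auto
  have "z \<bullet> y = 0" if "sgn z = e" for z
  proof -
    have "z = norm z *\<^sub>R e" unfolding that[symmetric] by (cases "z = 0") (simp_all add: sgn_div_norm)
    then have "z \<bullet> y = norm z * (e \<bullet> y)" by (metis inner_scaleR_left)
    then show ?thesis using y by (simp add: orthogonal_def)
  qed
  then have "{z. sgn z = e} \<subseteq> {z. y \<bullet> z = 0}" by (auto simp: inner_commute)
  moreover have "negligible {z. y \<bullet> z = 0}" using y by (intro negligible_hyperplane) auto
  ultimately show ?thesis using negligible_subset by blast
qed

lemma AE_sphere_neq:
  fixes e :: "'a::euclidean_space"
  assumes "DIM('a) \<ge> 2" "norm e = 1"
  shows "AE z in sphere_measure. z \<noteq> e"
proof -
  note [measurable] = sgn_borel_measurable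
  have "{z. sgn z = e} = sgn -` {e}" by auto
  then have b: "{z. sgn z = e} \<in> sets borel"
    using measurable_sets[OF sgn_borel_measurable, of "{e}"] by simp
  then have "emeasure lborel {z. sgn z = e} = 0"
    using negligible_ray[OF assms] by (simp add: negligible_iff_null_sets null_sets_def)
  then have "AE z in lborel. sgn z \<noteq> e"
    using b by (intro AE_I[of _ _ "{z. sgn z = e}"]) auto
  then have "(\<integral>\<^sup>+z\<in>ball 0 1. indicator {e} (sgn z) \<partial>lborel) = (\<integral>\<^sup>+z. 0 \<partial>(lborel :: 'a measure))"
    by (intro nn_integral_cong_AE, eventually_elim) auto
  then have "(\<integral>\<^sup>+z. indicator {e} z \<partial>sphere_measure) = 0"
    by (subst nn_integral_sphere_measure) auto
  moreover have "(\<lambda>z. indicator {e} z :: ennreal) \<in> borel_measurable (sphere_measure :: 'a measure)"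
    unfolding sphere_measure_def by (intro measurable_completion measurable_restrict_space1) simp
  ultimately have "AE z in sphere_measure. indicator {e} z = (0 :: ennreal)"
    by (subst (asm) nn_integral_0_iff_AE)
  then show ?thesis by eventually_elim (auto simp: indicator_def split: if_splits)
qed

lemma borel_measurable_sphere_measure:
  "f \<in> borel_measurable borel \<Longrightarrow> f \<in> borel_measurable (sphere_measure :: 'a::euclidean_space measure)"
  unfolding sphere_measure_def by (intro measurable_completion measurable_restrict_space1) simp

text \<open>Equality in the Cauchy-Schwarz inequality holds only at the two poles \<open>e\<close>
  and \<open>- e\<close>. Away from them the binomial series is evaluated strictly inside its
  interval of convergence, even for \<open>w = 1\<close>.\<close>

lemma AE_sphere_inner_less:
  fixes e :: "'a::euclidean_space"
  assumes "DIM('a) \<ge> 2" "norm e = 1"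
  shows "AE z in sphere_measure. \<bar>z \<bullet> e\<bar> < 1"
proof -
  have "AE z in sphere_measure. (z::'a) \<in> space sphere_measure" by (rule AE_space)
  moreover have "AE z in sphere_measure. z \<noteq> e" by (rule AE_sphere_neq[OF assms])
  moreover have "AE z in sphere_measure. z \<noteq> - e" by (rule AE_sphere_neq) (use assms in auto)
  ultimately show ?thesis
  proof eventually_elim
    case (elim z)
    then have nz: "norm z = 1" by (simp add: space_sphere_measure)
    have "\<bar>z \<bullet> e\<bar> \<le> 1" using Cauchy_Schwarz_ineq2[of z e] nz assms(2) by simp
    moreover have "\<bar>z \<bullet> e\<bar> \<noteq> 1"
      using norm_cauchy_schwarz_abs_eq[of z e] nz assms(2) elim by auto
    ultimately show ?case by simp
  qed
qed

subsection \<open>The extremal direction and the hypergeometric series\<close>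

text \<open>The sign is that of the product of \<open>s - i\<close> over \<open>i < 2 * k\<close>.
  The factors with \<open>i < 2 * K\<close> are nonnegative because
  \<open>s \<ge> 2 * K - 1\<close>; the later ones are nonpositive because
  \<open>s \<le> 2 * K\<close>, and their number \<open>2 * (k - K)\<close> is even.\<close>

lemma gbinomial_even_nonneg:
  fixes s :: real
  assumes "s = 0 \<or> (\<exists>K\<ge>1. 2 * real K - 1 \<le> s \<and> s \<le> 2 * real K)"
  shows "(s gchoose (2 * k)) \<ge> 0"
  using assms
proof (elim disjE exE conjE)
  assume "s = 0"
  then show ?thesis by (cases k) simp_all
next
  fix K :: nat assume K: "1 \<le> K" "2 * real K - 1 \<le> s" "s \<le> 2 * real K"
  have pos: "(\<Prod>i = 0..<m. s - real i) \<ge> 0" if "m \<le> 2 * K" for m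
  proof (rule prod_nonneg)
    fix i assume "i \<in> {0..<m}"
    then have "i + 1 \<le> 2 * K" using that by auto
    then have "real i + 1 \<le> 2 * real K" by linarith
    then show "0 \<le> s - real i" using K by linarith
  qed
  have "(\<Prod>i = 0..<2 * k. s - real i) \<ge> 0"
  proof (cases "k \<le> K")
    case False
    have "(\<Prod>i = 2 * K..<2 * k. s - real i) = (\<Prod>i = 2 * K..<2 * k. (- 1) * (real i - s))"
      by (intro prod.cong) auto
    also have "\<dots> = (- 1) ^ (2 * (k - K)) * (\<Prod>i = 2 * K..<2 * k. real i - s)"
      unfolding prod.distrib by (simp add: diff_mult_distrib2)
    also have "\<dots> = (\<Prod>i = 2 * K..<2 * k. real i - s)" by simp
    also have "\<dots> \<ge> 0"
    proof (rule prod_nonneg)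
      fix i assume "i \<in> {2 * K..<2 * k}"
      then have "2 * real K \<le> real i" by auto
      then show "0 \<le> real i - s" using K by linarith
    qed
    finally have "(\<Prod>i = 2 * K..<2 * k. s - real i) \<ge> 0" .
    moreover have "(\<Prod>i = 0..<2 * k. s - real i)
        = (\<Prod>i = 0..<2 * K. s - real i) * (\<Prod>i = 2 * K..<2 * k. s - real i)"
      using False by (intro prod.atLeastLessThan_concat[symmetric]) auto
    ultimately show ?thesis using pos[of "2 * K"] by simp
  qed (auto intro: pos)
  then show ?thesis by (simp add: gbinomial_prod_rev)
qed

text \<open>Averaging the binomial series at \<open>z\<close> and at \<open>- z\<close> cancels the
  odd terms; the zeros left behind are removed by reindexing along the even numbers.\<close>

lemma even_binomial_series:
  fixes s z :: real
  assumes "\<bar>z\<bar> < 1"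
  shows "(\<lambda>k. (s gchoose (2 * k)) * z ^ (2 * k)) sums (((1 - z) powr s + (1 + z) powr s) / 2)"
proof -
  have a: "(\<lambda>n. (s gchoose n) * z ^ n) sums (1 + z) powr s"
    by (rule gen_binomial_real) (use assms in simp)
  have b: "(\<lambda>n. (s gchoose n) * (- z) ^ n) sums (1 - z) powr s"
    using gen_binomial_real[of "- z" s] assms by simp
  have "(\<lambda>n. ((s gchoose n) * (- z) ^ n + (s gchoose n) * z ^ n) / 2) sums (((1 - z) powr s + (1 + z) powr s) / 2)"
    by (intro sums_divide sums_add a b)
  then have *: "(\<lambda>n. if even n then (s gchoose n) * z ^ n else 0) sums (((1 - z) powr s + (1 + z) powr s) / 2)"
    by (rule sums_cong[THEN iffD1, rotated]) auto
  have "(\<lambda>k. if even (2 * k) then (s gchoose (2 * k)) * z ^ (2 * k) else 0) sums (((1 - z) powr s + (1 + z) powr s) / 2)"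
    by (subst sums_mono_reindex[of "\<lambda>k. 2 * k"]) (use * in \<open>auto simp: strict_mono_def elim!: evenE\<close>)
  then show ?thesis by simp
qed

text \<open>For \<open>a \<ge> 0\<close> this is the integral of
  \<open>\<bar>z \<bullet> e\<bar> powr a\<close> over the unit sphere in dimension
  \<open>n\<close>, for any unit vector \<open>e\<close>.\<close>

definition sphere_moment :: "nat \<Rightarrow> real \<Rightarrow> real" where
  "sphere_moment n a = Gamma (n / 2) * Gamma ((a + 1) / 2) / (sqrt pi * Gamma ((a + n) / 2))"

lemma sphere_moment_pos: "n > 0 \<Longrightarrow> a \<ge> 0 \<Longrightarrow> sphere_moment n a > 0"
  by (simp add: sphere_moment_def Gamma_real_pos)

text \<open>Young's inequality with the conjugate exponents \<open>(m + q) / m\<close> and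
  \<open>(m + q) / q\<close>, chosen so that both terms on the right have total degree
  \<open>m + q\<close>. For \<open>m = 0\<close> the first exponent does not exist and both sides
  coincide.\<close>

lemma Young_powr_mult:
  fixes a b q :: real and m :: nat
  assumes "a \<ge> 0" "b \<ge> 0" "q > 0"
  shows "a ^ m * b powr q \<le> m / (m + q) * a powr (m + q) + q / (m + q) * b powr (m + q)"
proof (cases "m = 0")
  case True
  then show ?thesis using assms by simp
next
  case False
  then have m: "real m > 0" by simp
  have "a ^ m * b powr q \<le> (a ^ m) powr ((m + q) / m) / ((m + q) / m) + (b powr q) powr ((m + q) / q) / ((m + q) / q)"
  proof (rule Youngs_inequality)
    show "1 / ((m + q) / m) + 1 / ((m + q) / q) = 1"
      using m assms by (simp add: add_divide_distrib[symmetric])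
  qed (use m assms in \<open>auto simp: less_divide_eq\<close>)
  also have "(a ^ m) powr ((m + q) / m) = a powr (m + q)"
  proof (cases "a = 0")
    case False
    then have "a ^ m = a powr m" using assms by (simp add: powr_realpow)
    then show ?thesis using m by (simp add: powr_powr)
  qed (use m assms in \<open>simp add: power_0_left\<close>)
  also have "(b powr q) powr ((m + q) / q) = b powr (m + q)"
    using assms by (simp add: powr_powr)
  finally show ?thesis by (simp add: mult.commute)
qed

text \<open>After Young's inequality only pure moments of degree \<open>m + q\<close> remain. They
  do not depend on the unit vector, and the two weights add up to 1, so nothing is lost when
  \<open>l = e\<close>.\<close>

lemma nn_integral_sphere_mixed_moment_le:
  fixes e l :: "'a::euclidean_space"
  assumes e: "norm e = 1" and l: "norm l = 1" and q: "q > 0"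
  shows "(\<integral>\<^sup>+z. ennreal (\<bar>z \<bullet> e\<bar> ^ m * \<bar>z \<bullet> l\<bar> powr q) \<partial>sphere_measure)
    \<le> ennreal (sphere_moment DIM('a) (m + q))"
proof -
  let ?M = "sphere_moment DIM('a) (m + q)"
  have M: "?M > 0" using q by (intro sphere_moment_pos) auto
  have mom: "(\<integral>\<^sup>+z. ennreal (\<bar>z \<bullet> u\<bar> powr (m + q)) \<partial>sphere_measure) = ennreal ?M" if "norm u = 1" for u :: 'a
    unfolding sphere_moment_def using that q by (intro nn_integral_sphere_abs_powr) auto
  have [measurable]: "(\<lambda>z. ennreal (\<bar>z \<bullet> u\<bar> powr (m + q))) \<in> borel_measurable sphere_measure" for u :: 'a
    by (rule borel_measurable_sphere_measure) measurable
  have "(\<integral>\<^sup>+z. ennreal (\<bar>z \<bullet> e\<bar> ^ m * \<bar>z \<bullet> l\<bar> powr q) \<partial>sphere_measure)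
    \<le> (\<integral>\<^sup>+z. ennreal (m / (m + q)) * ennreal (\<bar>z \<bullet> e\<bar> powr (m + q))
          + ennreal (q / (m + q)) * ennreal (\<bar>z \<bullet> l\<bar> powr (m + q)) \<partial>sphere_measure)"
  proof (intro nn_integral_mono)
    fix z :: 'a
    have "ennreal (\<bar>z \<bullet> e\<bar> ^ m * \<bar>z \<bullet> l\<bar> powr q)
        \<le> ennreal (m / (m + q) * \<bar>z \<bullet> e\<bar> powr (m + q) + q / (m + q) * \<bar>z \<bullet> l\<bar> powr (m + q))"
      using q by (intro ennreal_leI Young_powr_mult) auto
    also have "\<dots> = ennreal (m / (m + q)) * ennreal (\<bar>z \<bullet> e\<bar> powr (m + q))
          + ennreal (q / (m + q)) * ennreal (\<bar>z \<bullet> l\<bar> powr (m + q))"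
      using q by (subst ennreal_plus, simp, simp, simp only: ennreal_mult''[OF powr_ge_zero])
    finally show "ennreal (\<bar>z \<bullet> e\<bar> ^ m * \<bar>z \<bullet> l\<bar> powr q)
        \<le> ennreal (m / (m + q)) * ennreal (\<bar>z \<bullet> e\<bar> powr (m + q))
          + ennreal (q / (m + q)) * ennreal (\<bar>z \<bullet> l\<bar> powr (m + q))" .
  qed
  also have "\<dots> = ennreal (m / (m + q)) * ennreal ?M + ennreal (q / (m + q)) * ennreal ?M"
  proof -
    have "(\<integral>\<^sup>+z. C * ennreal (\<bar>z \<bullet> u\<bar> powr (m + q)) \<partial>sphere_measure) = C * ennreal ?M" if "norm u = 1" for u :: 'a and C
      unfolding mom[OF that, symmetric] by (rule nn_integral_cmult) measurable
    then show ?thesis by (subst nn_integral_add) (auto simp: e l)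
  qed
  also have "\<dots> = ennreal (m / (m + q) * ?M + q / (m + q) * ?M)"
    using q M by (subst ennreal_plus, simp, simp, simp only: ennreal_mult''[OF less_imp_le[OF M]])
  also have "m / (m + q) * ?M + q / (m + q) * ?M = ?M"
    using q by (simp add: distrib_right[symmetric] add_divide_distrib[symmetric])
  finally show ?thesis .
qed

context
  fixes s q w :: real and e :: "'a::euclidean_space"
  assumes dim: "DIM('a) \<ge> 2" and e: "norm e = 1" and q: "q > 0" and s: "s \<ge> 0" and w: "0 \<le> w" "w \<le> 1"
    and coeff: "\<And>k. (s gchoose (2 * k)) \<ge> 0"
begin

text \<open>Averaging over the antipodal map replaces the kernel by its even part. As all
  coefficients are nonnegative, sum and integral can be exchanged by monotone convergence.\<close>

lemma nn_integral_sphere_kernel_series: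
  "(\<integral>\<^sup>+z. ennreal ((1 - w * (z \<bullet> e)) powr s * \<bar>z \<bullet> l\<bar> powr q) \<partial>sphere_measure)
    = (\<Sum>k. ennreal ((s gchoose (2 * k)) * w ^ (2 * k))
        * (\<integral>\<^sup>+z. ennreal (\<bar>z \<bullet> e\<bar> ^ (2 * k) * \<bar>z \<bullet> l\<bar> powr q) \<partial>sphere_measure))"
    (is "?J = _")
proof -
  note [measurable (raw)] = borel_measurable_sphere_measure
  let ?J' = "\<integral>\<^sup>+z. ennreal ((1 + w * (z \<bullet> e)) powr s * \<bar>z \<bullet> l\<bar> powr q) \<partial>sphere_measure"
  have J': "?J' = ?J"
    \<comment> \<open>The factor \<open>\<bar>z \<bullet> l\<bar> powr q\<close> is even, so the
      antipodal map only changes the sign in front of \<open>w\<close>.\<close>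
    using nn_integral_sphere_minus[of "\<lambda>z. ennreal ((1 - w * (z \<bullet> e)) powr s * \<bar>z \<bullet> l\<bar> powr q)"] by simp
  have "?J = ennreal (1/2) * (?J + ?J')"
  proof -
    have "ennreal (1/2) * 2 = ennreal (1/2 * 2)" by (subst ennreal_mult) auto
    then show ?thesis unfolding J' by (simp add: mult_2[symmetric] mult.assoc[symmetric])
  qed
  also have "\<dots> = (\<integral>\<^sup>+z. ennreal (1/2) * (ennreal ((1 - w * (z \<bullet> e)) powr s * \<bar>z \<bullet> l\<bar> powr q)
      + ennreal ((1 + w * (z \<bullet> e)) powr s * \<bar>z \<bullet> l\<bar> powr q)) \<partial>sphere_measure)"
  proof -
    have [measurable]: "(\<lambda>z::'a. ennreal ((1 - w * (z \<bullet> e)) powr s * \<bar>z \<bullet> l\<bar> powr q)) \<in> borel_measurable sphere_measure"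
      "(\<lambda>z::'a. ennreal ((1 + w * (z \<bullet> e)) powr s * \<bar>z \<bullet> l\<bar> powr q)) \<in> borel_measurable sphere_measure"
      by (rule borel_measurable_sphere_measure, measurable)+
    show ?thesis by (subst nn_integral_cmult) (auto simp: nn_integral_add)
  qed
  also have "\<dots> = (\<integral>\<^sup>+z. (\<Sum>k. ennreal ((s gchoose (2 * k)) * w ^ (2 * k))
      * ennreal (\<bar>z \<bullet> e\<bar> ^ (2 * k) * \<bar>z \<bullet> l\<bar> powr q)) \<partial>sphere_measure)"
  proof (intro nn_integral_cong_AE)
    show "AE z in sphere_measure. ennreal (1/2) * (ennreal ((1 - w * (z \<bullet> e)) powr s * \<bar>z \<bullet> l\<bar> powr q)
      + ennreal ((1 + w * (z \<bullet> e)) powr s * \<bar>z \<bullet> l\<bar> powr q))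
      = (\<Sum>k. ennreal ((s gchoose (2 * k)) * w ^ (2 * k)) * ennreal (\<bar>z \<bullet> e\<bar> ^ (2 * k) * \<bar>z \<bullet> l\<bar> powr q))"
      using AE_sphere_inner_less[OF dim e]
    proof eventually_elim
      case (elim z)
      have "\<bar>w * (z \<bullet> e)\<bar> \<le> 1 * \<bar>z \<bullet> e\<bar>" unfolding abs_mult using w by (intro mult_right_mono) auto
      then have "\<bar>w * (z \<bullet> e)\<bar> < 1" using elim by simp
      from sums_mult2[OF even_binomial_series[OF this, of s], of "\<bar>z \<bullet> l\<bar> powr q"]
      have "(\<lambda>k. ((s gchoose (2 * k)) * w ^ (2 * k)) * (\<bar>z \<bullet> e\<bar> ^ (2 * k) * \<bar>z \<bullet> l\<bar> powr q))
        sums (((1 - w * (z \<bullet> e)) powr s + (1 + w * (z \<bullet> e)) powr s) / 2 * \<bar>z \<bullet> l\<bar> powr q)"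
        by (simp add: power_mult_distrib mult_ac power_even_abs)
      then have "(\<Sum>k. ennreal (((s gchoose (2 * k)) * w ^ (2 * k)) * (\<bar>z \<bullet> e\<bar> ^ (2 * k) * \<bar>z \<bullet> l\<bar> powr q)))
        = ennreal (((1 - w * (z \<bullet> e)) powr s + (1 + w * (z \<bullet> e)) powr s) / 2 * \<bar>z \<bullet> l\<bar> powr q)"
        using coeff w by (intro suminf_ennreal_eq) auto
      moreover have "ennreal (((s gchoose (2 * k)) * w ^ (2 * k)) * (\<bar>z \<bullet> e\<bar> ^ (2 * k) * \<bar>z \<bullet> l\<bar> powr q))
        = ennreal ((s gchoose (2 * k)) * w ^ (2 * k)) * ennreal (\<bar>z \<bullet> e\<bar> ^ (2 * k) * \<bar>z \<bullet> l\<bar> powr q)" for k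
        using coeff w by (intro ennreal_mult) auto
      moreover have "ennreal (1/2) * (ennreal ((1 - w * (z \<bullet> e)) powr s * \<bar>z \<bullet> l\<bar> powr q)
          + ennreal ((1 + w * (z \<bullet> e)) powr s * \<bar>z \<bullet> l\<bar> powr q))
        = ennreal (((1 - w * (z \<bullet> e)) powr s + (1 + w * (z \<bullet> e)) powr s) / 2 * \<bar>z \<bullet> l\<bar> powr q)"
        by (subst ennreal_plus[symmetric], simp, simp, subst ennreal_mult[symmetric])
          (auto simp: distrib_right)
      ultimately show ?case by simp
    qed
  qed
  also have "\<dots> = (\<Sum>k. (\<integral>\<^sup>+z. ennreal ((s gchoose (2 * k)) * w ^ (2 * k))
      * ennreal (\<bar>z \<bullet> e\<bar> ^ (2 * k) * \<bar>z \<bullet> l\<bar> powr q) \<partial>sphere_measure))"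
    by (rule nn_integral_suminf, rule borel_measurable_sphere_measure) measurable
  also have "\<dots> = (\<Sum>k. ennreal ((s gchoose (2 * k)) * w ^ (2 * k))
        * (\<integral>\<^sup>+z. ennreal (\<bar>z \<bullet> e\<bar> ^ (2 * k) * \<bar>z \<bullet> l\<bar> powr q) \<partial>sphere_measure))"
    by (intro suminf_cong nn_integral_cmult borel_measurable_sphere_measure) measurable
  finally show ?thesis .
qed


lemma nn_integral_sphere_kernel_le:
  assumes "norm l = 1"
  shows "(\<integral>\<^sup>+z. ennreal ((1 - w * (z \<bullet> e)) powr s * \<bar>z \<bullet> l\<bar> powr q) \<partial>sphere_measure)
    \<le> (\<Sum>k. ennreal ((s gchoose (2 * k)) * w ^ (2 * k) * sphere_moment DIM('a) (real (2 * k) + q)))"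
  unfolding nn_integral_sphere_kernel_series
proof (intro suminf_le)
  fix k
  have "ennreal ((s gchoose (2 * k)) * w ^ (2 * k))
      * (\<integral>\<^sup>+z. ennreal (\<bar>z \<bullet> e\<bar> ^ (2 * k) * \<bar>z \<bullet> l\<bar> powr q) \<partial>sphere_measure)
    \<le> ennreal ((s gchoose (2 * k)) * w ^ (2 * k)) * ennreal (sphere_moment DIM('a) (real (2 * k) + q))"
    by (intro mult_left_mono nn_integral_sphere_mixed_moment_le e assms q) simp
  also have "\<dots> = ennreal ((s gchoose (2 * k)) * w ^ (2 * k) * sphere_moment DIM('a) (real (2 * k) + q))"
    using coeff w q by (intro ennreal_mult[symmetric]) (auto intro!: less_imp_le[OF sphere_moment_pos])
  finally show "ennreal ((s gchoose (2 * k)) * w ^ (2 * k))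
      * (\<integral>\<^sup>+z. ennreal (\<bar>z \<bullet> e\<bar> ^ (2 * k) * \<bar>z \<bullet> l\<bar> powr q) \<partial>sphere_measure)
    \<le> ennreal ((s gchoose (2 * k)) * w ^ (2 * k) * sphere_moment DIM('a) (real (2 * k) + q))" .
qed (auto intro: summableI)

lemma nn_integral_sphere_kernel_axis:
  "(\<integral>\<^sup>+z. ennreal ((1 - w * (z \<bullet> e)) powr s * \<bar>z \<bullet> e\<bar> powr q) \<partial>sphere_measure)
    = (\<Sum>k. ennreal ((s gchoose (2 * k)) * w ^ (2 * k) * sphere_moment DIM('a) (real (2 * k) + q)))"
  unfolding nn_integral_sphere_kernel_series
proof (intro suminf_cong)
  fix k
  have "\<bar>z \<bullet> e\<bar> ^ (2 * k) * \<bar>z \<bullet> e\<bar> powr q = \<bar>z \<bullet> e\<bar> powr (real (2 * k) + q)" for z :: 'a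
  proof (cases "z \<bullet> e = 0")
    case False
    then have "\<bar>z \<bullet> e\<bar> ^ (2 * k) = \<bar>z \<bullet> e\<bar> powr real (2 * k)" by (intro powr_realpow[symmetric]) simp
    then show ?thesis by (simp only: powr_add)
  qed simp
  moreover have "(\<integral>\<^sup>+z. ennreal (\<bar>z \<bullet> e\<bar> powr (real (2 * k) + q)) \<partial>sphere_measure)
      = ennreal (sphere_moment DIM('a) (real (2 * k) + q))"
    unfolding sphere_moment_def using e q by (intro nn_integral_sphere_abs_powr) auto
  moreover have "ennreal ((s gchoose (2 * k)) * w ^ (2 * k)) * ennreal (sphere_moment DIM('a) (real (2 * k) + q))
    = ennreal ((s gchoose (2 * k)) * w ^ (2 * k) * sphere_moment DIM('a) (real (2 * k) + q))"
    using coeff w q by (intro ennreal_mult[symmetric]) (auto intro!: less_imp_le[OF sphere_moment_pos])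
  ultimately show "ennreal ((s gchoose (2 * k)) * w ^ (2 * k))
      * (\<integral>\<^sup>+z. ennreal (\<bar>z \<bullet> e\<bar> ^ (2 * k) * \<bar>z \<bullet> e\<bar> powr q) \<partial>sphere_measure)
    = ennreal ((s gchoose (2 * k)) * w ^ (2 * k) * sphere_moment DIM('a) (real (2 * k) + q))"
    by (simp only:)
qed

lemma nn_integral_sphere_kernel_finite:
  "(\<integral>\<^sup>+z. ennreal ((1 - w * (z \<bullet> e)) powr s * \<bar>z \<bullet> e\<bar> powr q) \<partial>sphere_measure) < \<infinity>"
proof -
  have "(\<integral>\<^sup>+z. ennreal ((1 - w * (z \<bullet> e)) powr s * \<bar>z \<bullet> e\<bar> powr q) \<partial>sphere_measure)
      \<le> (\<integral>\<^sup>+z. ennreal (2 powr s) \<partial>(sphere_measure :: 'a measure))"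
  proof (intro nn_integral_mono ennreal_leI)
    fix z :: 'a assume "z \<in> space sphere_measure"
    then have z: "\<bar>z \<bullet> e\<bar> \<le> 1"
      using Cauchy_Schwarz_ineq2[of z e] e by (simp add: space_sphere_measure)
    have "\<bar>w * (z \<bullet> e)\<bar> \<le> 1 * 1" unfolding abs_mult using w z by (intro mult_mono) auto
    then have "(1 - w * (z \<bullet> e)) powr s * \<bar>z \<bullet> e\<bar> powr q \<le> 2 powr s * 1"
      using z s q by (intro mult_mono powr_mono2 powr_le1) (auto simp: abs_le_iff)
    then show "(1 - w * (z \<bullet> e)) powr s * \<bar>z \<bullet> e\<bar> powr q \<le> 2 powr s" by simp
  qed
  also have "\<dots> = ennreal (2 powr s)"
    using emeasure_sphere_measure_total[where 'a='a] by (simp add: space_sphere_measure)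
  finally show ?thesis using le_less_trans by fastforce
qed

end

text \<open>The duplication formulas for \<open>pochhammer (- s) (2 * k)\<close> and for
  \<open>fact (2 * k)\<close> each produce a power \<open>2 ^ (2 * k)\<close>, and these cancel.
  This accounts for the parameters \<open>- s / 2\<close>, \<open>(1 - s) / 2\<close> and
  \<open>1 / 2\<close>; the remaining two come from the Gamma quotients of the moments.\<close>

lemma hypergeometric_3F2_term:
  fixes s q :: real
  assumes q: "q > 0" and n: "n > 0"
  shows "(s gchoose (2 * k)) * sphere_moment n (real (2 * k) + q)
    = sphere_moment n q * (pochhammer (- s / 2) k * pochhammer ((1 - s) / 2) k * pochhammer ((q + 1) / 2) k
        / (fact k * pochhammer (1 / 2) k * pochhammer ((q + n) / 2) k))"
proof -
  have not_np: "x \<notin> \<int>\<^sub>\<le>\<^sub>0" if "x > 0" for x :: real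
    using that nonpos_Ints_nonpos by force
  have a3: "pochhammer ((q + 1) / 2) k = Gamma ((real (2 * k) + q + 1) / 2) / Gamma ((q + 1) / 2)"
    using pochhammer_Gamma[OF not_np, of "(q + 1) / 2" k] q by (simp add: add_divide_distrib add.commute add.left_commute)
  have b2: "pochhammer ((q + n) / 2) k = Gamma ((real (2 * k) + q + n) / 2) / Gamma ((q + n) / 2)"
    using pochhammer_Gamma[OF not_np, of "(q + n) / 2" k] q by (simp add: add_divide_distrib add.commute add.left_commute)
  have pos: "Gamma ((q + 1) / 2) > 0" "Gamma ((q + n) / 2) > 0" "Gamma ((real (2 * k) + q + n) / 2) > 0"
    "Gamma (n / 2) > 0"
    using q n by (auto intro!: Gamma_real_pos)
  have f: "fact (2 * k) = (2 ^ (2 * k) * pochhammer (1 / 2) k * fact k :: real)"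
    by (rule fact_double)
  have g: "pochhammer (- s) (2 * k) = 2 ^ (2 * k) * pochhammer (- s / 2) k * pochhammer ((1 - s) / 2) k"
    using pochhammer_double[of "- s / 2" k] by (simp add: diff_divide_distrib)
  have h: "pochhammer (1 / 2 :: real) k > 0" by (rule pochhammer_pos) simp
  have "(s gchoose (2 * k)) = pochhammer (- s) (2 * k) / fact (2 * k)"
    by (simp add: gbinomial_pochhammer)
  also have "\<dots> = pochhammer (- s / 2) k * pochhammer ((1 - s) / 2) k / (fact k * pochhammer (1 / 2) k)"
    unfolding f g using h by (simp add: field_simps)
  finally show ?thesis
    unfolding a3 b2 sphere_moment_def using pos h by (simp add: field_simps)
qed

text \<open>Convergence of the hypergeometric series, also at argument 1, is obtained from the
  integral: the terms are nonnegative and their extended sum equals a finite integral along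
  \<open>e\<close>.\<close>

lemma nn_integral_sphere_kernel:
  fixes s q w :: real and e l :: "'a::euclidean_space"
  assumes dim: "DIM('a) \<ge> 2" and e: "norm e = 1" and q: "q > 0" and s: "s \<ge> 0" and w: "0 \<le> w" "w \<le> 1"
    and coeff: "\<And>k. (s gchoose (2 * k)) \<ge> 0"
  defines "J \<equiv> sphere_moment DIM('a) q
    * hypergeometric_3F2 (- s / 2) ((1 - s) / 2) ((q + 1) / 2) (1 / 2) ((q + DIM('a)) / 2) (w\<^sup>2)"
  shows "J > 0"
    and "(\<integral>\<^sup>+z. ennreal ((1 - w * (z \<bullet> e)) powr s * \<bar>z \<bullet> e\<bar> powr q) \<partial>sphere_measure) = ennreal J"
    and "norm l = 1 \<Longrightarrow>
      (\<integral>\<^sup>+z. ennreal ((1 - w * (z \<bullet> e)) powr s * \<bar>z \<bullet> l\<bar> powr q) \<partial>sphere_measure) \<le> ennreal J"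
proof -
  define t where "t = (\<lambda>k. (s gchoose (2 * k)) * w ^ (2 * k) * sphere_moment DIM('a) (real (2 * k) + q))"
  have t0: "t k \<ge> 0" for k
    unfolding t_def using coeff w q by (auto intro!: mult_nonneg_nonneg less_imp_le[OF sphere_moment_pos])
  have ax: "(\<integral>\<^sup>+z. ennreal ((1 - w * (z \<bullet> e)) powr s * \<bar>z \<bullet> e\<bar> powr q) \<partial>sphere_measure) = (\<Sum>k. ennreal (t k))"
    unfolding t_def by (rule nn_integral_sphere_kernel_axis) fact+
  have fin: "(\<Sum>k. ennreal (t k)) \<noteq> top"
    using nn_integral_sphere_kernel_finite[OF dim e q s w coeff] unfolding ax by simp
  have sm: "summable t" using summable_suminf_not_top[OF t0 fin] .
  have tk: "t k = sphere_moment DIM('a) q * (pochhammer (- s / 2) k * pochhammer ((1 - s) / 2) k * pochhammer ((q + 1) / 2) k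
        / (fact k * pochhammer (1 / 2) k * pochhammer ((q + DIM('a)) / 2) k) * (w\<^sup>2) ^ k)" for k
  proof -
    have "t k = (s gchoose (2 * k)) * sphere_moment DIM('a) (real (2 * k) + q) * (w\<^sup>2) ^ k"
      by (simp add: t_def power_mult)
    also have "\<dots> = sphere_moment DIM('a) q * (pochhammer (- s / 2) k * pochhammer ((1 - s) / 2) k * pochhammer ((q + 1) / 2) k
        / (fact k * pochhammer (1 / 2) k * pochhammer ((q + DIM('a)) / 2) k)) * (w\<^sup>2) ^ k"
      by (subst hypergeometric_3F2_term) (use q in auto)
    finally show ?thesis by (simp only: mult.assoc)
  qed
  have m0: "sphere_moment DIM('a) q > 0" using q by (intro sphere_moment_pos) auto
  have J: "J = suminf t"
  proof -
    have "summable (\<lambda>k. pochhammer (- s / 2) k * pochhammer ((1 - s) / 2) k * pochhammer ((q + 1) / 2) k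
        / (fact k * pochhammer (1 / 2) k * pochhammer ((q + DIM('a)) / 2) k) * (w\<^sup>2) ^ k)"
      using sm m0 unfolding tk by (subst (asm) summable_cmult_iff) auto
    from suminf_mult[OF this, of "sphere_moment DIM('a) q"] show ?thesis
      unfolding J_def hypergeometric_3F2_def tk[abs_def] by simp
  qed
  \<comment> \<open>The leading term is the positive moment itself, which already makes the whole
    sum positive.\<close>
  have "t 0 > 0" unfolding t_def using m0 by simp
  then show "J > 0" unfolding J using suminf_pos2[OF sm t0] by blast
  have eq: "(\<Sum>k. ennreal (t k)) = ennreal J" unfolding J by (rule suminf_ennreal2[OF t0 sm])
  show "(\<integral>\<^sup>+z. ennreal ((1 - w * (z \<bullet> e)) powr s * \<bar>z \<bullet> e\<bar> powr q) \<partial>sphere_measure) = ennreal J"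
    unfolding ax eq ..
  show "(\<integral>\<^sup>+z. ennreal ((1 - w * (z \<bullet> e)) powr s * \<bar>z \<bullet> l\<bar> powr q) \<partial>sphere_measure) \<le> ennreal J"
    if "norm l = 1"
    using nn_integral_sphere_kernel_le[OF dim e q s w coeff that] eq by (simp only: t_def)
qed

subsection \<open>Differentiation under the integral and duality\<close>

text \<open>The remainder quotient \<open>R\<close> tends to 0 pointwise and is bounded by
  \<open>2 * B\<close>: once for the difference quotient, by the mean value inequality on the ball,
  and once for the linear term. Dominated convergence is applied along sequences.\<close>

lemma has_derivative_integral_dominated:
  fixes K :: "'a::euclidean_space \<Rightarrow> 'b \<Rightarrow> real" and G :: "'a \<Rightarrow> 'b \<Rightarrow> 'a"
  assumes e: "e > 0" and int: "\<And>y. y \<in> ball x e \<Longrightarrow> integrable M (K y)"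
    and der: "\<And>\<zeta> y. \<zeta> \<in> space M \<Longrightarrow> y \<in> ball x e \<Longrightarrow>
      ((\<lambda>y. K y \<zeta>) has_derivative (\<lambda>h. h \<bullet> G y \<zeta>)) (at y)"
    and bd: "\<And>\<zeta> y. \<zeta> \<in> space M \<Longrightarrow> y \<in> ball x e \<Longrightarrow> norm (G y \<zeta>) \<le> B \<zeta>"
    and B: "integrable M B" and G: "integrable M (G x)"
  shows "((\<lambda>y. \<integral>\<zeta>. K y \<zeta> \<partial>M) has_derivative (\<lambda>h. h \<bullet> (\<integral>\<zeta>. G x \<zeta> \<partial>M))) (at x)"
  unfolding has_derivative_at
proof
  show "bounded_linear (\<lambda>h. h \<bullet> (\<integral>\<zeta>. G x \<zeta> \<partial>M))" by (rule bounded_linear_inner_left)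
  let ?u = "\<lambda>y. \<integral>\<zeta>. K y \<zeta> \<partial>M"
  have x: "x \<in> ball x e" using e by simp
  define R where "R = (\<lambda>h \<zeta>. (K (x + h) \<zeta> - K x \<zeta> - h \<bullet> G x \<zeta>) / norm h)"
  show "((\<lambda>h. norm (?u (x + h) - ?u x - h \<bullet> (\<integral>\<zeta>. G x \<zeta> \<partial>M)) / norm h) \<longlongrightarrow> 0) (at 0)"
    unfolding tendsto_at_iff_sequentially
  proof (intro allI impI)
    fix X :: "nat \<Rightarrow> 'a" assume X: "\<forall>i. X i \<in> UNIV - {0}" "X \<longlonglongrightarrow> 0"
    \<comment> \<open>Dominated convergence asks for the bound at every index, so the finitely many
      members that leave the ball are replaced by 0, where \<open>R\<close> vanishes since division
      by 0 gives 0.\<close>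
    define Y where "Y = (\<lambda>i. if norm (X i) < e then X i else 0)"
    have Ye: "x + Y i \<in> ball x e" for i using e by (auto simp: Y_def dist_norm)
    have ev: "\<forall>\<^sub>F i in sequentially. Y i = X i"
    proof -
      have "\<forall>\<^sub>F i in sequentially. dist (X i) 0 < e" using X(2) e by (rule tendstoD)
      then show ?thesis by eventually_elim (simp add: Y_def)
    qed
    have intR: "integrable M (R (Y i))" for i
      unfolding R_def using int[OF Ye] int[OF x] G by auto
    have "(\<lambda>i. \<integral>\<zeta>. R (Y i) \<zeta> \<partial>M) \<longlonglongrightarrow> (\<integral>\<zeta>. 0 \<partial>M)"
    proof (rule integral_dominated_convergence[where w = "\<lambda>\<zeta>. 2 * B \<zeta>"])
      show "(\<lambda>\<zeta>. 0) \<in> borel_measurable M" by simp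
      show "R (Y i) \<in> borel_measurable M" for i using intR by auto
      show "integrable M (\<lambda>\<zeta>. 2 * B \<zeta>)" using B by simp
      show "AE \<zeta> in M. (\<lambda>i. R (Y i) \<zeta>) \<longlonglongrightarrow> 0"
      proof (rule AE_I2)
        fix \<zeta> assume \<zeta>: "\<zeta> \<in> space M"
        have "((\<lambda>h. norm (K (x + h) \<zeta> - K x \<zeta> - h \<bullet> G x \<zeta>) / norm h) \<longlongrightarrow> 0) (at 0)"
          using der[OF \<zeta> x] unfolding has_derivative_at by blast
        then have "(\<lambda>i. norm (K (x + X i) \<zeta> - K x \<zeta> - X i \<bullet> G x \<zeta>) / norm (X i)) \<longlonglongrightarrow> 0"
          using X unfolding tendsto_at_iff_sequentially comp_def by blast
        then have "(\<lambda>i. norm (R (X i) \<zeta>)) \<longlonglongrightarrow> 0" by (simp add: R_def)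
        then have "(\<lambda>i. R (X i) \<zeta>) \<longlonglongrightarrow> 0" by (rule tendsto_norm_zero_cancel)
        then show "(\<lambda>i. R (Y i) \<zeta>) \<longlonglongrightarrow> 0"
          by (rule Lim_transform_eventually) (use ev in eventually_elim, simp)
      qed
      show "AE \<zeta> in M. norm (R (Y i) \<zeta>) \<le> 2 * B \<zeta>" for i
      proof (rule AE_I2)
        fix \<zeta> assume \<zeta>: "\<zeta> \<in> space M"
        have B0: "B \<zeta> \<ge> 0" using bd[OF \<zeta> x] norm_ge_zero order_trans by blast
        have "norm (K (x + Y i) \<zeta> - K x \<zeta>) \<le> B \<zeta> * norm (x + Y i - x)"
        proof (rule differentiable_bound[of "ball x e"])
          fix y assume y: "y \<in> ball x e"
          show "((\<lambda>y. K y \<zeta>) has_derivative (\<lambda>h. h \<bullet> G y \<zeta>)) (at y within ball x e)"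
            using der[OF \<zeta> y] by (rule has_derivative_at_withinI)
          show "onorm (\<lambda>h. h \<bullet> G y \<zeta>) \<le> B \<zeta>"
          proof (rule onorm_bound[OF B0])
            fix h
            have "\<bar>h \<bullet> G y \<zeta>\<bar> \<le> norm h * norm (G y \<zeta>)" by (rule Cauchy_Schwarz_ineq2)
            also have "\<dots> \<le> norm h * B \<zeta>" by (intro mult_left_mono bd \<zeta> y) simp
            finally show "norm (h \<bullet> G y \<zeta>) \<le> B \<zeta> * norm h" by (simp add: mult.commute)
          qed
        qed (use Ye x in auto)
        moreover have "\<bar>Y i \<bullet> G x \<zeta>\<bar> \<le> B \<zeta> * norm (Y i)"
          using Cauchy_Schwarz_ineq2[of "Y i" "G x \<zeta>"] mult_left_mono[OF bd[OF \<zeta> x] norm_ge_zero[of "Y i"]]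
          by (simp add: mult.commute)
        ultimately have "\<bar>K (x + Y i) \<zeta> - K x \<zeta> - Y i \<bullet> G x \<zeta>\<bar> \<le> 2 * B \<zeta> * norm (Y i)"
          by simp
        then show "norm (R (Y i) \<zeta>) \<le> 2 * B \<zeta>"
          using B0 by (cases "Y i = 0") (simp_all add: R_def divide_le_eq)
      qed
    qed
    then have "(\<lambda>i. norm (\<integral>\<zeta>. R (Y i) \<zeta> \<partial>M)) \<longlonglongrightarrow> 0"
      by (intro tendsto_norm_zero) simp
    then have "(\<lambda>i. norm (?u (x + X i) - ?u x - X i \<bullet> (\<integral>\<zeta>. G x \<zeta> \<partial>M)) / norm (X i)) \<longlonglongrightarrow> 0"
    proof (rule Lim_transform_eventually)
      show "\<forall>\<^sub>F i in sequentially. norm (\<integral>\<zeta>. R (Y i) \<zeta> \<partial>M)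
          = norm (?u (x + X i) - ?u x - X i \<bullet> (\<integral>\<zeta>. G x \<zeta> \<partial>M)) / norm (X i)"
        using ev
      proof eventually_elim
        case (elim i)
        have "(\<integral>\<zeta>. R (X i) \<zeta> \<partial>M) = (\<integral>\<zeta>. K (x + X i) \<zeta> - K x \<zeta> - X i \<bullet> G x \<zeta> \<partial>M) / norm (X i)"
          unfolding R_def by simp
        also have "(\<integral>\<zeta>. K (x + X i) \<zeta> - K x \<zeta> - X i \<bullet> G x \<zeta> \<partial>M)
            = ?u (x + X i) - ?u x - X i \<bullet> (\<integral>\<zeta>. G x \<zeta> \<partial>M)"
          using int[OF Ye[of i]] int[OF x] G by (simp add: elim integrable_inner_right)
        finally show ?case by (simp add: elim)
      qed
    qed
    then show "((\<lambda>h. norm (?u (x + h) - ?u x - h \<bullet> (\<integral>\<zeta>. G x \<zeta> \<partial>M)) / norm h) \<circ> X) \<longlonglongrightarrow> 0"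
      by (simp add: comp_def)
  qed
qed

section \<open>Hoelder's inequality and duality\<close>

lemma Lp_norm_nonneg:
  assumes "\<phi> \<in> Lp M p" "emeasure M (space M) \<noteq> 0"
  shows "Lp_norm M p \<phi> \<ge> 0"
proof (cases "p = \<infinity>")
  case True
  have "esssup M (\<lambda>z. 0 :: ereal) \<le> esssup M (\<lambda>z. ereal \<bar>\<phi> z\<bar>)" by (rule esssup_mono) auto
  then have "0 \<le> esssup M (\<lambda>z. ereal \<bar>\<phi> z\<bar>)" using assms(2) by (simp add: esssup_const)
  then show ?thesis using True by (simp add: Lp_norm_def real_of_ereal_pos)
qed (simp add: Lp_norm_def)

text \<open>The norm of \<open>g\<close> enters only through an upper bound \<open>I\<close> for its
  \<open>q\<close>-th power integral, so that one and the same constant serves all directions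
  \<open>l\<close> later on.\<close>

lemma Holder_Lp:
  fixes \<phi> g :: "'a \<Rightarrow> real"
  assumes pq: "p = \<infinity> \<and> q = 1 \<or> (\<exists>r. p = ereal r \<and> r > 1 \<and> q > 1 \<and> 1 / r + 1 / q = 1)"
    and \<phi>: "\<phi> \<in> Lp M p" and M: "emeasure M (space M) \<noteq> 0"
    and g [measurable]: "g \<in> borel_measurable M"
    and I: "(\<integral>\<^sup>+z. ennreal (\<bar>g z\<bar> powr q) \<partial>M) \<le> ennreal I" "I > 0"
  shows "integrable M (\<lambda>z. \<phi> z * g z)" and "(\<integral>z. \<phi> z * g z \<partial>M) \<le> I powr (1 / q) * Lp_norm M p \<phi>"
proof -
  have \<phi>m [measurable]: "\<phi> \<in> borel_measurable M" using \<phi> by (simp add: Lp_def)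
  have gq: "integrable M (\<lambda>z. \<bar>g z\<bar> powr q)"
    using I(1) by (intro integrableI_nonneg) (auto intro: le_less_trans)
  have "ennreal (\<integral>z. \<bar>g z\<bar> powr q \<partial>M) \<le> ennreal I"
    using I(1) by (subst nn_integral_eq_integral[symmetric]) (auto simp: gq)
  then have gI: "(\<integral>z. \<bar>g z\<bar> powr q \<partial>M) \<le> I" using I(2) by simp
  define N where "N = Lp_norm M p \<phi>"
  have N0: "N \<ge> 0" unfolding N_def by (rule Lp_norm_nonneg[OF \<phi> M])
  have "integrable M (\<lambda>z. \<phi> z * g z) \<and> (\<integral>z. \<phi> z * g z \<partial>M) \<le> I powr (1 / q) * N"
    using pq
  proof (elim disjE conjE exE)
    assume p: "p = \<infinity>" and q: "q = 1"
    have "AE z in M. ereal \<bar>\<phi> z\<bar> \<le> esssup M (\<lambda>z. ereal \<bar>\<phi> z\<bar>)" by (rule esssup_AE)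
    then have ae: "AE z in M. \<bar>\<phi> z\<bar> \<le> N"
    proof eventually_elim
      case (elim z)
      have "esssup M (\<lambda>z. ereal \<bar>\<phi> z\<bar>) < \<infinity>" using \<phi> p by (simp add: Lp_def)
      with elim show ?case
        by (cases "esssup M (\<lambda>z. ereal \<bar>\<phi> z\<bar>)") (auto simp: N_def Lp_norm_def p)
    qed
    have gi: "integrable M (\<lambda>z. \<bar>g z\<bar>)" using gq by (simp add: q powr_one')
    have ae2: "AE z in M. \<bar>\<phi> z * g z\<bar> \<le> N * \<bar>g z\<bar>"
      using ae by eventually_elim (simp add: abs_mult mult_right_mono)
    have int: "integrable M (\<lambda>z. \<phi> z * g z)"
    proof (rule Bochner_Integration.integrable_bound)
      show "integrable M (\<lambda>z. N * \<bar>g z\<bar>)" using gi by simp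
      show "AE z in M. norm (\<phi> z * g z) \<le> norm (N * \<bar>g z\<bar>)" using ae2 N0 by (simp add: abs_mult)
    qed measurable
    have "(\<integral>z. \<phi> z * g z \<partial>M) \<le> (\<integral>z. N * \<bar>g z\<bar> \<partial>M)"
      using ae2 gi int by (intro integral_mono_AE) auto
    also have "\<dots> = N * (\<integral>z. \<bar>g z\<bar> powr q \<partial>M)" by (simp add: q powr_one')
    also have "\<dots> \<le> N * I" by (intro mult_left_mono gI N0)
    finally show ?thesis using int q I(2) by (simp add: mult.commute)
  next
    fix r assume p: "p = ereal r" and r: "r > 1" and q: "q > 1" and rq: "1 / r + 1 / q = 1"
    have \<phi>r: "integrable M (\<lambda>z. \<bar>\<phi> z\<bar> powr r)" using \<phi> by (simp add: Lp_def p)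
    have N: "N = (\<integral>z. \<bar>\<phi> z\<bar> powr r \<partial>M) powr (1 / r)" by (simp add: N_def Lp_norm_def p)
    have int: "integrable M (\<lambda>z. \<phi> z * g z)"
    proof (rule Bochner_Integration.integrable_bound)
      show "integrable M (\<lambda>z. \<bar>\<phi> z\<bar> powr r / r + \<bar>g z\<bar> powr q / q)" using \<phi>r gq by simp
      show "AE z in M. norm (\<phi> z * g z) \<le> norm (\<bar>\<phi> z\<bar> powr r / r + \<bar>g z\<bar> powr q / q)"
        using Youngs_inequality[OF r q rq] r q by (auto simp: abs_mult intro!: AE_I2)
    qed measurable
    have "(\<integral>z. \<phi> z * g z \<partial>M) \<le> I powr (1 / q) * N"
    \<comment> \<open>A function of norm 0 cannot be normalized; it vanishes almost everywhere, and
      so does the product.\<close>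
    proof (cases "N = 0")
      case True
      then have "(\<integral>z. \<bar>\<phi> z\<bar> powr r \<partial>M) = 0" by (simp add: N)
      then have "AE z in M. \<bar>\<phi> z\<bar> powr r = 0"
        using \<phi>r by (subst (asm) integral_nonneg_eq_0_iff_AE) auto
      then have "(\<integral>z. \<phi> z * g z \<partial>M) = (\<integral>z. 0 \<partial>M)"
        by (intro integral_cong_AE) (auto elim!: eventually_mono)
      then show ?thesis using True by simp
    next
      case False
      then have Np: "N > 0" using N0 by simp
      define J where "J = I powr (1 / q)"
      have Jp: "J > 0" using I(2) by (simp add: J_def)
      have Jq: "J powr q = I" using I(2) q by (simp add: J_def powr_powr)
      have Nr: "N powr r = (\<integral>z. \<bar>\<phi> z\<bar> powr r \<partial>M)" using r by (simp add: N powr_powr)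
      have "\<phi> z * g z \<le> N * J * (\<bar>\<phi> z\<bar> powr r / (r * N powr r) + \<bar>g z\<bar> powr q / (q * J powr q))" for z
      proof -
        \<comment> \<open>Young's inequality is applied to functions scaled so that the power
          integrals of \<open>\<bar>\<phi>\<bar> / N\<close> and \<open>\<bar>g\<bar> / J\<close>
          are at most 1; integration then leaves \<open>1 / r + 1 / q = 1\<close>.\<close>
        have "\<bar>\<phi> z\<bar> / N * (\<bar>g z\<bar> / J) \<le> (\<bar>\<phi> z\<bar> / N) powr r / r + (\<bar>g z\<bar> / J) powr q / q"
          using Np Jp by (intro Youngs_inequality[OF r q rq]) auto
        also have "\<dots> = \<bar>\<phi> z\<bar> powr r / (r * N powr r) + \<bar>g z\<bar> powr q / (q * J powr q)"
          using Np Jp by (simp add: powr_divide mult.commute)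
        finally have "N * J * (\<bar>\<phi> z\<bar> / N * (\<bar>g z\<bar> / J)) \<le> N * J * (\<bar>\<phi> z\<bar> powr r / (r * N powr r) + \<bar>g z\<bar> powr q / (q * J powr q))"
          using Np Jp by (intro mult_left_mono) auto
        moreover have "N * J * (\<bar>\<phi> z\<bar> / N * (\<bar>g z\<bar> / J)) = \<bar>\<phi> z\<bar> * \<bar>g z\<bar>" using Np Jp by simp
        moreover have "\<phi> z * g z \<le> \<bar>\<phi> z\<bar> * \<bar>g z\<bar>" by (metis abs_ge_self abs_mult)
        ultimately show ?thesis by linarith
      qed
      then have "(\<integral>z. \<phi> z * g z \<partial>M) \<le> (\<integral>z. N * J * (\<bar>\<phi> z\<bar> powr r / (r * N powr r) + \<bar>g z\<bar> powr q / (q * J powr q)) \<partial>M)"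
        using int \<phi>r gq by (intro integral_mono) auto
      also have "\<dots> = N * J * ((\<integral>z. \<bar>\<phi> z\<bar> powr r \<partial>M) / (r * N powr r) + (\<integral>z. \<bar>g z\<bar> powr q \<partial>M) / (q * J powr q))"
        using \<phi>r gq by simp
      also have "\<dots> \<le> N * J * (1 / r + 1 / q)"
      proof (intro mult_left_mono add_mono)
        have "N powr r > 0" using Np by simp
        then show "(\<integral>z. \<bar>\<phi> z\<bar> powr r \<partial>M) / (r * N powr r) \<le> 1 / r" unfolding Nr[symmetric] by simp
        have "(\<integral>z. \<bar>g z\<bar> powr q \<partial>M) / (q * I) \<le> I / (q * I)"
          using gI I(2) q by (intro divide_right_mono) auto
        then show "(\<integral>z. \<bar>g z\<bar> powr q \<partial>M) / (q * J powr q) \<le> 1 / q"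
          unfolding Jq using I(2) by simp
      qed (use Np Jp in auto)
      finally show ?thesis by (simp add: rq J_def mult.commute)
    qed
    then show ?thesis using int by blast
  qed
  then show "integrable M (\<lambda>z. \<phi> z * g z)" "(\<integral>z. \<phi> z * g z \<partial>M) \<le> I powr (1 / q) * Lp_norm M p \<phi>"
    by (simp_all add: N_def)
qed

text \<open>The norm of the vector integral is its inner product with its own direction, which
  reduces the upper bound to scalar Hoelder with a constant uniform in \<open>l\<close>. Sharpness
  needs only the single direction \<open>l0\<close> where that constant is attained.\<close>

lemma Lp_vector_duality:
  fixes G :: "'b \<Rightarrow> 'a::euclidean_space"
  assumes pq: "p = \<infinity> \<and> q = 1 \<or> (\<exists>r. p = ereal r \<and> r > 1 \<and> q > 1 \<and> 1 / r + 1 / q = 1)"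
    and G [measurable]: "G \<in> borel_measurable M"
    and l0: "norm l0 = 1" and I: "I > 0"
    and I0: "(\<integral>\<^sup>+z. ennreal (\<bar>G z \<bullet> l0\<bar> powr q) \<partial>M) = ennreal I"
    and Il: "\<And>l. norm l = 1 \<Longrightarrow> (\<integral>\<^sup>+z. ennreal (\<bar>G z \<bullet> l\<bar> powr q) \<partial>M) \<le> ennreal I"
  shows "\<And>\<phi>. \<phi> \<in> Lp M p \<Longrightarrow> integrable M (\<lambda>z. \<phi> z *\<^sub>R G z)"
    and "sharp_inequality (Lp M p) (\<lambda>\<phi>. norm (\<integral>z. \<phi> z *\<^sub>R G z \<partial>M)) (Lp_norm M p) (I powr (1 / q))"
proof -
  have M: "emeasure M (space M) \<noteq> 0"
  proof
    assume "emeasure M (space M) = 0"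
    then have "AE z in M. ennreal (\<bar>G z \<bullet> l0\<bar> powr q) = 0"
      by (intro AE_I[of _ _ "space M"]) auto
    then have "(\<integral>\<^sup>+z. ennreal (\<bar>G z \<bullet> l0\<bar> powr q) \<partial>M) = (\<integral>\<^sup>+z. 0 \<partial>M)"
      by (rule nn_integral_cong_AE)
    then show False using I0 I by simp
  qed
  have q: "q \<ge> 1" using pq by auto
  show int: "integrable M (\<lambda>z. \<phi> z *\<^sub>R G z)" if \<phi>: "\<phi> \<in> Lp M p" for \<phi>
  proof (rule Bochner_Integration.integrable_bound)
    have [measurable]: "\<phi> \<in> borel_measurable M" using \<phi> by (simp add: Lp_def)
    show "(\<lambda>z. \<phi> z *\<^sub>R G z) \<in> borel_measurable M" by measurable
    show "integrable M (\<lambda>z. \<Sum>b\<in>Basis. \<bar>\<phi> z * (G z \<bullet> b)\<bar>)"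
    proof (intro Bochner_Integration.integrable_sum integrable_abs)
      fix b :: 'a assume "b \<in> Basis"
      then show "integrable M (\<lambda>z. \<phi> z * (G z \<bullet> b))"
        by (intro Holder_Lp(1)[OF pq \<phi> M _ Il I]) auto
    qed
    have "norm (\<phi> z *\<^sub>R G z) \<le> norm (\<Sum>b\<in>Basis. \<bar>\<phi> z * (G z \<bullet> b)\<bar>)" for z
      using norm_le_l1[of "\<phi> z *\<^sub>R G z"] by (simp add: sum_nonneg)
    then show "AE z in M. norm (\<phi> z *\<^sub>R G z) \<le> norm (\<Sum>b\<in>Basis. \<bar>\<phi> z * (G z \<bullet> b)\<bar>)" by simp
  qed
  have inn: "(\<integral>z. \<phi> z *\<^sub>R G z \<partial>M) \<bullet> l = (\<integral>z. \<phi> z * (G z \<bullet> l) \<partial>M)" if "\<phi> \<in> Lp M p" for \<phi> l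
    using integral_inner_left[of l, OF int[OF that]] by simp
  show "sharp_inequality (Lp M p) (\<lambda>\<phi>. norm (\<integral>z. \<phi> z *\<^sub>R G z \<partial>M)) (Lp_norm M p) (I powr (1 / q))"
    unfolding sharp_inequality_def
  proof (intro conjI ballI allI impI)
    fix \<phi> assume \<phi>: "\<phi> \<in> Lp M p"
    let ?v = "\<integral>z. \<phi> z *\<^sub>R G z \<partial>M"
    show "norm ?v \<le> I powr (1 / q) * Lp_norm M p \<phi>"
    proof (cases "?v = 0")
      case True
      then show ?thesis using Lp_norm_nonneg[OF \<phi> M] by simp
    next
      case False
      then have l: "norm (sgn ?v) = 1" by (simp add: norm_sgn)
      have "norm ?v = ?v \<bullet> sgn ?v"
        using False by (simp add: sgn_div_norm power2_norm_eq_inner[symmetric] power2_eq_square)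
      also have "\<dots> = (\<integral>z. \<phi> z * (G z \<bullet> sgn ?v) \<partial>M)" by (rule inn[OF \<phi>])
      also have "\<dots> \<le> I powr (1 / q) * Lp_norm M p \<phi>"
        by (rule Holder_Lp(2)[OF pq \<phi> M _ Il[OF l] I]) measurable
      finally show ?thesis .
    qed
  next
    fix C' assume C': "\<forall>\<phi>\<in>Lp M p. norm (\<integral>z. \<phi> z *\<^sub>R G z \<partial>M) \<le> C' * Lp_norm M p \<phi>"
    define g where "g = (\<lambda>z. G z \<bullet> l0)"
    have [measurable]: "g \<in> borel_measurable M" unfolding g_def by measurable
    have gq: "integrable M (\<lambda>z. \<bar>g z\<bar> powr q)"
      using I0 by (intro integrableI_nonneg) (auto simp: g_def)
    have "ennreal (\<integral>z. \<bar>g z\<bar> powr q \<partial>M) = ennreal I"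
      using I0 by (subst nn_integral_eq_integral[symmetric]) (auto simp: gq[unfolded g_def] g_def)
    then have gI: "(\<integral>z. \<bar>g z\<bar> powr q \<partial>M) = I" using I by simp
    \<comment> \<open>equality case of Hoelder's inequality\<close>
    define \<phi> where "\<phi> = (\<lambda>z. sgn (g z) * \<bar>g z\<bar> powr (q - 1))"
    have [measurable]: "\<phi> \<in> borel_measurable M"
      unfolding \<phi>_def sgn_real_def by measurable
    have \<phi>g: "\<phi> z * g z = \<bar>g z\<bar> powr q" for z
    proof (cases "g z = 0")
      case False
      then have "\<bar>g z\<bar> powr q = \<bar>g z\<bar> powr (q - 1) * \<bar>g z\<bar>"
        using powr_add[of "\<bar>g z\<bar>" "q - 1" 1] by simp
      then show ?thesis by (simp add: \<phi>_def sgn_real_def abs_if)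
    qed (simp add: \<phi>_def)
    \<comment> \<open>Testing the assumed inequality on the extremal function and projecting onto
      \<open>l0\<close> recovers the whole integral \<open>I\<close>.\<close>
    have low: "I \<le> C' * Lp_norm M p \<phi>" if \<phi>L: "\<phi> \<in> Lp M p"
    proof -
      have "I = (\<integral>z. \<phi> z *\<^sub>R G z \<partial>M) \<bullet> l0"
        unfolding inn[OF \<phi>L] using gI by (simp add: \<phi>g[unfolded g_def] g_def)
      also have "\<dots> \<le> norm (\<integral>z. \<phi> z *\<^sub>R G z \<partial>M)"
        using Cauchy_Schwarz_ineq2[of "\<integral>z. \<phi> z *\<^sub>R G z \<partial>M" l0] l0 by simp
      also have "\<dots> \<le> C' * Lp_norm M p \<phi>" using C' \<phi>L by blast
      finally show ?thesis .
    qed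
    show "I powr (1 / q) \<le> C'"
      using pq
    proof (elim disjE conjE exE)
      assume p: "p = \<infinity>" and q: "q = 1"
      have "esssup M (\<lambda>z. ereal \<bar>\<phi> z\<bar>) \<le> 1"
      proof (rule esssup_I)
        show "AE z in M. ereal \<bar>\<phi> z\<bar> \<le> 1"
          by (rule AE_I2) (auto simp: \<phi>_def q sgn_real_def abs_mult)
      qed measurable
      then have e: "esssup M (\<lambda>z. ereal \<bar>\<phi> z\<bar>) \<le> 1" "esssup M (\<lambda>z. ereal \<bar>\<phi> z\<bar>) < \<infinity>" by auto
      have \<phi>L: "\<phi> \<in> Lp M p" using e(2) by (simp add: Lp_def p)
      have N: "0 \<le> Lp_norm M p \<phi>" by (rule Lp_norm_nonneg[OF \<phi>L M])
      have N1: "Lp_norm M p \<phi> \<le> 1"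
        using e(1) by (cases "esssup M (\<lambda>z. ereal \<bar>\<phi> z\<bar>)") (auto simp: Lp_norm_def p)
      \<comment> \<open>Here \<open>\<phi>\<close> is the sign of \<open>g\<close>, and only the
        bound 1 on its norm is available; \<open>C'\<close> must be known to be positive before that
        bound can be multiplied by it.\<close>
      have "C' * Lp_norm M p \<phi> > 0" using low[OF \<phi>L] I by simp
      then have "C' > 0" using N by (simp add: zero_less_mult_iff)
      then have "C' * Lp_norm M p \<phi> \<le> C' * 1" using N1 by (intro mult_left_mono) auto
      then show ?thesis using low[OF \<phi>L] I q by simp
    next
      fix r assume p: "p = ereal r" and r: "r > 1" and q: "q > 1" and rq: "1 / r + 1 / q = 1"
      \<comment> \<open>Conjugacy of the exponents makes \<open>\<bar>\<phi>\<bar> powr r\<close>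
        equal to \<open>\<bar>g\<bar> powr q\<close>, so the norm of \<open>\<phi>\<close> is
        \<open>I powr (1 / r)\<close>.\<close>
      have qr: "(q - 1) * r = q"
        using rq r q by (simp add: field_simps)
      have \<phi>r: "\<bar>\<phi> z\<bar> powr r = \<bar>g z\<bar> powr q" for z
      proof (cases "g z = 0")
        case False
        then have "\<bar>\<phi> z\<bar> = \<bar>g z\<bar> powr (q - 1)" by (simp add: \<phi>_def abs_mult sgn_real_def)
        then show ?thesis by (simp add: powr_powr qr)
      qed (use r in \<open>simp add: \<phi>_def\<close>)
      have \<phi>L: "\<phi> \<in> Lp M p" using gq by (simp add: Lp_def p \<phi>r)
      have "Lp_norm M p \<phi> = I powr (1 / r)" by (simp add: Lp_norm_def p \<phi>r gI)
      then have "I \<le> C' * I powr (1 / r)" using low[OF \<phi>L] by simp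
      moreover have "I = I powr (1 / q) * I powr (1 / r)"
        using I rq by (simp add: powr_add[symmetric] add.commute)
      ultimately have "I powr (1 / q) * I powr (1 / r) \<le> C' * I powr (1 / r)" by simp
      then show ?thesis using I by (simp add: mult_le_cancel_right)
    qed
  qed
qed

lemma gradient_eq:
  assumes "(f has_derivative (\<lambda>h. h \<bullet> D)) (at x)"
  shows "gradient f x = D"
proof -
  have G: "GDERIV f x :> D'" if "(f has_derivative (\<lambda>h. h \<bullet> D')) (at x)" for D'
    using that by (simp add: gderiv_def)
  show ?thesis unfolding gradient_def
  proof (rule the_equality[where P = "\<lambda>D. GDERIV f x :> D"])
    show "GDERIV f x :> D" by (rule G[OF assms])
    fix D' assume "GDERIV f x :> D'"
    then have "(f has_derivative (\<lambda>h. h \<bullet> D')) (at x)" by (simp add: gderiv_def)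
    from has_derivative_unique[OF this assms] have "h \<bullet> D' = h \<bullet> D" for h by meson
    then show "D' = D" by (metis vector_eq_rdot inner_commute)
  qed
qed

text \<open>The hypotheses \<open>Kb\<close> and \<open>Gb\<close> are Harnack-type bounds: near
  \<open>x\<close> the kernel and its gradient are controlled by the gradient at \<open>x\<close>
  itself. Duality already makes \<open>\<phi>\<close> times that gradient integrable, and this is
  the dominating function. It works for the infinite measure on the boundary of the half-space as
  well.\<close>

lemma kernel_integral_sharp_gradient:
  fixes K :: "'a::euclidean_space \<Rightarrow> 'b \<Rightarrow> real" and G :: "'a \<Rightarrow> 'b \<Rightarrow> 'a"
  assumes e: "e > 0"
    and Km: "\<And>y. y \<in> ball x e \<Longrightarrow> K y \<in> borel_measurable M"
    and der: "\<And>\<zeta> y. \<zeta> \<in> space M \<Longrightarrow> y \<in> ball x e \<Longrightarrow>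
      ((\<lambda>y. K y \<zeta>) has_derivative (\<lambda>h. h \<bullet> G y \<zeta>)) (at y)"
    and Kb: "\<And>\<zeta> y. \<zeta> \<in> space M \<Longrightarrow> y \<in> ball x e \<Longrightarrow> \<bar>K y \<zeta>\<bar> \<le> C * norm (G x \<zeta>)"
    and Gb: "\<And>\<zeta> y. \<zeta> \<in> space M \<Longrightarrow> y \<in> ball x e \<Longrightarrow> norm (G y \<zeta>) \<le> C * norm (G x \<zeta>)"
    and pq: "p = \<infinity> \<and> q = 1 \<or> (\<exists>r. p = ereal r \<and> r > 1 \<and> q > 1 \<and> 1 / r + 1 / q = 1)"
    and Gm: "G x \<in> borel_measurable M"
    and l0: "norm l0 = 1" and I: "I > 0"
    and I0: "(\<integral>\<^sup>+z. ennreal (\<bar>G x z \<bullet> l0\<bar> powr q) \<partial>M) = ennreal I"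
    and Il: "\<And>l. norm l = 1 \<Longrightarrow> (\<integral>\<^sup>+z. ennreal (\<bar>G x z \<bullet> l\<bar> powr q) \<partial>M) \<le> ennreal I"
  defines "u \<equiv> \<lambda>\<phi> y. \<integral>\<zeta>. K y \<zeta> * \<phi> \<zeta> \<partial>M"
  shows "\<And>\<phi>. \<phi> \<in> Lp M p \<Longrightarrow> u \<phi> differentiable (at x)"
    and "sharp_inequality (Lp M p) (\<lambda>\<phi>. norm (gradient (u \<phi>) x)) (Lp_norm M p) (I powr (1 / q))"
proof -
  note dual = Lp_vector_duality[OF pq Gm l0 I I0 Il]
  have D: "(u \<phi> has_derivative (\<lambda>h. h \<bullet> (\<integral>\<zeta>. \<phi> \<zeta> *\<^sub>R G x \<zeta> \<partial>M))) (at x)" if \<phi>: "\<phi> \<in> Lp M p" for \<phi>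
    unfolding u_def
  proof (rule has_derivative_integral_dominated[OF e, where B = "\<lambda>\<zeta>. C * norm (\<phi> \<zeta> *\<^sub>R G x \<zeta>)"])
    have [measurable]: "\<phi> \<in> borel_measurable M" using \<phi> by (simp add: Lp_def)
    show int: "integrable M (\<lambda>\<zeta>. \<phi> \<zeta> *\<^sub>R G x \<zeta>)" by (rule dual(1)[OF _ \<phi>])
    then show intB: "integrable M (\<lambda>\<zeta>. C * norm (\<phi> \<zeta> *\<^sub>R G x \<zeta>))"
      by (intro Bochner_Integration.integrable_mult_right Bochner_Integration.integrable_norm)
    show "integrable M (\<lambda>\<zeta>. K y \<zeta> * \<phi> \<zeta>)" if y: "y \<in> ball x e" for y
    proof (rule Bochner_Integration.integrable_bound[OF intB])
      show "(\<lambda>\<zeta>. K y \<zeta> * \<phi> \<zeta>) \<in> borel_measurable M" using Km[OF y] by measurable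
      show "AE \<zeta> in M. norm (K y \<zeta> * \<phi> \<zeta>) \<le> norm (C * norm (\<phi> \<zeta> *\<^sub>R G x \<zeta>))"
      proof (rule AE_I2)
        fix \<zeta> assume "\<zeta> \<in> space M"
        from mult_right_mono[OF Kb[OF this y], of "\<bar>\<phi> \<zeta>\<bar>"]
        have "norm (K y \<zeta> * \<phi> \<zeta>) \<le> C * norm (\<phi> \<zeta> *\<^sub>R G x \<zeta>)" by (simp add: abs_mult mult_ac)
        then show "norm (K y \<zeta> * \<phi> \<zeta>) \<le> norm (C * norm (\<phi> \<zeta> *\<^sub>R G x \<zeta>))" by simp
      qed
    qed
    fix \<zeta> y assume \<zeta>: "\<zeta> \<in> space M" and y: "y \<in> ball x e"
    show "((\<lambda>y. K y \<zeta> * \<phi> \<zeta>) has_derivative (\<lambda>h. h \<bullet> (\<phi> \<zeta> *\<^sub>R G y \<zeta>))) (at y)"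
      using has_derivative_mult_left[OF der[OF \<zeta> y], of "\<phi> \<zeta>"] by (simp add: mult.commute)
    show "norm (\<phi> \<zeta> *\<^sub>R G y \<zeta>) \<le> C * norm (\<phi> \<zeta> *\<^sub>R G x \<zeta>)"
      using mult_left_mono[OF Gb[OF \<zeta> y], of "\<bar>\<phi> \<zeta>\<bar>"] by (simp add: mult_ac)
  qed
  show "u \<phi> differentiable (at x)" if "\<phi> \<in> Lp M p" for \<phi>
    using D[OF that] differentiableI by blast
  show "sharp_inequality (Lp M p) (\<lambda>\<phi>. norm (gradient (u \<phi>) x)) (Lp_norm M p) (I powr (1 / q))"
    using dual(2) by (simp add: sharp_inequality_def gradient_eq[OF D])
qed

subsection \<open>The ball\<close>

text \<open>The distance formula for the inversion in the unit sphere. Up to scaling and translation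
  both boundary maps are such inversions, and this identity is the source of their conformal
  factors.\<close>

lemma norm_inversion_diff:
  fixes u v :: "'a::real_inner"
  assumes "u \<noteq> 0" "v \<noteq> 0"
  shows "(norm (u /\<^sub>R (norm u)\<^sup>2 - v /\<^sub>R (norm v)\<^sup>2))\<^sup>2 = (norm (u - v))\<^sup>2 / ((norm u)\<^sup>2 * (norm v)\<^sup>2)"
proof -
  define a b c where "a = u \<bullet> u" and "b = v \<bullet> v" and "c = u \<bullet> v"
  have ab: "a > 0" "b > 0" using assms by (auto simp: a_def b_def)
  have "(norm (u /\<^sub>R a - v /\<^sub>R b))\<^sup>2 = a / a\<^sup>2 - 2 * c / (a * b) + b / b\<^sup>2"
    unfolding power2_norm_eq_inner
    by (simp add: inner_diff_left inner_diff_right inner_commute[of v u] a_def[symmetric] b_def[symmetric] c_def[symmetric]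
        power2_eq_square divide_inverse) (simp add: algebra_simps)
  also have "\<dots> = (a - 2 * c + b) / (a * b)" using ab by (simp add: field_simps power2_eq_square)
  also have "a - 2 * c + b = (norm (u - v))\<^sup>2"
    unfolding power2_norm_eq_inner
    by (simp add: inner_diff_left inner_diff_right inner_commute[of v u] a_def b_def c_def)
  finally show ?thesis by (simp add: a_def b_def power2_norm_eq_inner)
qed

text \<open>The law of cosines, splitting a chord into a radial and a spherical part. A
  norm-preserving radial extension of a map of the sphere changes only the second part.\<close>

lemma norm_scaled_unit_diff:
  fixes a b :: "'a::real_inner"
  assumes "norm a = 1" "norm b = 1"
  shows "(norm (r *\<^sub>R a - t *\<^sub>R b))\<^sup>2 = (r - t)\<^sup>2 + r * t * (norm (a - b))\<^sup>2"
proof -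
  have "a \<bullet> a = 1" "b \<bullet> b = 1" using assms by (simp_all add: norm_eq_1)
  then show ?thesis
    unfolding power2_norm_eq_inner
    by (simp add: inner_diff_left inner_diff_right inner_commute[of b a]) (simp add: algebra_simps power2_eq_square)
qed

definition ball_factor :: "'a::euclidean_space \<Rightarrow> 'a \<Rightarrow> real" where
  "ball_factor x \<zeta> = (1 - (norm x)\<^sup>2) / (norm (x - \<zeta>))\<^sup>2"

text \<open>On the unit sphere this is the Moebius automorphism of the ball that exchanges \<open>x\<close> and \<open>0\<close>.
  Its conformal factor \<open>ball_factor\<close> is the Poisson kernel raised to the power \<open>1 / (n - 1)\<close>.\<close>
definition ball_involution :: "'a::euclidean_space \<Rightarrow> 'a \<Rightarrow> 'a" where
  "ball_involution x \<zeta> = x + ball_factor x \<zeta> *\<^sub>R (x - \<zeta>)"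

lemma ball_factor_borel [measurable]: "(\<lambda>\<zeta>. ball_factor x \<zeta>) \<in> borel_measurable borel"
  unfolding ball_factor_def by measurable

lemma ball_involution_borel [measurable]: "ball_involution x \<in> borel_measurable borel"
  unfolding ball_involution_def by measurable

context
  fixes x :: "'a::euclidean_space"
  assumes x: "norm x < 1"
begin

lemma one_minus_norm_sq_pos: "1 - (norm x)\<^sup>2 > 0"
  using x by (simp add: abs_square_less_1)

lemma diff_sphere_nonzero: "norm \<zeta> = 1 \<Longrightarrow> x - \<zeta> \<noteq> 0"
  using x by auto

lemma ball_factor_pos: "norm \<zeta> = 1 \<Longrightarrow> ball_factor x \<zeta> > 0"
  unfolding ball_factor_def using diff_sphere_nonzero one_minus_norm_sq_pos by simp

lemma norm_ball_involution:
  assumes "norm \<zeta> = 1" shows "norm (ball_involution x \<zeta>) = 1"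
proof -
  define d where "d = (norm (x - \<zeta>))\<^sup>2"
  have d: "d > 0" unfolding d_def using diff_sphere_nonzero[OF assms] by simp
  have dd: "d = (norm x)\<^sup>2 + 1 - 2 * (x \<bullet> \<zeta>)"
    unfolding d_def using assms by (simp add: power2_norm_eq_inner inner_diff_left inner_diff_right inner_commute norm_eq_1)
  define c where "c = ball_factor x \<zeta>"
  have c: "c * d = 1 - (norm x)\<^sup>2" using d by (simp add: c_def ball_factor_def d_def)
  have "(norm (ball_involution x \<zeta>))\<^sup>2 = (norm x)\<^sup>2 + 2 * c * (x \<bullet> (x - \<zeta>)) + c\<^sup>2 * d"
    unfolding ball_involution_def c_def[symmetric] d_def power2_norm_eq_inner
    by (simp add: inner_add_left inner_add_right inner_commute) (simp add: algebra_simps power2_eq_square)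
  \<comment> \<open>On the unit sphere \<open>2 * (x \<bullet> (x - \<zeta>))\<close> equals
    \<open>d\<close> minus \<open>1 - (norm x)\<^sup>2\<close>, and the latter is
    \<open>c * d\<close> by the choice of \<open>c\<close>.\<close>
  also have "2 * (x \<bullet> (x - \<zeta>)) = d - c * d"
    unfolding c unfolding dd by (simp add: inner_diff_right power2_norm_eq_inner)
  then have "2 * c * (x \<bullet> (x - \<zeta>)) = c * (d - c * d)" by (simp add: mult_ac)
  also have "(norm x)\<^sup>2 + c * (d - c * d) + c\<^sup>2 * d = (norm x)\<^sup>2 + c * d"
    by (simp add: algebra_simps power2_eq_square)
  also have "\<dots> = 1" using c by simp
  finally show ?thesis
    using norm_ge_zero[of "ball_involution x \<zeta>"] by (auto simp: power2_eq_1_iff)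
qed

text \<open>It serves twice: it shows that the factor at the image point is the reciprocal of the
  factor at \<open>\<zeta>\<close>, and it expresses the kernel in the new variable, where the
  square expands to a multiple of \<open>1 - w * (\<eta> \<bullet> e)\<close>.\<close>

lemma norm_ball_involution_minus:
  assumes "norm \<zeta> = 1"
  shows "(norm (x - ball_involution x \<zeta>))\<^sup>2 = (1 - (norm x)\<^sup>2) * ball_factor x \<zeta>"
proof -
  have "(norm (x - ball_involution x \<zeta>))\<^sup>2 = (ball_factor x \<zeta>)\<^sup>2 * (norm (x - \<zeta>))\<^sup>2"
    by (simp add: ball_involution_def power_mult_distrib)
  then show ?thesis using diff_sphere_nonzero[OF assms] by (simp add: ball_factor_def power2_eq_square)
qed

lemma ball_involution_involution:
  assumes "norm \<zeta> = 1"
  shows "ball_involution x (ball_involution x \<zeta>) = \<zeta>"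
proof -
  have c: "ball_factor x \<zeta> > 0" by (rule ball_factor_pos[OF assms])
  have "ball_factor x (ball_involution x \<zeta>) = 1 / ball_factor x \<zeta>"
    unfolding ball_factor_def[of x "ball_involution x \<zeta>"] norm_ball_involution_minus[OF assms]
    using one_minus_norm_sq_pos by simp
  then have "ball_involution x (ball_involution x \<zeta>)
      = x + (1 / ball_factor x \<zeta>) *\<^sub>R (x - (x + ball_factor x \<zeta> *\<^sub>R (x - \<zeta>)))"
    by (simp only: ball_involution_def[of x "ball_involution x \<zeta>"]) (simp only: ball_involution_def)
  then show ?thesis using c by simp
qed

lemma norm_ball_involution_diff:
  assumes "norm \<zeta> = 1" "norm \<xi> = 1"
  shows "(norm (ball_involution x \<zeta> - ball_involution x \<xi>))\<^sup>2
    = ball_factor x \<zeta> * ball_factor x \<xi> * (norm (\<zeta> - \<xi>))\<^sup>2"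
proof -
  let ?u = "x - \<zeta>" and ?v = "x - \<xi>" and ?c = "1 - (norm x)\<^sup>2"
  have nz: "?u \<noteq> 0" "?v \<noteq> 0" using assms diff_sphere_nonzero by auto
  have "ball_involution x \<zeta> - ball_involution x \<xi> = ?c *\<^sub>R (?u /\<^sub>R (norm ?u)\<^sup>2 - ?v /\<^sub>R (norm ?v)\<^sup>2)"
    by (simp add: ball_involution_def ball_factor_def scaleR_diff_right divide_inverse)
  then have "(norm (ball_involution x \<zeta> - ball_involution x \<xi>))\<^sup>2
      = ?c\<^sup>2 * (norm (?u /\<^sub>R (norm ?u)\<^sup>2 - ?v /\<^sub>R (norm ?v)\<^sup>2))\<^sup>2"
    by (simp add: power_mult_distrib)
  also have "\<dots> = ?c\<^sup>2 * ((norm (?u - ?v))\<^sup>2 / ((norm ?u)\<^sup>2 * (norm ?v)\<^sup>2))"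
    by (simp only: norm_inversion_diff[OF nz])
  also have "norm (?u - ?v) = norm (\<zeta> - \<xi>)" by (simp add: norm_minus_commute)
  finally show ?thesis by (simp add: ball_factor_def power2_eq_square)
qed

text \<open>The boundary map is extended by
  \<open>F z = norm z *\<^sub>R ball_involution x (sgn z)\<close>, a norm-preserving involution of
  the punctured ball. It is unstretched along the radius and stretches by \<open>ball_factor\<close>
  across it.\<close>

lemma nn_integral_ball_involution:
  assumes g [measurable]: "g \<in> borel_measurable borel"
  shows "(\<integral>\<^sup>+\<zeta>. ennreal (ball_factor x \<zeta> ^ (DIM('a) - 1)) * g (ball_involution x \<zeta>) \<partial>sphere_measure)
    = (\<integral>\<^sup>+\<zeta>. g \<zeta> \<partial>sphere_measure)"
proof -
  note [measurable] = sgn_borel_measurable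
  define S where "S = ball (0::'a) 1 - {0}"
  define F where "F = (\<lambda>z::'a. norm z *\<^sub>R ball_involution x (sgn z))"
  have S0: "z \<noteq> 0" "norm (sgn z) = 1" if "z \<in> S" for z using that by (auto simp: S_def norm_sgn)
  have nF: "norm (F z) = norm z" if "z \<in> S" for z
    using S0[OF that] by (simp add: F_def norm_ball_involution)
  have sF: "sgn (F z) = ball_involution x (sgn z)" if "z \<in> S" for z
  proof -
    have "sgn (F z) = F z /\<^sub>R norm z" by (simp add: sgn_div_norm nF[OF that])
    then show ?thesis using S0(1)[OF that] by (simp add: F_def)
  qed
  have FS: "F z \<in> S" if "z \<in> S" for z
    using nF[OF that] that by (auto simp: S_def)
  have FF: "F (F z) = z" if "z \<in> S" for z
  proof -
    have "F (F z) = norm z *\<^sub>R ball_involution x (ball_involution x (sgn z))"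
      by (subst F_def) (simp add: nF[OF that] sF[OF that])
    then show ?thesis using S0[OF that] by (simp add: ball_involution_involution sgn_div_norm)
  qed
  have bij: "bij_betw F S S"
    by (rule bij_betw_byWitness[where f' = F]) (use FF FS in auto)
  \<comment> \<open>Subtracting the radial part from the squared chord leaves the spherical part,
    and the boundary map multiplies exactly this by the two conformal factors.\<close>
  have chord: "(norm (F w - F z))\<^sup>2 = (norm w - norm z)\<^sup>2
      + ball_factor x (sgn w) * ball_factor x (sgn z) * ((norm (w - z))\<^sup>2 - (norm w - norm z)\<^sup>2)"
    if "w \<in> S" "z \<in> S" for w z
  proof -
    have w: "norm w *\<^sub>R sgn w = w" and z: "norm z *\<^sub>R sgn z = z"
      using S0 that by (simp_all add: sgn_div_norm)
    have "(norm (w - z))\<^sup>2 = (norm w - norm z)\<^sup>2 + norm w * norm z * (norm (sgn w - sgn z))\<^sup>2"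
      using norm_scaled_unit_diff[OF S0(2)[OF that(1)] S0(2)[OF that(2)], of "norm w" "norm z"]
      unfolding w z .
    moreover have "(norm (F w - F z))\<^sup>2 = (norm w - norm z)\<^sup>2 + norm w * norm z
        * (norm (ball_involution x (sgn w) - ball_involution x (sgn z)))\<^sup>2"
      unfolding F_def using that by (intro norm_scaled_unit_diff norm_ball_involution S0)
    ultimately show ?thesis
      using that by (simp add: norm_ball_involution_diff S0)
  qed
  have oS: "open S" unfolding S_def by (intro open_Diff) auto
  have sd: "sgn differentiable (at z)" if "z \<noteq> 0" for z :: 'a
    unfolding sgn_div_norm[abs_def] using that by simp
  have cd: "(\<lambda>z. ball_factor x (sgn z)) differentiable (at z)" if "z \<in> S" for z
    unfolding ball_factor_def power2_norm_eq_inner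
    using sd[OF S0(1)[OF that]] diff_sphere_nonzero[OF S0(2)[OF that]] by simp
  have Fd: "F differentiable (at z)" if "z \<in> S" for z
    unfolding F_def ball_involution_def
    using sd[OF S0(1)[OF that]] cd[OF that] S0(1)[OF that] by simp
  have [measurable]: "F \<in> borel_measurable borel" unfolding F_def by measurable
  have "(\<integral>\<^sup>+z\<in>S. ennreal (ball_factor x (sgn z) ^ (DIM('a) - 1)) * g (sgn (F z)) \<partial>lborel)
      = (\<integral>\<^sup>+z\<in>S. g (sgn z) \<partial>lborel)"
  proof (rule nn_integral_conformal_change[where e = sgn and f' = "\<lambda>z. frechet_derivative F (at z)" and g = "\<lambda>z. g (sgn z)"])
    show "S \<in> sets borel" "S \<in> sets borel" using oS by auto
    show "bounded S" by (rule bounded_subset[of "ball 0 1"]) (auto simp: S_def)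
    show "bij_betw F S S" by (rule bij)
    fix z assume z: "z \<in> S"
    show D: "(F has_derivative frechet_derivative F (at z)) (at z)"
      using Fd[OF z] by (simp add: frechet_derivative_works)
    show "norm (sgn z) = 1" by (rule S0(2)[OF z])
    show "ball_factor x (sgn z) > 0" by (rule ball_factor_pos[OF S0(2)[OF z]])
    fix v
    show "(norm (frechet_derivative F (at z) v))\<^sup>2
        = (v \<bullet> sgn z)\<^sup>2 + (ball_factor x (sgn z))\<^sup>2 * ((norm v)\<^sup>2 - (v \<bullet> sgn z)\<^sup>2)"
    proof (rule chord_identity_derivative[OF oS z D, where \<nu> = norm])
      show "(norm has_derivative (\<lambda>v. v \<bullet> sgn z)) (at z)" by (rule has_derivative_norm[OF S0(1)[OF z]])
      show "isCont (\<lambda>z. ball_factor x (sgn z)) z"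
        using cd[OF z] by (rule differentiable_imp_continuous_within)
    qed (use chord z in auto)
  qed measurable
  also have "(\<integral>\<^sup>+z\<in>S. ennreal (ball_factor x (sgn z) ^ (DIM('a) - 1)) * g (sgn (F z)) \<partial>lborel)
      = (\<integral>\<^sup>+z\<in>ball 0 1. ennreal (ball_factor x (sgn z) ^ (DIM('a) - 1)) * g (ball_involution x (sgn z)) \<partial>lborel)"
    using AE_lborel_singleton[of "0::'a"]
    by (intro nn_integral_cong_AE, eventually_elim) (use sF in \<open>auto simp: indicator_def S_def\<close>)
  also have "(\<integral>\<^sup>+z\<in>S. g (sgn z) \<partial>lborel) = (\<integral>\<^sup>+z\<in>ball 0 1. g (sgn z) \<partial>lborel)"
    using AE_lborel_singleton[of "0::'a"]
    by (intro nn_integral_cong_AE, eventually_elim) (auto simp: indicator_def S_def)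
  finally show ?thesis by (subst (1 2) nn_integral_sphere_measure) (simp, measurable)
qed

end

text \<open>With \<open>D\<close> the squared distance and \<open>c\<close> the factor, the quotient
  rule gives the gradient \<open>- (2 / D)\<close> times
  \<open>y + c *\<^sub>R (y - \<zeta>)\<close>, which is the boundary map itself. As
  \<open>1 / D\<close> is \<open>c / (1 - (norm y)\<^sup>2)\<close>, the power rule returns a
  multiple of the kernel.\<close>

lemma has_derivative_ball_kernel:
  fixes y :: "'a::euclidean_space"
  assumes y: "norm y < 1" and \<zeta>: "norm \<zeta> = 1"
  shows "((\<lambda>y. ball_factor y \<zeta> ^ m) has_derivative
    (\<lambda>h. h \<bullet> (- (2 * real m / (1 - (norm y)\<^sup>2) * ball_factor y \<zeta> ^ m)) *\<^sub>R ball_involution y \<zeta>)) (at y)"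
proof -
  define D where "D = (norm (y - \<zeta>))\<^sup>2"
  have nz: "(y - \<zeta>) \<bullet> (y - \<zeta>) \<noteq> 0" using diff_sphere_nonzero[OF y \<zeta>] by simp
  have D: "D > 0" using diff_sphere_nonzero[OF y \<zeta>] by (simp add: D_def)
  have s: "1 - (norm y)\<^sup>2 > 0" by (rule one_minus_norm_sq_pos[OF y])
  have "((\<lambda>y. (1 - y \<bullet> y) / ((y - \<zeta>) \<bullet> (y - \<zeta>))) has_derivative
     (\<lambda>h. (- (2 * (h \<bullet> y)) * D - (1 - (norm y)\<^sup>2) * (2 * (h \<bullet> (y - \<zeta>)))) / (D * D))) (at y)"
    using nz by (auto intro!: derivative_eq_intros
      simp: D_def power2_norm_eq_inner inner_commute)
  moreover have "(- (2 * (h \<bullet> y)) * D - (1 - (norm y)\<^sup>2) * (2 * (h \<bullet> (y - \<zeta>)))) / (D * D)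
      = - (2 / D) * (h \<bullet> ball_involution y \<zeta>)" for h
  proof -
    have hi: "h \<bullet> ball_involution y \<zeta> = h \<bullet> y + (1 - (norm y)\<^sup>2) / D * (h \<bullet> (y - \<zeta>))"
      by (simp add: ball_involution_def ball_factor_def D_def inner_add_right)
    show ?thesis unfolding hi using D by (simp add: field_simps)
  qed
  ultimately have f: "((\<lambda>y. ball_factor y \<zeta>) has_derivative (\<lambda>h. - (2 / D) * (h \<bullet> ball_involution y \<zeta>))) (at y)"
    by (simp add: ball_factor_def power2_norm_eq_inner)
  have "((\<lambda>y. ball_factor y \<zeta> ^ m) has_derivative
      (\<lambda>h. real m * (- (2 / D) * (h \<bullet> ball_involution y \<zeta>)) * ball_factor y \<zeta> ^ (m - 1))) (at y)"
    using has_derivative_power[OF f, of m] by (simp add: mult_ac)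
  moreover have "real m * (- (2 / D) * (h \<bullet> ball_involution y \<zeta>)) * ball_factor y \<zeta> ^ (m - 1)
     = h \<bullet> (- (2 * real m / (1 - (norm y)\<^sup>2) * ball_factor y \<zeta> ^ m)) *\<^sub>R ball_involution y \<zeta>" for h
  proof (cases m)
    case (Suc k)
    have "ball_factor y \<zeta> / (1 - (norm y)\<^sup>2) = 1 / D" using s by (simp add: ball_factor_def D_def)
    moreover have "2 * real m / (1 - (norm y)\<^sup>2) * ball_factor y \<zeta> ^ m
        = 2 * real m * (ball_factor y \<zeta> / (1 - (norm y)\<^sup>2)) * ball_factor y \<zeta> ^ k"
      by (simp add: Suc)
    ultimately have "2 * real m / (1 - (norm y)\<^sup>2) * ball_factor y \<zeta> ^ m = real m * (2 / D) * ball_factor y \<zeta> ^ k"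
      by simp
    then show ?thesis by (simp add: Suc mult_ac)
  qed simp
  ultimately show ?thesis by simp
qed

context
  fixes p :: ereal and q :: real
  assumes pq: "p = \<infinity> \<and> q = 1 \<or> (\<exists>r. p = ereal r \<and> r > 1 \<and> q > 1 \<and> 1 / r + 1 / q = 1)"
begin

lemma exponent_ge_1: "q \<ge> 1" using pq by auto

text \<open>\<open>I\<close> has three sources: the scalar factor of the gradient to the power
  \<open>q\<close> (\<open>A\<close> below), the constant produced by rewriting the leftover power
  of the conformal factor in the new variable (\<open>B\<close>), and the extremal spherical
  integral (\<open>J\<close>).\<close>

lemma sharp_gradient_ball:
  fixes x :: "'a::euclidean_space"
  defines "n \<equiv> DIM('a)"
  defines "s \<equiv> (real n - 1) * (q - 1)"
  assumes dim: "n \<ge> 2" and x: "norm x < 1" and coeff: "\<And>k. (s gchoose (2 * k)) \<ge> 0"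
  defines "I \<equiv> (2 * (real n - 1) / (1 - (norm x)\<^sup>2)) powr q * ((1 + (norm x)\<^sup>2) / (1 - (norm x)\<^sup>2)) powr s
      * (sphere_moment n q * hypergeometric_3F2 (- s / 2) ((1 - s) / 2) ((q + 1) / 2) (1 / 2) ((q + n) / 2)
          ((2 * norm x / (1 + (norm x)\<^sup>2))\<^sup>2))"
  shows "\<And>\<phi>. \<phi> \<in> Lp sphere_measure p \<Longrightarrow> poisson_szego_ball \<phi> differentiable (at x)"
    and "sharp_inequality (Lp sphere_measure p) (\<lambda>\<phi>. norm (gradient (poisson_szego_ball \<phi>) x))
      (Lp_norm sphere_measure p) (I powr (1 / q))"
proof -
  define N where "N = DIM('a) - 1"
  have N: "N > 0" "real N = real n - 1" using dim by (auto simp: N_def n_def of_nat_diff)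
  define r where "r = norm x"
  have r: "0 \<le> r" "r < 1" using x by (auto simp: r_def)
  have r2: "1 - r\<^sup>2 > 0" using one_minus_norm_sq_pos[OF x] by (simp add: r_def)
  define G where "G = (\<lambda>(y::'a) \<zeta>. (- (2 * real N / (1 - (norm y)\<^sup>2) * ball_factor y \<zeta> ^ N)) *\<^sub>R ball_involution y \<zeta>)"
  define K where "K = (\<lambda>(y::'a) \<zeta>. ball_factor y \<zeta> ^ N)"
  have u: "poisson_szego_ball \<phi> = (\<lambda>y. \<integral>\<zeta>. K y \<zeta> * \<phi> \<zeta> \<partial>sphere_measure)" for \<phi>
    by (simp add: poisson_szego_ball_def[abs_def] K_def ball_factor_def N_def)
  \<comment> \<open>At the centre every direction is extremal, so any unit vector will do; there
    \<open>w = 0\<close>.\<close>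
  obtain e :: 'a where e: "norm e = 1" "x = r *\<^sub>R e"
  proof (cases "x = 0")
    case True
    then show ?thesis using that[of "SOME b. b \<in> Basis"] SOME_Basis by (simp add: r_def)
  next
    case False
    then show ?thesis using that[of "sgn x"] by (simp add: r_def norm_sgn sgn_div_norm)
  qed
  define w where "w = 2 * r / (1 + r\<^sup>2)"
  have r21: "1 + r\<^sup>2 > 0" by (smt (verit) zero_le_power2)
  have w: "0 \<le> w" "w \<le> 1"
    unfolding w_def using r r21 sum_power2_ge_zero[of "r - 1" 0]
    by (auto simp: divide_le_eq power2_eq_square algebra_simps)
  have s0: "s \<ge> 0" using exponent_ge_1 dim by (simp add: s_def)
  have q0: "q > 0" using exponent_ge_1 by simp
  define J where "J = sphere_moment n q * hypergeometric_3F2 (- s / 2) ((1 - s) / 2) ((q + 1) / 2) (1 / 2) ((q + n) / 2) (w\<^sup>2)"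
  note kernel = nn_integral_sphere_kernel[OF dim[unfolded n_def] e(1) q0 s0 w coeff, folded n_def, folded J_def]
  define A where "A = (2 * real N / (1 - r\<^sup>2)) powr q"
  define B where "B = ((1 + r\<^sup>2) / (1 - r\<^sup>2)) powr s"
  have AB: "A > 0" "B > 0" unfolding A_def B_def using r2 r21 N by auto
  have IAB: "I = A * B * J" unfolding I_def A_def B_def J_def w_def r_def N(2) ..
  have fac: "ball_factor x \<zeta> = (1 + r\<^sup>2) / (1 - r\<^sup>2) * (1 - w * (ball_involution x \<zeta> \<bullet> e))"
    "1 - w * (ball_involution x \<zeta> \<bullet> e) \<ge> 0" if \<zeta>: "norm \<zeta> = 1" for \<zeta>
  proof -
    let ?\<eta> = "ball_involution x \<zeta>"
    have \<eta>: "norm ?\<eta> = 1" by (rule norm_ball_involution[OF x \<zeta>])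
    have "(1 - r\<^sup>2) * ball_factor x \<zeta> = (norm (x - ?\<eta>))\<^sup>2"
      using norm_ball_involution_minus[OF x \<zeta>] by (simp add: r_def)
    also have "\<dots> = r\<^sup>2 - 2 * (?\<eta> \<bullet> x) + 1"
      using \<eta> by (simp add: power2_norm_eq_inner inner_diff_left inner_diff_right inner_commute norm_eq_1 r_def)
    also have "?\<eta> \<bullet> x = r * (?\<eta> \<bullet> e)" by (subst e(2)) simp
    also have "r\<^sup>2 - 2 * (r * (?\<eta> \<bullet> e)) + 1 = (1 + r\<^sup>2) * (1 - w * (?\<eta> \<bullet> e))"
      using r21 by (simp add: w_def right_diff_distrib)
    finally have *: "(1 - r\<^sup>2) * ball_factor x \<zeta> = (1 + r\<^sup>2) * (1 - w * (?\<eta> \<bullet> e))" .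
    then show "ball_factor x \<zeta> = (1 + r\<^sup>2) / (1 - r\<^sup>2) * (1 - w * (?\<eta> \<bullet> e))"
      using r2 by (simp add: field_simps)
    have "(1 - r\<^sup>2) * ball_factor x \<zeta> > 0" using ball_factor_pos[OF x \<zeta>] r2 by simp
    then show "1 - w * (?\<eta> \<bullet> e) \<ge> 0" unfolding * using r21 by (simp add: zero_less_mult_iff)
  qed
  have int: "(\<integral>\<^sup>+\<zeta>. ennreal (\<bar>G x \<zeta> \<bullet> l\<bar> powr q) \<partial>sphere_measure)
      = ennreal (A * B) * (\<integral>\<^sup>+z. ennreal ((1 - w * (z \<bullet> e)) powr s * \<bar>z \<bullet> l\<bar> powr q) \<partial>sphere_measure)" for l
  proof -
    define g where "g = (\<lambda>z. ennreal (A * B) * ennreal ((1 - w * (z \<bullet> e)) powr s * \<bar>z \<bullet> l\<bar> powr q))"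
    have gm: "g \<in> borel_measurable borel" unfolding g_def by measurable
    have "(\<integral>\<^sup>+\<zeta>. ennreal (\<bar>G x \<zeta> \<bullet> l\<bar> powr q) \<partial>sphere_measure)
      = (\<integral>\<^sup>+\<zeta>. ennreal (ball_factor x \<zeta> ^ (DIM('a) - 1)) * g (ball_involution x \<zeta>) \<partial>sphere_measure)"
    proof (intro nn_integral_cong)
      fix \<zeta> :: 'a assume "\<zeta> \<in> space sphere_measure"
      then have \<zeta>: "norm \<zeta> = 1" by (simp add: space_sphere_measure)
      let ?\<eta> = "ball_involution x \<zeta>" and ?c = "ball_factor x \<zeta>"
      have c: "?c > 0" by (rule ball_factor_pos[OF x \<zeta>])
      \<comment> \<open>The exponent splits as \<open>N * q = N + s\<close>: the part
        \<open>N\<close> is the Jacobian of the boundary map, the part \<open>s\<close> stays in the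
        integrand.\<close>
      have cN: "(?c ^ N) powr q = ?c ^ N * ?c powr s"
      proof -
        have "(?c ^ N) powr q = ?c powr (real N * q)" using c by (simp add: powr_realpow[symmetric] powr_powr)
        also have "real N * q = real N + s" by (simp add: s_def N(2) algebra_simps)
        finally show ?thesis using c by (simp add: powr_add powr_realpow)
      qed
      have "\<bar>G x \<zeta> \<bullet> l\<bar> = 2 * real N / (1 - r\<^sup>2) * ?c ^ N * \<bar>?\<eta> \<bullet> l\<bar>"
        unfolding G_def using c r2 by (simp add: abs_mult r_def)
      then have "\<bar>G x \<zeta> \<bullet> l\<bar> powr q = A * (?c ^ N) powr q * \<bar>?\<eta> \<bullet> l\<bar> powr q"
        by (simp only: A_def powr_mult)
      also have "\<dots> = ?c ^ N * (A * ?c powr s * \<bar>?\<eta> \<bullet> l\<bar> powr q)" by (simp add: cN mult_ac)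
      also have "?c powr s = B * (1 - w * (?\<eta> \<bullet> e)) powr s"
        unfolding B_def fac(1)[OF \<zeta>] by (rule powr_mult)
      finally have "\<bar>G x \<zeta> \<bullet> l\<bar> powr q = ?c ^ N * (A * B * ((1 - w * (?\<eta> \<bullet> e)) powr s * \<bar>?\<eta> \<bullet> l\<bar> powr q))"
        by (simp add: mult_ac)
      then show "ennreal (\<bar>G x \<zeta> \<bullet> l\<bar> powr q) = ennreal (?c ^ (DIM('a) - 1)) * g ?\<eta>"
        using c AB unfolding g_def N_def[symmetric] by (simp add: ennreal_mult[symmetric] del: ennreal_mult')
    qed
    also have "\<dots> = (\<integral>\<^sup>+\<zeta>. g \<zeta> \<partial>sphere_measure)" by (rule nn_integral_ball_involution[OF x gm])
    also have "\<dots> = ennreal (A * B) * (\<integral>\<^sup>+z. ennreal ((1 - w * (z \<bullet> e)) powr s * \<bar>z \<bullet> l\<bar> powr q) \<partial>sphere_measure)"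
      unfolding g_def by (intro nn_integral_cmult borel_measurable_sphere_measure) measurable
    finally show ?thesis .
  qed
  have Ipos: "I > 0" unfolding IAB using AB kernel(1) by simp
  have Ie: "ennreal (A * B) * ennreal J = ennreal I"
    unfolding IAB using AB kernel(1) by (intro ennreal_mult[symmetric]) auto
  \<comment> \<open>Half the distance from \<open>x\<close> to the sphere, so that points of the
    ball around \<open>x\<close> keep at least the distance \<open>\<epsilon>\<close> from the
    sphere.\<close>
  define \<epsilon> where "\<epsilon> = (1 - r) / 2"
  have \<epsilon>: "\<epsilon> > 0" using r by (simp add: \<epsilon>_def)
  \<comment> \<open>The 4 is the square of the ratio 2 between the distances of \<open>x\<close> and
    \<open>y\<close> to \<open>\<zeta>\<close>; the numerator of the factor at \<open>y\<close> is
    bounded by 1 and that at \<open>x\<close> is divided out. In \<open>C\<close> the first summand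
    serves the bound on the kernel, the second the bound on its gradient.\<close>
  define H where "H = 4 / (1 - r\<^sup>2)"
  define C where "C = H ^ N * ((1 - r\<^sup>2) / (2 * real N) + 2 / (1 - r) * (1 - r\<^sup>2))"
  have Gx: "norm (G x \<zeta>) = 2 * real N / (1 - r\<^sup>2) * ball_factor x \<zeta> ^ N" if "norm \<zeta> = 1" for \<zeta>
    unfolding G_def using ball_factor_pos[OF x that] r2 by (simp add: norm_ball_involution[OF x that] abs_mult r_def)
  have near: "norm y < 1" "1 - (norm y)\<^sup>2 \<ge> (1 - r) / 2" if y: "y \<in> ball x \<epsilon>" for y
  proof -
    have "norm y \<le> norm x + norm (x - y)" using norm_triangle_ineq4[of x "x - y"] by simp
    then have y2: "norm y \<le> (1 + r) / 2" using y by (simp add: dist_norm r_def \<epsilon>_def field_simps)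
    then show "norm y < 1" using r by simp
    then have "(norm y)\<^sup>2 \<le> norm y" by (simp add: power2_eq_square mult_left_le)
    then show "1 - (norm y)\<^sup>2 \<ge> (1 - r) / 2" using y2 by (simp add: field_simps)
  qed
  have Harnack: "ball_factor y \<zeta> \<le> H * ball_factor x \<zeta>" if y: "y \<in> ball x \<epsilon>" and \<zeta>: "norm \<zeta> = 1" for y \<zeta>
  proof -
    have d: "norm (x - y) \<le> \<epsilon>" using y by (simp add: dist_norm)
    have "norm \<zeta> \<le> norm (y - \<zeta>) + norm y" using norm_triangle_ineq4[of y "y - \<zeta>"] by simp
    moreover have "norm y \<le> norm x + norm (x - y)" using norm_triangle_ineq4[of x "x - y"] by simp
    ultimately have "norm (y - \<zeta>) \<ge> \<epsilon>" using d \<zeta> by (simp add: r_def \<epsilon>_def field_simps)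
    moreover have "norm (x - \<zeta>) \<le> norm (x - y) + norm (y - \<zeta>)" using norm_triangle_ineq[of "x - y" "y - \<zeta>"] by simp
    ultimately have "norm (x - \<zeta>) \<le> 2 * norm (y - \<zeta>)" using d by linarith
    then have "(norm (x - \<zeta>))\<^sup>2 \<le> (2 * norm (y - \<zeta>))\<^sup>2" by (intro power_mono) auto
    then have n2: "(norm (x - \<zeta>))\<^sup>2 \<le> 4 * (norm (y - \<zeta>))\<^sup>2" by (simp add: power_mult_distrib)
    have pos: "norm (x - \<zeta>) > 0" "norm (y - \<zeta>) > 0"
      using diff_sphere_nonzero[OF x \<zeta>] diff_sphere_nonzero[OF near(1)[OF y] \<zeta>] by auto
    have "ball_factor y \<zeta> \<le> 1 / (norm (y - \<zeta>))\<^sup>2"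
      unfolding ball_factor_def by (intro divide_right_mono) auto
    also have "\<dots> \<le> 4 / (norm (x - \<zeta>))\<^sup>2" using n2 pos by (simp add: field_simps)
    also have "\<dots> = H * ball_factor x \<zeta>"
    proof -
      have aux: "4 / d = 4 / a * (a / d)" if "a \<noteq> 0" for a d :: real using that by simp
      show ?thesis unfolding H_def ball_factor_def r_def[symmetric] by (rule aux) (use r2 in simp)
    qed
    finally show ?thesis .
  qed
  have HN: "ball_factor y \<zeta> ^ N \<le> H ^ N * ball_factor x \<zeta> ^ N" if "y \<in> ball x \<epsilon>" "norm \<zeta> = 1" for y \<zeta>
    unfolding power_mult_distrib[symmetric]
    using Harnack[OF that] less_imp_le[OF ball_factor_pos[OF near(1)[OF that(1)] that(2)]] by (rule power_mono)
  have H0: "H ^ N \<ge> 0" using r2 by (simp add: H_def)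
  have Kb: "\<bar>K y \<zeta>\<bar> \<le> C * norm (G x \<zeta>)" if y: "y \<in> ball x \<epsilon>" and \<zeta>: "norm \<zeta> = 1" for y \<zeta>
  proof -
    have c: "ball_factor x \<zeta> ^ N \<ge> 0" using ball_factor_pos[OF x \<zeta>] by simp
    have "\<bar>K y \<zeta>\<bar> \<le> H ^ N * ball_factor x \<zeta> ^ N"
      using HN[OF that] ball_factor_pos[OF near(1)[OF y] \<zeta>] by (simp add: K_def)
    also have "\<dots> = H ^ N * ((1 - r\<^sup>2) / (2 * real N)) * norm (G x \<zeta>)"
      using Gx[OF \<zeta>] r2 N by simp
    also have "\<dots> \<le> C * norm (G x \<zeta>)"
      unfolding C_def using H0 r r2 by (intro mult_right_mono mult_left_mono) auto
    finally show ?thesis .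
  qed
  have Gb: "norm (G y \<zeta>) \<le> C * norm (G x \<zeta>)" if y: "y \<in> ball x \<epsilon>" and \<zeta>: "norm \<zeta> = 1" for y \<zeta>
  proof -
    have cy: "ball_factor y \<zeta> > 0" by (rule ball_factor_pos[OF near(1)[OF y] \<zeta>])
    have y2: "1 - (norm y)\<^sup>2 > 0" by (rule one_minus_norm_sq_pos[OF near(1)[OF y]])
    have "norm (G y \<zeta>) = 2 * real N / (1 - (norm y)\<^sup>2) * ball_factor y \<zeta> ^ N"
      unfolding G_def using cy y2 by (simp add: norm_ball_involution[OF near(1)[OF y] \<zeta>] abs_mult)
    also have "\<dots> \<le> 2 * real N / ((1 - r) / 2) * (H ^ N * ball_factor x \<zeta> ^ N)"
    proof (intro mult_mono HN that)
      show "2 * real N / (1 - (norm y)\<^sup>2) \<le> 2 * real N / ((1 - r) / 2)"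
        using near(2)[OF y] r by (intro divide_left_mono) auto
    qed (use cy r in auto)
    also have "\<dots> = H ^ N * (2 / (1 - r) * (1 - r\<^sup>2)) * norm (G x \<zeta>)"
    proof -
      have aux: "2 * k / (a / 2) * (h * b) = h * (2 / a * d) * (2 * k / d * b)" if "d \<noteq> 0" for a b d h k :: real
        using that by simp
      show ?thesis unfolding Gx[OF \<zeta>] by (rule aux) (use r2 in simp)
    qed
    also have "\<dots> \<le> C * norm (G x \<zeta>)"
      unfolding C_def using H0 r r2 by (intro mult_right_mono mult_left_mono) auto
    finally show ?thesis .
  qed
  note concl = kernel_integral_sharp_gradient[OF \<epsilon>, where K = K and G = G and x = x and M = sphere_measure
    and C = C and p = p and q = q and I = I and ?l0.0 = e]
  have Gm: "G x \<in> borel_measurable sphere_measure"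
    unfolding G_def by (rule borel_measurable_sphere_measure) measurable
  have Km: "K y \<in> borel_measurable sphere_measure" for y
    unfolding K_def by (rule borel_measurable_sphere_measure) measurable
  have der: "((\<lambda>y. K y \<zeta>) has_derivative (\<lambda>h. h \<bullet> G y \<zeta>)) (at y)"
    if "\<zeta> \<in> space sphere_measure" "y \<in> ball x \<epsilon>" for y \<zeta>
    unfolding K_def G_def using that near(1) by (intro has_derivative_ball_kernel) (auto simp: space_sphere_measure)
  have Kb': "\<bar>K y \<zeta>\<bar> \<le> C * norm (G x \<zeta>)" "norm (G y \<zeta>) \<le> C * norm (G x \<zeta>)"
    if "\<zeta> \<in> space sphere_measure" "y \<in> ball x \<epsilon>" for y \<zeta>
    using that Kb Gb by (auto simp: space_sphere_measure)
  have I0: "(\<integral>\<^sup>+\<zeta>. ennreal (\<bar>G x \<zeta> \<bullet> e\<bar> powr q) \<partial>sphere_measure) = ennreal I"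
    unfolding int kernel(2) Ie ..
  have Il: "(\<integral>\<^sup>+\<zeta>. ennreal (\<bar>G x \<zeta> \<bullet> l\<bar> powr q) \<partial>sphere_measure) \<le> ennreal I" if "norm l = 1" for l
    unfolding int Ie[symmetric] using kernel(3)[OF that] by (intro mult_left_mono) auto
  show "poisson_szego_ball \<phi> differentiable (at x)" if "\<phi> \<in> Lp sphere_measure p" for \<phi>
    unfolding u by (rule concl(1)[OF Km der Kb' pq Gm e(1) Ipos I0 Il that])
  show "sharp_inequality (Lp sphere_measure p) (\<lambda>\<phi>. norm (gradient (poisson_szego_ball \<phi>) x))
      (Lp_norm sphere_measure p) (I powr (1 / q))"
    unfolding u by (rule concl(2)[OF Km der Kb' pq Gm e(1) Ipos I0 Il])
qed

end

subsection \<open>The half-space\<close>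

definition half_denom :: "'b::euclidean_space \<times> real \<Rightarrow> 'b \<Rightarrow> real" where
  "half_denom x y = (norm (fst x - y))\<^sup>2 + (snd x)\<^sup>2"

text \<open>Inversion in a sphere centred at \<open>x\<close> followed by a translation: the inverse of a stereographic
  projection, with conformal factor \<open>2 * snd x / half_denom x y\<close>.\<close>
definition half_map :: "'b::euclidean_space \<times> real \<Rightarrow> 'b \<Rightarrow> 'b \<times> real" where
  "half_map x y = (0, 1) - (2 * snd x / half_denom x y) *\<^sub>R (fst x - y, snd x)"

text \<open>Inversion is its own inverse: with \<open>v = (0, 1) - \<eta>\<close>, the vector
  \<open>(fst x - y, snd x)\<close> is \<open>2 * snd x / (norm v)\<^sup>2\<close> times
  \<open>v\<close>, and its first component determines \<open>y\<close>.\<close>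

definition half_map_inv :: "'b::euclidean_space \<times> real \<Rightarrow> 'b \<times> real \<Rightarrow> 'b" where
  "half_map_inv x \<eta> = fst x - (2 * snd x / (norm ((0, 1) - \<eta>))\<^sup>2) *\<^sub>R fst ((0, 1) - \<eta>)"

lemma half_denom_norm: "half_denom x y = (norm (fst x - y, snd x))\<^sup>2"
  by (simp add: half_denom_def norm_Pair)

lemma fst_borel_measurable [measurable]: "fst \<in> borel_measurable (borel :: ('b::euclidean_space \<times> real) measure)"
  by (intro borel_measurable_continuous_onI continuous_intros)

lemma snd_borel_measurable [measurable]: "snd \<in> borel_measurable (borel :: ('b::euclidean_space \<times> real) measure)"
  by (intro borel_measurable_continuous_onI continuous_intros)

context
  fixes x :: "'b::euclidean_space \<times> real"
  assumes x: "snd x > 0"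
begin

lemma half_denom_pos: "half_denom x y > 0"
  unfolding half_denom_def using x by (simp add: add_nonneg_pos)

lemma Pair_nonzero: "(fst x - y, snd x) \<noteq> 0"
  using x by (auto simp: zero_prod_def)

lemma snd_half_map: "snd (half_map x y) = 1 - 2 * (snd x)\<^sup>2 / half_denom x y"
  by (simp add: half_map_def power2_eq_square)

text \<open>Inversion sends a hyperplane at distance \<open>snd x\<close> from the centre to a
  sphere through the centre. The scaling by \<open>2 * snd x\<close> gives it diameter 2, and the
  translation centres it at the origin, with \<open>(0, 1)\<close> as the image of infinity.\<close>

lemma norm_half_map: "norm (half_map x y) = 1"
proof -
  define D k where "D = half_denom x y" and "k = 2 * snd x / D"
  let ?u = "(fst x - y, snd x)"
  have D: "D > 0" unfolding D_def by (rule half_denom_pos)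
  have "(norm (half_map x y))\<^sup>2 = 1 - 2 * k * snd x + k\<^sup>2 * (?u \<bullet> ?u)"
    unfolding half_map_def D_def[symmetric] k_def[symmetric] power2_norm_eq_inner
    by (simp add: inner_diff_left inner_diff_right inner_commute) (simp add: algebra_simps power2_eq_square)
  also have "?u \<bullet> ?u = D" by (simp add: D_def half_denom_norm power2_norm_eq_inner)
  also have "1 - 2 * k * snd x + k\<^sup>2 * D = 1" using D by (simp add: k_def power2_eq_square)
  finally show ?thesis using norm_ge_zero[of "half_map x y"] by (auto simp: power2_eq_1_iff)
qed

lemma e_minus_half_map: "(0, 1) - half_map x y = (2 * snd x / half_denom x y) *\<^sub>R (fst x - y, snd x)"
  by (simp add: half_map_def)

lemma norm_e_minus_half_map: "(norm ((0, 1) - half_map x y))\<^sup>2 = 4 * (snd x)\<^sup>2 / half_denom x y"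
proof -
  have "(norm ((0, 1) - half_map x y))\<^sup>2 = (2 * snd x / half_denom x y)\<^sup>2 * half_denom x y"
  proof -
    have "(norm (a *\<^sub>R u))\<^sup>2 = a\<^sup>2 * (norm u)\<^sup>2" for a and u :: "'b \<times> real"
      by (simp add: power_mult_distrib)
    then show ?thesis unfolding e_minus_half_map half_denom_norm .
  qed
  then show ?thesis using half_denom_pos[of y] by (simp add: power2_eq_square)
qed

lemma half_map_neq: "half_map x y \<noteq> (0, 1)"
proof
  assume "half_map x y = (0, 1)"
  then have "(norm ((0::'b, 1::real) - half_map x y))\<^sup>2 = 0" by simp
  then show False unfolding norm_e_minus_half_map using half_denom_pos[of y] x by simp
qed

lemma half_map_inv_half_map: "half_map_inv x (half_map x y) = y"
proof -
  have D: "half_denom x y > 0" by (rule half_denom_pos)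
  have "half_map_inv x (half_map x y) = fst x - (2 * snd x / (4 * (snd x)\<^sup>2 / half_denom x y)) *\<^sub>R
      ((2 * snd x / half_denom x y) *\<^sub>R (fst x - y))"
    unfolding half_map_inv_def norm_e_minus_half_map unfolding e_minus_half_map by simp
  also have "\<dots> = fst x - (2 * snd x / (4 * (snd x)\<^sup>2 / half_denom x y) * (2 * snd x / half_denom x y)) *\<^sub>R (fst x - y)"
    by simp
  also have "2 * snd x / (4 * (snd x)\<^sup>2 / half_denom x y) * (2 * snd x / half_denom x y) = 1"
    using D x by (simp add: field_simps power2_eq_square)
  finally show ?thesis by simp
qed

lemma half_map_half_map_inv:
  assumes \<eta>: "norm \<eta> = 1" "\<eta> \<noteq> (0, 1)"
  shows "half_map x (half_map_inv x \<eta>) = \<eta>"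
proof -
  define v k where "v = (0, 1) - \<eta>" and "k = 2 * snd x / (norm v)\<^sup>2"
  have v: "norm v > 0" using \<eta> by (simp add: v_def)
  have "\<eta> \<bullet> \<eta> = 1" using \<eta> by (simp add: norm_eq_1)
  then have "fst \<eta> \<bullet> fst \<eta> + snd \<eta> * snd \<eta> = 1" by (simp add: inner_prod_def)
  moreover have "(norm v)\<^sup>2 = fst \<eta> \<bullet> fst \<eta> + (1 - snd \<eta>) * (1 - snd \<eta>)"
    by (simp add: v_def power2_norm_eq_inner inner_prod_def)
  moreover have "snd v = 1 - snd \<eta>" by (simp add: v_def)
  \<comment> \<open>For unit \<open>\<eta>\<close> the squared distance to the pole is linear in the
    height. Hence \<open>k *\<^sub>R v\<close> has last coordinate \<open>snd x\<close>, that is, it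
    lies on the hyperplane being inverted.\<close>
  ultimately have nv: "(norm v)\<^sup>2 = 2 * snd v" by (simp add: algebra_simps)
  then have "snd v \<noteq> 0" using v by auto
  then have "k * snd v = snd x" by (simp add: k_def nv)
  then have u: "(fst x - half_map_inv x \<eta>, snd x) = k *\<^sub>R v"
    unfolding half_map_inv_def v_def[symmetric] k_def[symmetric] by (simp add: prod_eq_iff)
  then have "half_denom x (half_map_inv x \<eta>) = k\<^sup>2 * (norm v)\<^sup>2"
    unfolding half_denom_norm by (simp add: power_mult_distrib)
  then have "half_map x (half_map_inv x \<eta>) = (0, 1) - (2 * snd x / (k\<^sup>2 * (norm v)\<^sup>2) * k) *\<^sub>R v"
    unfolding half_map_def u by simp
  also have "2 * snd x / (k\<^sup>2 * (norm v)\<^sup>2) * k = 1"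
    using v x by (simp add: k_def power2_eq_square)
  finally show ?thesis by (simp add: v_def)
qed

lemma norm_half_map_diff:
  "(norm (half_map x y - half_map x z))\<^sup>2
    = (2 * snd x / half_denom x y) * (2 * snd x / half_denom x z) * (norm (y - z))\<^sup>2"
proof -
  let ?u = "(fst x - y, snd x)" and ?v = "(fst x - z, snd x)" and ?c = "2 * snd x"
  have "half_map x y - half_map x z = ?c *\<^sub>R (?v /\<^sub>R (norm ?v)\<^sup>2 - ?u /\<^sub>R (norm ?u)\<^sup>2)"
    unfolding half_map_def half_denom_norm by (simp add: scaleR_diff_right divide_inverse) (simp add: algebra_simps)
  moreover have "(norm (a *\<^sub>R w))\<^sup>2 = a\<^sup>2 * (norm w)\<^sup>2" for a and w :: "'b \<times> real"
    by (simp add: power_mult_distrib)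
  ultimately have "(norm (half_map x y - half_map x z))\<^sup>2 = ?c\<^sup>2 * (norm (?v /\<^sub>R (norm ?v)\<^sup>2 - ?u /\<^sub>R (norm ?u)\<^sup>2))\<^sup>2"
    by (simp only:)
  also have "\<dots> = ?c\<^sup>2 * ((norm (?v - ?u))\<^sup>2 / ((norm ?v)\<^sup>2 * (norm ?u)\<^sup>2))"
    by (simp only: norm_inversion_diff[OF Pair_nonzero Pair_nonzero])
  also have "norm (?v - ?u) = norm (y - z)" by (simp add: norm_Pair)
  finally show ?thesis by (simp add: half_denom_norm power2_eq_square mult_ac)
qed

lemma half_denom_borel [measurable]: "half_denom x \<in> borel_measurable borel"
  unfolding half_denom_def by measurable

lemma half_map_borel [measurable]: "half_map x \<in> borel_measurable borel"
proof -
  have "continuous_on UNIV (half_denom x)" unfolding half_denom_def[abs_def] by (intro continuous_intros)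
  then have "continuous_on UNIV (half_map x)"
    unfolding half_map_def[abs_def] using half_denom_pos by (intro continuous_intros) (auto simp: less_imp_neq[symmetric])
  then show ?thesis by (rule borel_measurable_continuous_onI)
qed

text \<open>The map \<open>F (y, \<rho>) = \<rho> *\<^sub>R half_map x y\<close> takes the cylinder
  of height 1 over the boundary onto the ball without the origin and the ray through
  \<open>(0, 1)\<close>. It is unstretched along the axis and stretches by \<open>\<rho>\<close>
  times the conformal factor across it. Integrating the power of \<open>\<rho>\<close> contributes
  \<open>1 / n\<close>, so \<open>n\<close> times the volume of the ball, the area of the sphere,
  appears.\<close>

lemma nn_integral_half_map:
  assumes g [measurable]: "g \<in> borel_measurable borel"
  shows "(\<integral>\<^sup>+y. ennreal ((2 * snd x / half_denom x y) ^ DIM('b)) * g (half_map x y) \<partial>lborel)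
    = ennreal (real DIM('b \<times> real) * unit_ball_vol (real DIM('b \<times> real))) * (\<integral>\<^sup>+\<eta>. g \<eta> \<partial>sphere_measure)"
proof -
  note [measurable] = sgn_borel_measurable
  define k where "k = (\<lambda>y. 2 * snd x / half_denom x y)"
  have k: "k y > 0" for y using x half_denom_pos[of y] by (simp add: k_def)
  have km [measurable]: "k \<in> borel_measurable borel" unfolding k_def by measurable
  define m where "m = DIM('b)"
  have dm: "DIM('b \<times> real) = Suc m" by (simp add: m_def)
  define S where "S = (UNIV :: 'b set) \<times> {0<..<1::real}"
  define T where "T = {z :: 'b \<times> real. z \<in> ball 0 1 \<and> z \<noteq> 0 \<and> sgn z \<noteq> (0, 1)}"
  define F where "F = (\<lambda>z :: 'b \<times> real. snd z *\<^sub>R half_map x (fst z))"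
  have nF: "norm (F z) = snd z" "sgn (F z) = half_map x (fst z)" if "z \<in> S" for z
  proof -
    have "snd z > 0" using that by (auto simp: S_def)
    then show "norm (F z) = snd z" by (simp add: F_def norm_half_map)
    then show "sgn (F z) = half_map x (fst z)" using \<open>snd z > 0\<close> by (simp add: sgn_div_norm F_def)
  qed
  have bij: "bij_betw F S T"
  proof (rule bij_betw_byWitness[where f' = "\<lambda>z. (half_map_inv x (sgn z), norm z)"])
    show "\<forall>a\<in>S. (half_map_inv x (sgn (F a)), norm (F a)) = a"
      using nF by (auto simp: half_map_inv_half_map)
    show "\<forall>a'\<in>T. F (half_map_inv x (sgn a'), norm a') = a'"
    proof
      fix z assume "z \<in> T"
      then have "z \<noteq> 0" "sgn z \<noteq> (0, 1)" by (auto simp: T_def)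
      then show "F (half_map_inv x (sgn z), norm z) = z"
        by (simp add: F_def half_map_half_map_inv norm_sgn) (simp add: sgn_div_norm)
    qed
    show "F ` S \<subseteq> T"
    proof
      fix w assume "w \<in> F ` S"
      then obtain z where z: "z \<in> S" "w = F z" by blast
      have "0 < snd z" "snd z < 1" using z by (auto simp: S_def)
      then show "w \<in> T"
      proof -
        have "F z \<noteq> 0" using nF(1)[OF z(1)] \<open>0 < snd z\<close> by auto
        then show ?thesis
          using nF[OF z(1)] half_map_neq[of "fst z"] \<open>snd z < 1\<close> by (simp add: T_def z(2))
      qed
    qed
    show "(\<lambda>z. (half_map_inv x (sgn z), norm z)) ` T \<subseteq> S"
      by (auto simp: T_def S_def)
  qed
  have oS: "open S" unfolding S_def by (intro open_Times) auto
  have fd: "fst differentiable (at z)" "snd differentiable (at z)" for z :: "'b \<times> real"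
    using bounded_linear_imp_differentiable[OF bounded_linear_fst] bounded_linear_imp_differentiable[OF bounded_linear_snd] by auto
  have dd: "(\<lambda>z. half_denom x (fst z)) differentiable (at z)" for z :: "'b \<times> real"
    unfolding half_denom_def power2_norm_eq_inner using fd by simp
  have hd: "half_denom x y \<noteq> 0" for y using half_denom_pos[of y] by simp
  have Fd: "F differentiable (at z)" for z
    unfolding F_def half_map_def using fd dd hd by simp
  have cd: "(\<lambda>z. snd z * k (fst z)) differentiable (at z)" for z :: "'b \<times> real"
    unfolding k_def using fd dd hd by simp
  have chord: "(norm (F w - F z))\<^sup>2 = (snd w - snd z)\<^sup>2
      + (snd w * k (fst w)) * (snd z * k (fst z)) * ((norm (w - z))\<^sup>2 - (snd w - snd z)\<^sup>2)" for w z
  proof -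
    have "(norm (w - z))\<^sup>2 = (norm (fst w - fst z))\<^sup>2 + (snd w - snd z)\<^sup>2"
      by (cases w, cases z) (simp add: norm_Pair)
    moreover have "(norm (F w - F z))\<^sup>2 = (snd w - snd z)\<^sup>2
        + snd w * snd z * (norm (half_map x (fst w) - half_map x (fst z)))\<^sup>2"
      unfolding F_def by (intro norm_scaled_unit_diff norm_half_map)
    ultimately show ?thesis by (simp add: norm_half_map_diff k_def)
  qed
  have [measurable]: "F \<in> borel_measurable borel" unfolding F_def by measurable
  have mT: "T \<in> sets borel"
  proof -
    have "T = ball 0 1 \<inter> (- {0}) \<inter> sgn -` (- {(0, 1)})" by (auto simp: T_def)
    moreover have "sgn -` (- {(0::'b, 1::real)}) \<in> sets borel"
      using measurable_sets[OF sgn_borel_measurable, of "- {(0::'b, 1::real)}"] by simp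
    ultimately show ?thesis by auto
  qed
  have cov: "(\<integral>\<^sup>+z\<in>S. ennreal ((snd z * k (fst z)) ^ (DIM('b \<times> real) - 1)) * g (sgn (F z)) \<partial>lborel)
      = (\<integral>\<^sup>+z\<in>T. g (sgn z) \<partial>lborel)"
  proof (rule nn_integral_conformal_change[where e = "\<lambda>_. (0, 1)" and f' = "\<lambda>z. frechet_derivative F (at z)" and g = "\<lambda>z. g (sgn z)"])
    show "S \<in> sets borel" using oS by auto
    show "T \<in> sets borel" by (rule mT)
    show "bounded T" by (rule bounded_subset[of "ball 0 1"]) (auto simp: T_def)
    show "bij_betw F S T" by (rule bij)
    fix z assume z: "z \<in> S"
    show D: "(F has_derivative frechet_derivative F (at z)) (at z)"
      using Fd[of z] by (simp add: frechet_derivative_works)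
    show "norm (0::'b, 1::real) = 1" by (simp add: norm_Pair)
    show "snd z * k (fst z) > 0" using z k[of "fst z"] by (auto simp: S_def)
    fix v
    show "(norm (frechet_derivative F (at z) v))\<^sup>2
        = (v \<bullet> (0, 1))\<^sup>2 + (snd z * k (fst z))\<^sup>2 * ((norm v)\<^sup>2 - (v \<bullet> (0, 1))\<^sup>2)"
    proof (rule chord_identity_derivative[OF oS z D, where \<nu> = snd])
      show "(snd has_derivative (\<lambda>v. v \<bullet> (0, 1))) (at z)"
        by (rule has_derivative_eq_rhs[OF bounded_linear_imp_has_derivative[OF bounded_linear_snd]])
          (simp add: fun_eq_iff inner_prod_def)
      show "isCont (\<lambda>z. snd z * k (fst z)) z"
        using cd by (rule differentiable_imp_continuous_within)
    qed (rule chord)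
  qed measurable
  also have "\<dots> = (\<integral>\<^sup>+z\<in>ball 0 1. g (sgn z) \<partial>lborel)"
  proof -
    have "{z. sgn z = (0::'b, 1::real)} = sgn -` {(0, 1)}" by auto
    then have "{z. sgn z = (0::'b, 1::real)} \<in> sets borel"
      using measurable_sets[OF sgn_borel_measurable, of "{(0::'b, 1::real)}"] by simp
    moreover have "negligible {z. sgn z = (0::'b, 1::real)}"
      by (rule negligible_ray) (auto simp: norm_Pair Suc_le_eq)
    ultimately have "AE z in lborel. sgn z \<noteq> (0::'b, 1::real)"
      by (intro AE_I[of _ _ "{z. sgn z = (0::'b, 1::real)}"])
        (auto simp: negligible_iff_null_sets null_sets_def)
    then show ?thesis
      using AE_lborel_singleton[of "0::'b \<times> real"]
      by (intro nn_integral_cong_AE, eventually_elim) (auto simp: indicator_def T_def)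
  qed
  finally have 1: "(\<integral>\<^sup>+z\<in>S. ennreal ((snd z * k (fst z)) ^ m) * g (sgn (F z)) \<partial>lborel)
      = ennreal (unit_ball_vol (real DIM('b \<times> real))) * (\<integral>\<^sup>+\<eta>. g \<eta> \<partial>sphere_measure)"
    by (simp add: nn_integral_sphere_measure_times dm del: DIM_prod)
  \<comment> \<open>The extra factor \<open>Suc m\<close> normalizes the integral over the height to
    1, so Fubini leaves exactly the boundary integral.\<close>
  define f where "f = (\<lambda>z :: 'b \<times> real. ennreal (k (fst z) ^ m) * g (half_map x (fst z))
      * (ennreal (real (Suc m) * snd z ^ (Suc m - 1)) * indicator {0<..<1} (snd z)))"
  have fm: "f \<in> borel_measurable (lborel \<Otimes>\<^sub>M lborel)"
    unfolding lborel_prod f_def by measurable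
  have "(\<integral>\<^sup>+z. f z \<partial>lborel) = ennreal (real (Suc m)) * (\<integral>\<^sup>+z\<in>S. ennreal ((snd z * k (fst z)) ^ m) * g (sgn (F z)) \<partial>lborel)"
  proof (subst nn_integral_cmult[symmetric])
    show "(\<lambda>z. ennreal ((snd z * k (fst z)) ^ m) * g (sgn (F z)) * indicator S z) \<in> borel_measurable lborel"
    proof -
      have [measurable]: "S \<in> sets borel" using oS by auto
      have "(\<lambda>z. snd z * k (fst z)) \<in> borel_measurable (borel :: ('b \<times> real) measure)" by measurable
      then have "(\<lambda>z. ennreal ((snd z * k (fst z)) ^ m)) \<in> borel_measurable (borel :: ('b \<times> real) measure)" by measurable
      moreover have "(\<lambda>z. g (sgn (F z)) * indicator S z) \<in> borel_measurable borel" by measurable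
      ultimately have "(\<lambda>z. ennreal ((snd z * k (fst z)) ^ m) * (g (sgn (F z)) * indicator S z)) \<in> borel_measurable borel"
        by (rule borel_measurable_times_ennreal)
      then show ?thesis by (simp add: mult.assoc)
    qed
    show "(\<integral>\<^sup>+z. f z \<partial>lborel) = (\<integral>\<^sup>+z. ennreal (real (Suc m)) * (ennreal ((snd z * k (fst z)) ^ m) * g (sgn (F z)) * indicator S z) \<partial>lborel)"
    proof (intro nn_integral_cong)
      fix z :: "'b \<times> real"
      show "f z = ennreal (real (Suc m)) * (ennreal ((snd z * k (fst z)) ^ m) * g (sgn (F z)) * indicator S z)"
      proof (cases "z \<in> S")
        case True
        then have z: "0 < snd z" "snd z < 1" by (auto simp: S_def)
        have "ennreal ((snd z * k (fst z)) ^ m) = ennreal (snd z ^ m) * ennreal (k (fst z) ^ m)"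
          using z k[of "fst z"] by (simp add: power_mult_distrib ennreal_mult)
        moreover have "ennreal (real (Suc m) * snd z ^ m) = ennreal (real (Suc m)) * ennreal (snd z ^ m)"
          using z by (intro ennreal_mult) auto
        ultimately show ?thesis
          using True z by (simp add: f_def nF(2) mult_ac del: of_nat_Suc)
      next
        case False
        then have "\<not> (0 < snd z \<and> snd z < 1)" by (cases z) (auto simp: S_def)
        then show ?thesis using False by (auto simp: f_def)
      qed
    qed
  qed
  moreover have "(\<integral>\<^sup>+z. f z \<partial>lborel) = (\<integral>\<^sup>+y. (\<integral>\<^sup>+\<rho>. f (y, \<rho>) \<partial>lborel) \<partial>lborel)"
    using lborel.nn_integral_fst[OF fm] by (simp add: lborel_prod)
  moreover have "(\<integral>\<^sup>+\<rho>. f (y, \<rho>) \<partial>lborel) = ennreal (k y ^ m) * g (half_map x y)" for y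
  proof -
    have "(\<integral>\<^sup>+\<rho>. f (y, \<rho>) \<partial>lborel) = ennreal (k y ^ m) * g (half_map x y)
        * (\<integral>\<^sup>+\<rho>\<in>{0<..<1}. ennreal (real (Suc m) * \<rho> ^ (Suc m - 1)) \<partial>lborel)"
      unfolding f_def fst_conv snd_conv by (rule nn_integral_cmult) measurable
    then show ?thesis by (subst (asm) nn_integral_monomial) auto
  qed
  ultimately have "(\<integral>\<^sup>+y. ennreal (k y ^ m) * g (half_map x y) \<partial>lborel)
      = ennreal (real (Suc m)) * (ennreal (unit_ball_vol (real DIM('b \<times> real))) * (\<integral>\<^sup>+\<eta>. g \<eta> \<partial>sphere_measure))"
    unfolding 1 by simp
  then show ?thesis
    unfolding k_def m_def[symmetric] dm by (simp add: ennreal_mult mult.assoc del: of_nat_Suc)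
qed

end

text \<open>With \<open>D\<close> the denominator, the gradient of \<open>snd z / D\<close> is
  \<open>1 / D\<close> times \<open>(0, 1)\<close> minus \<open>2 * snd z / D\<close> times
  \<open>(fst z - y, snd z)\<close>, and this difference is \<open>half_map z y\<close>.\<close>

lemma has_derivative_half_kernel:
  fixes z :: "'b::euclidean_space \<times> real"
  assumes z: "snd z > 0"
  shows "((\<lambda>z. (snd z / half_denom z y) ^ m) has_derivative
    (\<lambda>h. h \<bullet> (real m / snd z * (snd z / half_denom z y) ^ m) *\<^sub>R half_map z y)) (at z)"
proof -
  define D where "D = half_denom z y"
  have D: "D > 0" unfolding D_def by (rule half_denom_pos[OF z])
  have DD: "D = (fst z - y) \<bullet> (fst z - y) + snd z * snd z"
    by (simp add: D_def half_denom_def power2_norm_eq_inner power2_eq_square[of "snd z"])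
  have nz: "(fst z - y) \<bullet> (fst z - y) + snd z * snd z \<noteq> 0" using D DD by simp
  have "((\<lambda>z. snd z / ((fst z - y) \<bullet> (fst z - y) + snd z * snd z)) has_derivative
     (\<lambda>h. (snd h * D - snd z * (2 * (fst h \<bullet> (fst z - y)) + 2 * (snd h * snd z))) / (D * D))) (at z)"
    unfolding DD
    using nz by (auto intro!: derivative_eq_intros bounded_linear_imp_has_derivative[OF bounded_linear_fst]
       bounded_linear_imp_has_derivative[OF bounded_linear_snd] simp: inner_commute)
  moreover have "(snd h * D - snd z * (2 * (fst h \<bullet> (fst z - y)) + 2 * (snd h * snd z))) / (D * D)
      = (1 / D) * (h \<bullet> half_map z y)" for h
  proof -
    have hh: "h \<bullet> half_map z y = snd h - 2 * snd z / D * (fst h \<bullet> (fst z - y) + snd h * snd z)"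
      using D by (cases h) (simp add: half_map_def D_def[symmetric] inner_diff_right field_simps)
    show ?thesis unfolding hh using D by (simp add: field_simps)
  qed
  ultimately have f: "((\<lambda>z. snd z / half_denom z y) has_derivative (\<lambda>h. (1 / D) * (h \<bullet> half_map z y))) (at z)"
    by (simp add: half_denom_def power2_norm_eq_inner power2_eq_square[of "snd _"])
  have "((\<lambda>z. (snd z / half_denom z y) ^ m) has_derivative
      (\<lambda>h. real m * ((1 / D) * (h \<bullet> half_map z y)) * (snd z / half_denom z y) ^ (m - 1))) (at z)"
    using has_derivative_power[OF f, of m] by (simp add: mult_ac)
  moreover have "real m * ((1 / D) * (h \<bullet> half_map z y)) * (snd z / half_denom z y) ^ (m - 1)
     = h \<bullet> (real m / snd z * (snd z / half_denom z y) ^ m) *\<^sub>R half_map z y" for h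
    using z by (cases m) (simp_all add: D_def)
  ultimately show ?thesis by simp
qed

text \<open>The constant is the one for which the kernel has integral 1: the denominator is the area
  of the unit sphere, and \<open>2 ^ (n - 1)\<close> accounts for the 2 in the conformal
  factor.\<close>

lemma half_space_const_eq:
  assumes "n \<ge> 2"
  shows "half_space_const n = 2 ^ (n - 1) / (real n * unit_ball_vol (real n))"
proof -
  have "Gamma (n / 2 + 1) = n / 2 * Gamma (n / 2)"
    using assms by (intro Gamma_plus1) (auto simp: nonpos_Ints_def)
  moreover have "(2::real) ^ (n - 1) = 2 * 2 ^ (n - 2)"
    using assms by (simp flip: power_Suc add: Suc_diff_le numeral_2_eq_2)
  moreover have "Gamma (n / 2) > 0" using assms by (intro Gamma_real_pos) auto
  ultimately show ?thesis
    using assms by (simp add: half_space_const_def unit_ball_vol_def field_simps)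
qed

text \<open>The analogue of the ball with \<open>w = 1\<close> at every \<open>x\<close>. Here the
  kernel carries \<open>half_space_const n\<close>, while the boundary measure is not normalized;
  the area of the sphere and the power of 2 from the Jacobian combine to the division by that
  constant in \<open>I\<close>.\<close>

lemma sharp_gradient_half_space:
  fixes x :: "'b::euclidean_space \<times> real"
  defines "n \<equiv> DIM('b \<times> real)"
  assumes pq: "p = \<infinity> \<and> q = 1 \<or> (\<exists>r. p = ereal r \<and> r > 1 \<and> q > 1 \<and> 1 / r + 1 / q = 1)"
  defines "s \<equiv> (real n - 1) * (q - 1)"
  assumes x: "snd x > 0" and coeff: "\<And>k. (s gchoose (2 * k)) \<ge> 0"
  defines "I \<equiv> (half_space_const n * (real n - 1) / snd x) powr q / half_space_const n * (1 / (2 * snd x)) powr s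
      * (sphere_moment n q * hypergeometric_3F2 (- s / 2) ((1 - s) / 2) ((q + 1) / 2) (1 / 2) ((q + n) / 2) 1)"
  shows "\<And>\<phi>. \<phi> \<in> Lp lebesgue p \<Longrightarrow> poisson_szego_half_space \<phi> differentiable (at x)"
    and "sharp_inequality (Lp lebesgue p) (\<lambda>\<phi>. norm (gradient (poisson_szego_half_space \<phi>) x))
      (Lp_norm lebesgue p) (I powr (1 / q))"
proof -
  define N where "N = DIM('b)"
  have nN: "n = Suc N" "n - 1 = N" "real n - 1 = real N" by (simp_all add: n_def N_def)
  have N: "N > 0" by (simp add: N_def)
  have dim: "DIM('b \<times> real) \<ge> 2" using N by (simp add: N_def)
  define t where "t = snd x"
  have t: "t > 0" using x by (simp add: t_def)
  define c where "c = half_space_const n"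
  have ceq: "c = 2 ^ N / (real n * unit_ball_vol (real n))"
    unfolding c_def using half_space_const_eq[of n] dim nN by (simp add: n_def)
  have c: "c > 0" unfolding ceq using nN by simp
  define G where "G = (\<lambda>(z::'b \<times> real) y. (c * (real N / snd z) * (snd z / half_denom z y) ^ N) *\<^sub>R half_map z y)"
  define K where "K = (\<lambda>(z::'b \<times> real) y. c * (snd z / half_denom z y) ^ N)"
  have u: "poisson_szego_half_space \<phi> = (\<lambda>z. \<integral>y. K z y * \<phi> y \<partial>lebesgue)" for \<phi>
    by (simp add: poisson_szego_half_space_def[abs_def] K_def half_denom_def N_def c_def n_def mult.assoc)
  define e :: "'b \<times> real" where "e = (0, 1)"
  have e: "norm e = 1" by (simp add: e_def norm_Pair)
  have q1: "q \<ge> 1" using pq by auto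
  then have s0: "s \<ge> 0" and q0: "q > 0" using N by (auto simp: s_def nN(3))
  define J where "J = sphere_moment n q * hypergeometric_3F2 (- s / 2) ((1 - s) / 2) ((q + 1) / 2) (1 / 2) ((q + n) / 2) 1"
  note kernel = nn_integral_sphere_kernel[OF dim e q0 s0 zero_le_one order_refl coeff, folded n_def, simplified power_one, folded J_def]
  define A where "A = (c * (real N / t)) powr q"
  define B where "B = (1 / (2 * t)) powr s"
  have AB: "A > 0" "B > 0" unfolding A_def B_def using c N t by auto
  have IAB: "I = A * B / c * J"
    unfolding I_def A_def B_def J_def t_def c_def nN(3) by simp
  have D: "half_denom x y > 0" for y by (rule half_denom_pos[OF x])
  have fac: "t / half_denom x y = 1 / (2 * t) * (1 - half_map x y \<bullet> e)" for y
    using D[of y] t snd_half_map[OF x, of y] by (simp add: e_def inner_prod_def t_def field_simps power2_eq_square)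
  have fac0: "1 - half_map x y \<bullet> e \<ge> 0" for y
  proof -
    have "0 < t / half_denom x y" using D[of y] t by simp
    then have "0 < 1 / (2 * t) * (1 - half_map x y \<bullet> e)" unfolding fac .
    then show ?thesis using t by (simp add: zero_less_mult_iff zero_less_divide_iff)
  qed
  have int: "(\<integral>\<^sup>+y. ennreal (\<bar>G x y \<bullet> l\<bar> powr q) \<partial>lebesgue)
      = ennreal (A * B / c) * (\<integral>\<^sup>+z. ennreal ((1 - 1 * (z \<bullet> e)) powr s * \<bar>z \<bullet> l\<bar> powr q) \<partial>sphere_measure)" for l
  proof -
    \<comment> \<open>The kernel contains \<open>(t / half_denom x y) ^ N\<close>, whereas the
      Jacobian has \<open>2 * t\<close> in the numerator; the division by \<open>2 ^ N\<close> makes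
      up for this.\<close>
    define g where "g = (\<lambda>z. ennreal (A * B / 2 ^ N) * ennreal ((1 - 1 * (z \<bullet> e)) powr s * \<bar>z \<bullet> l\<bar> powr q))"
    have gm: "g \<in> borel_measurable borel" unfolding g_def by measurable
    have "(\<integral>\<^sup>+y. ennreal (\<bar>G x y \<bullet> l\<bar> powr q) \<partial>lebesgue)
      = (\<integral>\<^sup>+y. ennreal ((2 * snd x / half_denom x y) ^ DIM('b)) * g (half_map x y) \<partial>lborel)"
      unfolding nn_integral_completion
    proof (intro nn_integral_cong)
      fix y :: 'b
      let ?\<eta> = "half_map x y" and ?c = "t / half_denom x y"
      have cp: "?c > 0" using D[of y] t by simp
      have cN: "(?c ^ N) powr q = ?c ^ N * ?c powr s"
      proof -
        have "(?c ^ N) powr q = ?c powr (real N * q)" using cp by (simp add: powr_realpow[symmetric] powr_powr)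
        also have "real N * q = real N + s" by (simp add: s_def nN(3) algebra_simps)
        finally show ?thesis using cp by (simp add: powr_add powr_realpow)
      qed
      have "\<bar>G x y \<bullet> l\<bar> = c * (real N / t) * ?c ^ N * \<bar>?\<eta> \<bullet> l\<bar>"
        unfolding G_def using cp c t D[of y] by (simp add: abs_mult t_def)
      then have "\<bar>G x y \<bullet> l\<bar> powr q = A * (?c ^ N) powr q * \<bar>?\<eta> \<bullet> l\<bar> powr q"
        by (simp only: A_def powr_mult)
      also have "\<dots> = ?c ^ N * (A * ?c powr s * \<bar>?\<eta> \<bullet> l\<bar> powr q)" by (simp add: cN mult_ac)
      also have "?c powr s = B * (1 - 1 * (?\<eta> \<bullet> e)) powr s"
        unfolding B_def fac mult_1 by (rule powr_mult)
      also have "?c ^ N = (2 * t / half_denom x y) ^ N / 2 ^ N"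
        by (simp add: power_divide power_mult_distrib)
      finally have "\<bar>G x y \<bullet> l\<bar> powr q = (2 * t / half_denom x y) ^ N * (A * B / 2 ^ N * ((1 - 1 * (?\<eta> \<bullet> e)) powr s * \<bar>?\<eta> \<bullet> l\<bar> powr q))"
        by simp
      moreover have "ennreal ((2 * t / half_denom x y) ^ N * (A * B / 2 ^ N * ((1 - 1 * (?\<eta> \<bullet> e)) powr s * \<bar>?\<eta> \<bullet> l\<bar> powr q)))
        = ennreal ((2 * t / half_denom x y) ^ N) * g ?\<eta>"
        unfolding g_def using AB t D[of y] by (subst ennreal_mult, simp, simp, subst ennreal_mult) auto
      ultimately show "ennreal (\<bar>G x y \<bullet> l\<bar> powr q) = ennreal ((2 * snd x / half_denom x y) ^ DIM('b)) * g ?\<eta>"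
        unfolding N_def[symmetric] t_def[symmetric] by simp
    qed
    also have "\<dots> = ennreal (real n * unit_ball_vol (real n)) * (\<integral>\<^sup>+\<eta>. g \<eta> \<partial>sphere_measure)"
      using nn_integral_half_map[OF x gm] by (simp only: n_def)
    also have "(\<integral>\<^sup>+\<eta>. g \<eta> \<partial>sphere_measure)
        = ennreal (A * B / 2 ^ N) * (\<integral>\<^sup>+z. ennreal ((1 - 1 * (z \<bullet> e)) powr s * \<bar>z \<bullet> l\<bar> powr q) \<partial>sphere_measure)"
      unfolding g_def by (intro nn_integral_cmult borel_measurable_sphere_measure) measurable
    also have "ennreal (real n * unit_ball_vol (real n)) * (ennreal (A * B / 2 ^ N) * X) = ennreal (A * B / c) * X" for X
    proof -
      have "ennreal (real n * unit_ball_vol (real n)) * ennreal (A * B / 2 ^ N)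
          = ennreal (real n * unit_ball_vol (real n) * (A * B / 2 ^ N))"
        using AB by (intro ennreal_mult[symmetric]) auto
      also have "real n * unit_ball_vol (real n) * (A * B / 2 ^ N) = A * B / c"
        by (simp add: ceq)
      finally show ?thesis by (simp only: mult.assoc[symmetric])
    qed
    finally show ?thesis .
  qed
  have Ipos: "I > 0" unfolding IAB using AB c kernel(1) by simp
  have Ie: "ennreal (A * B / c) * ennreal J = ennreal I"
    unfolding IAB using AB c kernel(1) by (intro ennreal_mult[symmetric]) auto
  have I0: "(\<integral>\<^sup>+y. ennreal (\<bar>G x y \<bullet> e\<bar> powr q) \<partial>lebesgue) = ennreal I"
    unfolding int using kernel(2) Ie by simp
  have Il: "(\<integral>\<^sup>+y. ennreal (\<bar>G x y \<bullet> l\<bar> powr q) \<partial>lebesgue) \<le> ennreal I" if "norm l = 1" for l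
    unfolding int Ie[symmetric] using kernel(3)[OF that] by (intro mult_left_mono) auto
  \<comment> \<open>6 is \<open>3 / 2 * 4\<close>: heights near \<open>x\<close> stay below
    \<open>3 / 2 * t\<close>, and the distances to \<open>y\<close> differ by a factor at most 2
    before squaring. The summand \<open>t / real N\<close> serves the bound on the kernel, the
    summand 2 the bound on its gradient.\<close>
  define H C where "H = (6::real) ^ N" and "C = H * (t / real N + 2)"
  have t2: "t / 2 > 0" using t by simp
  have nsnd: "\<bar>snd v\<bar> \<le> norm v" for v :: "'b \<times> real"
    using norm_snd_le[of "snd v" "fst v"] by simp
  have near: "snd z > t / 2" "snd z < 3 / 2 * t" if z: "z \<in> ball x (t / 2)" for z
  proof -
    have "\<bar>snd (x - z)\<bar> \<le> norm (x - z)" by (rule nsnd)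
    also have "\<dots> < t / 2" using z by (simp add: dist_norm)
    finally have "\<bar>t - snd z\<bar> < t / 2" by (simp add: t_def)
    then have "t - snd z < t / 2" "- (t - snd z) < t / 2" by (simp_all only: abs_less_iff)
    then show "snd z > t / 2" "snd z < 3 / 2 * t" by linarith+
  qed
  have nearp: "snd z > 0" if "z \<in> ball x (t / 2)" for z using near[OF that] t by simp
  have Harnack: "snd z / half_denom z y \<le> 6 * (t / half_denom x y)" if z: "z \<in> ball x (t / 2)" for z y
  proof -
    let ?a = "norm (fst x - y, snd x)" and ?b = "norm (fst z - y, snd z)"
    have "?a \<le> norm (x - z) + ?b"
      using norm_triangle_ineq[of "x - z" "(fst z - y, snd z)"] by (simp add: minus_prod_def plus_prod_def)
    moreover have "norm (x - z) \<le> t / 2" using z by (simp add: dist_norm)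
    moreover have "t / 2 \<le> ?b" using nsnd[of "(fst z - y, snd z)"] near(1)[OF z] by simp
    ultimately have "?a \<le> 2 * ?b" by linarith
    then have "?a\<^sup>2 \<le> (2 * ?b)\<^sup>2" by (intro power_mono) auto
    then have "half_denom x y \<le> 4 * half_denom z y" by (simp add: half_denom_norm power_mult_distrib)
    then have "1 / half_denom z y \<le> 4 / half_denom x y"
      using D[of y] half_denom_pos[OF nearp[OF z], of y] by (simp add: field_simps)
    then have "snd z * (1 / half_denom z y) \<le> (3 / 2 * t) * (4 / half_denom x y)"
      using near(2)[OF z] nearp[OF z] D[of y] half_denom_pos[OF nearp[OF z], of y] t by (intro mult_mono) auto
    then show ?thesis by simp
  qed
  have HN: "(snd z / half_denom z y) ^ N \<le> H * (t / half_denom x y) ^ N" "0 < (snd z / half_denom z y) ^ N"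
    if z: "z \<in> ball x (t / 2)" for z y
    unfolding H_def power_mult_distrib[symmetric]
    using Harnack[OF z, of y] nearp[OF z] half_denom_pos[OF nearp[OF z], of y] by (auto intro!: power_mono)
  have Gx: "norm (G x y) = c * (real N / t) * (t / half_denom x y) ^ N" for y
    unfolding G_def using D[of y] t c by (simp add: norm_half_map[OF x] abs_mult t_def)
  have H0: "H \<ge> 0" by (simp add: H_def)
  have Kb: "\<bar>K z y\<bar> \<le> C * norm (G x y)" if z: "z \<in> ball x (t / 2)" for z y
  proof -
    have "\<bar>K z y\<bar> = c * (snd z / half_denom z y) ^ N"
      unfolding K_def using HN(2)[OF z, of y] c by (simp add: abs_mult)
    also have "\<dots> \<le> c * (H * (t / half_denom x y) ^ N)"
      using HN(1)[OF z, of y] c by (intro mult_left_mono) auto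
    also have "\<dots> = H * (t / real N) * norm (G x y)"
      unfolding Gx using t N by simp
    also have "\<dots> \<le> C * norm (G x y)"
      unfolding C_def using H0 by (intro mult_right_mono mult_left_mono) auto
    finally show ?thesis .
  qed
  have Gb: "norm (G z y) \<le> C * norm (G x y)" if z: "z \<in> ball x (t / 2)" for z y
  proof -
    have "norm (G z y) = c * (real N / snd z) * (snd z / half_denom z y) ^ N"
      unfolding G_def using HN(2)[OF z, of y] c nearp[OF z] by (simp add: norm_half_map[OF nearp[OF z]] abs_mult)
    also have "\<dots> \<le> c * (real N / (t / 2)) * (H * (t / half_denom x y) ^ N)"
    proof (intro mult_mono mult_left_mono HN z)
      show "real N / snd z \<le> real N / (t / 2)"
        using near(1)[OF z] t nearp[OF z] by (intro divide_left_mono) auto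
    qed (use c t nearp[OF z] less_imp_le[OF HN(2)[OF z, of y]] in auto)
    also have "\<dots> = H * 2 * norm (G x y)" unfolding Gx by simp
    also have "\<dots> \<le> C * norm (G x y)"
      unfolding C_def using H0 t by (intro mult_right_mono mult_left_mono) auto
    finally show ?thesis .
  qed
  have Km: "K z \<in> borel_measurable lebesgue" if "z \<in> ball x (t / 2)" for z
  proof -
    note [measurable] = half_denom_borel[OF nearp[OF that]]
    have "K z \<in> borel_measurable borel" unfolding K_def by measurable
    then show ?thesis by (intro measurable_completion) simp
  qed
  have Gm: "G x \<in> borel_measurable lebesgue"
  proof -
    note [measurable] = half_denom_borel[OF x] half_map_borel[OF x]
    have "G x \<in> borel_measurable borel" unfolding G_def by measurable
    then show ?thesis by (intro measurable_completion) simp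
  qed
  have der: "((\<lambda>z. K z y) has_derivative (\<lambda>h. h \<bullet> G z y)) (at z)" if "z \<in> ball x (t / 2)" for z y
    using has_derivative_mult_right[OF has_derivative_half_kernel[OF nearp[OF that], of y N], of c]
    by (simp add: K_def G_def mult_ac)
  note concl = kernel_integral_sharp_gradient[OF t2, where K = K and G = G and x = x and M = lebesgue
    and C = C and p = p and q = q and I = I and ?l0.0 = e]
  show "poisson_szego_half_space \<phi> differentiable (at x)" if "\<phi> \<in> Lp lebesgue p" for \<phi>
    unfolding u by (rule concl(1)[OF Km der Kb Gb pq Gm e Ipos I0 Il that])
  show "sharp_inequality (Lp lebesgue p) (\<lambda>\<phi>. norm (gradient (poisson_szego_half_space \<phi>) x))
      (Lp_norm lebesgue p) (I powr (1 / q))"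
    unfolding u by (rule concl(2)[OF Km der Kb Gb pq Gm e Ipos I0 Il])
qed

subsection \<open>The constants\<close>

text \<open>The end points of the interval for \<open>p\<close> are
  \<open>1 + (n - 1) / (2 * K)\<close> and \<open>1 + (n - 1) / (2 * K - 1)\<close>, and
  \<open>(p - 1) * (q - 1) = 1\<close>. Hence \<open>(n - 1) * (q - 1)\<close> equals
  \<open>(n - 1) / (p - 1)\<close> and ranges between \<open>2 * K - 1\<close> and
  \<open>2 * K\<close>.\<close>

lemma conjugate_exponent_cases:
  fixes p :: ereal and q :: real and n :: nat
  assumes n: "n \<ge> 3"
    and p: "p = \<infinity> \<or>
         (\<exists>K\<^sub>1::nat. K\<^sub>1 \<ge> 1 \<and>
            p \<in> {ereal ((2 * real K\<^sub>1 + real n - 1) / (2 * real K\<^sub>1)) ..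
                 ereal ((2 * real K\<^sub>1 + real n - 2) / (2 * real K\<^sub>1 - 1))})"
    and pq: "1 / p + 1 / ereal q = 1"
  shows "p = \<infinity> \<and> q = 1 \<or> (\<exists>r. p = ereal r \<and> r > 1 \<and> q > 1 \<and> 1 / r + 1 / q = 1)"
    and "(real n - 1) * (q - 1) = 0 \<or>
      (\<exists>K\<ge>1. 2 * real K - 1 \<le> (real n - 1) * (q - 1) \<and> (real n - 1) * (q - 1) \<le> 2 * real K)"
proof -
  have ed: "1 / ereal a = ereal (1 / a)" if "a \<noteq> 0" for a
    unfolding one_ereal_def ereal_divide using that by simp
  \<comment> \<open>In \<open>ereal\<close>, \<open>1 / 0\<close> is infinite, so
    \<open>q = 0\<close> is excluded by the conjugacy equation together with
    \<open>1 / p \<ge> 0\<close>.\<close>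
  have q0: "q \<noteq> 0"
  proof
    assume "q = 0"
    then have e: "1 / ereal q = \<infinity>" by (simp add: divide_ereal_def)
    have "1 / p \<ge> 0"
      using p
    proof
      assume "\<exists>K\<^sub>1::nat. K\<^sub>1 \<ge> 1 \<and>
            p \<in> {ereal ((2 * real K\<^sub>1 + real n - 1) / (2 * real K\<^sub>1)) ..
                 ereal ((2 * real K\<^sub>1 + real n - 2) / (2 * real K\<^sub>1 - 1))}"
      then obtain K\<^sub>1 :: nat where "K\<^sub>1 \<ge> 1" "ereal ((2 * real K\<^sub>1 + real n - 1) / (2 * real K\<^sub>1)) \<le> p" by auto
      moreover have "0 \<le> (2 * real K\<^sub>1 + real n - 1) / (2 * real K\<^sub>1)" using n by simp
      ultimately have "0 \<le> p" using order_trans[of 0 "ereal ((2 * real K\<^sub>1 + real n - 1) / (2 * real K\<^sub>1))" p] by simp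
      then show ?thesis by (cases p) (auto simp: divide_ereal_def)
    qed simp
    then show False using pq unfolding e by (cases "1 / p") auto
  qed
  show "p = \<infinity> \<and> q = 1 \<or> (\<exists>r. p = ereal r \<and> r > 1 \<and> q > 1 \<and> 1 / r + 1 / q = 1)"
    and "(real n - 1) * (q - 1) = 0 \<or>
      (\<exists>K\<ge>1. 2 * real K - 1 \<le> (real n - 1) * (q - 1) \<and> (real n - 1) * (q - 1) \<le> 2 * real K)"
    using p
  proof (atomize (full), elim disjE exE conjE)
    assume pinf: "p = \<infinity>"
    then have "ereal (1 / q) = ereal 1" using pq unfolding ed[OF q0] by simp
    then have "q = 1" using q0 by (simp del: ereal_eq_1)
    then show "(p = \<infinity> \<and> q = 1 \<or> (\<exists>r. p = ereal r \<and> r > 1 \<and> q > 1 \<and> 1 / r + 1 / q = 1)) \<and>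
      ((real n - 1) * (q - 1) = 0 \<or>
      (\<exists>K\<ge>1. 2 * real K - 1 \<le> (real n - 1) * (q - 1) \<and> (real n - 1) * (q - 1) \<le> 2 * real K))"
      using pinf by simp
  next
    fix K :: nat
    assume K: "K \<ge> 1" and mem: "p \<in> {ereal ((2 * real K + real n - 1) / (2 * real K)) ..
                 ereal ((2 * real K + real n - 2) / (2 * real K - 1))}"
    then obtain r where r: "p = ereal r" by (cases p) auto
    define m where "m = real n - 1"
    have m: "m \<ge> 2" using n by (simp add: m_def)
    have K1: "real K \<ge> 1" using K by simp
    have lo: "(2 * real K + m) / (2 * real K) \<le> r" and hi: "r \<le> (2 * real K + m - 1) / (2 * real K - 1)"
      using mem by (simp_all add: r m_def algebra_simps)
    have rm: "r - 1 \<ge> m / (2 * real K)" "r - 1 \<le> m / (2 * real K - 1)"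
      using lo hi K1 by (simp_all add: field_simps)
    have "m / (2 * real K) > 0" using m K1 by simp
    then have r1: "r > 1" using rm by simp
    have "ereal (1 / r + 1 / q) = ereal 1"
      using pq r1 unfolding r ed[OF q0] by (subst (asm) ed) (auto simp: one_ereal_def)
    then have rq: "1 / r + 1 / q = 1" by (simp only: ereal.inject)
    have qq: "(q - 1) * (r - 1) = 1" using rq r1 q0 by (simp add: field_simps)
    then have q1: "q > 1" using r1 by (metis diff_gt_0_iff_gt zero_less_mult_pos2 zero_less_one)
    have s: "m * (q - 1) = m / (r - 1)" using qq r1 by (simp add: field_simps)
    have "m * (q - 1) \<le> 2 * real K"
      unfolding s using rm(1) r1 K1 by (simp add: field_simps)
    moreover have "2 * real K - 1 \<le> m * (q - 1)"
      unfolding s using rm(2) r1 K1 by (simp add: field_simps)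
    ultimately show "(p = \<infinity> \<and> q = 1 \<or> (\<exists>r. p = ereal r \<and> r > 1 \<and> q > 1 \<and> 1 / r + 1 / q = 1)) \<and>
      ((real n - 1) * (q - 1) = 0 \<or>
      (\<exists>K\<ge>1. 2 * real K - 1 \<le> (real n - 1) * (q - 1) \<and> (real n - 1) * (q - 1) \<le> 2 * real K))"
      using r r1 q1 rq K unfolding m_def by blast
  qed
qed

lemma ball_constant_eq:
  fixes q r :: real and n :: nat
  assumes n: "n \<ge> 2" and q: "q \<ge> 1" and r: "0 \<le> r" "r < 1"
  defines "s \<equiv> (real n - 1) * (q - 1)"
  shows "((2 * (real n - 1) / (1 - r\<^sup>2)) powr q * ((1 + r\<^sup>2) / (1 - r\<^sup>2)) powr s * (sphere_moment n q * H)) powr (1 / q)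
    = 2 * (real n - 1) *
           (Gamma (real n / 2) * Gamma ((q + 1) / 2)
              * (1 + r ^ 2) powr ((real n - 1) * (q - 1))
            / (sqrt pi * Gamma ((q + real n) / 2)
              * (1 - r ^ 2) powr (real n * (q - 1) + 1))) powr (1 / q) * H powr (1 / q)"
proof -
  have r2: "1 - r\<^sup>2 > 0" using r by (simp add: abs_square_less_1)
  \<comment> \<open>The power of \<open>1 - r\<^sup>2\<close> collects \<open>q\<close> from the
    gradient factor and \<open>s\<close> from the conformal factor.\<close>
  have e: "real n * (q - 1) + 1 = q + s" by (simp add: s_def algebra_simps)
  have "(2 * (real n - 1) / (1 - r\<^sup>2)) powr q * ((1 + r\<^sup>2) / (1 - r\<^sup>2)) powr s * (sphere_moment n q * H)
    = (2 * (real n - 1)) powr q * (Gamma (real n / 2) * Gamma ((q + 1) / 2) * (1 + r ^ 2) powr s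
        / (sqrt pi * Gamma ((q + real n) / 2) * (1 - r ^ 2) powr (q + s))) * H"
    unfolding sphere_moment_def powr_divide powr_add by (simp add: mult_ac)
  then show ?thesis
    unfolding e s_def[symmetric] using q n by (simp only: powr_mult powr_powr) simp
qed

text \<open>Bookkeeping of exponents before the root is taken: 2 gets
  \<open>(n - 2) * (q - 1) - s = - (q - 1)\<close>, \<open>Gamma (n / 2)\<close> gets
  \<open>(q - 1) + 1 = q\<close> and so leaves the root, \<open>pi\<close> gets
  \<open>- n * (q - 1) / 2 - 1 / 2\<close>, and \<open>t\<close> gets
  \<open>- (q + s)\<close>.\<close>

lemma half_space_constant_eq:
  fixes q t :: real and n :: nat
  assumes n: "n \<ge> 2" and q: "q \<ge> 1" and t: "t > 0"
  defines "s \<equiv> (real n - 1) * (q - 1)"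
  shows "((half_space_const n * (real n - 1) / t) powr q / half_space_const n * (1 / (2 * t)) powr s
      * (sphere_moment n q * H)) powr (1 / q)
    = (real n - 1) * Gamma (real n / 2)
            / (2 powr ((q - 1) / q) * pi powr ((real n * q - real n + 1) / (2 * q))
               * t powr ((real n * (q - 1) + 1) / q)) *
           (Gamma ((q + 1) / 2) / Gamma ((q + real n) / 2) * H) powr (1 / q)"
proof -
  define c g where "c = half_space_const n" and "g = Gamma (real n / 2)"
  have g: "g > 0" unfolding g_def using n by (intro Gamma_real_pos) auto
  have m: "real n - 1 > 0" using n by simp
  have ceq: "c = 2 powr (real n - 2) * g * pi powr (- (real n / 2))"
    using n by (simp add: c_def half_space_const_def g_def powr_realpow[symmetric] of_nat_diff powr_minus_divide)
  have c: "c > 0" unfolding ceq using g by simp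
  define X where "X = Gamma ((q + 1) / 2) / Gamma ((q + real n) / 2) * H"
  have "(c * (real n - 1) / t) powr q / c * (1 / (2 * t)) powr s * (sphere_moment n q * H)
    = (c powr q / c * (real n - 1) powr q * t powr (- (q + s)) * 2 powr (- s) * (g / sqrt pi)) * X"
    unfolding sphere_moment_def g_def[symmetric] X_def powr_divide powr_mult powr_minus_divide powr_add
    by (simp add: mult_ac)
  also have "c powr q / c = c powr (q - 1)" using c by (simp add: powr_diff)
  also have "\<dots> = 2 powr ((real n - 2) * (q - 1)) * g powr (q - 1) * pi powr (- (real n / 2) * (q - 1))"
    unfolding ceq powr_mult powr_powr ..
  also have "2 powr ((real n - 2) * (q - 1)) * g powr (q - 1) * pi powr (- (real n / 2) * (q - 1))
      * (real n - 1) powr q * t powr (- (q + s)) * 2 powr (- s) * (g / sqrt pi)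
    = (2 powr ((real n - 2) * (q - 1)) * 2 powr (- s)) * (g powr (q - 1) * g)
      * (pi powr (- (real n / 2) * (q - 1)) / sqrt pi) * (real n - 1) powr q * t powr (- (q + s))"
    by simp
  also have "2 powr ((real n - 2) * (q - 1)) * 2 powr (- s) = 2 powr (- (q - 1))"
    unfolding powr_add[symmetric] by (rule arg_cong[where f = "\<lambda>a. 2 powr a"]) (simp add: s_def algebra_simps)
  also have "g powr (q - 1) * g = g powr q" using g powr_add[of g "q - 1" 1] by simp
  also have "pi powr (- (real n / 2) * (q - 1)) / sqrt pi = pi powr (- ((real n * q - real n + 1) / 2))"
  proof -
    have "pi powr (- (real n / 2) * (q - 1)) / sqrt pi = pi powr (- (real n / 2) * (q - 1)) * pi powr (- (1 / 2))"
      by (simp add: powr_minus_divide powr_half_sqrt)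
    also have "\<dots> = pi powr (- ((real n * q - real n + 1) / 2))"
      unfolding powr_add[symmetric] by (rule arg_cong[where f = "\<lambda>a. pi powr a"]) (simp add: field_simps)
    finally show ?thesis .
  qed
  finally have "((c * (real n - 1) / t) powr q / c * (1 / (2 * t)) powr s * (sphere_moment n q * H)) powr (1 / q)
    = 2 powr (- (q - 1) * (1 / q)) * g powr (q * (1 / q)) * pi powr (- ((real n * q - real n + 1) / 2) * (1 / q))
      * (real n - 1) powr (q * (1 / q)) * t powr (- (q + s) * (1 / q)) * X powr (1 / q)"
    by (simp only: powr_mult powr_powr)
  also have "- (q - 1) * (1 / q) = - ((q - 1) / q)"
    by (simp only: mult_minus_left times_divide_eq_right mult_1_right)
  also have "- ((real n * q - real n + 1) / 2) * (1 / q) = - ((real n * q - real n + 1) / (2 * q))"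
    by (simp only: mult_minus_left times_divide_times_eq mult_1_right)
  also have "- (q + s) * (1 / q) = - ((real n * (q - 1) + 1) / q)"
  proof -
    have "q + s = real n * (q - 1) + 1" by (simp add: s_def algebra_simps)
    then show ?thesis by (simp only: mult_minus_left times_divide_eq_right mult_1_right)
  qed
  finally show ?thesis
    unfolding c_def[symmetric] g_def[symmetric] X_def[symmetric] powr_minus_divide
    using q g m by simp
qed

text \<open>Differentiability is asserted alongside each inequality because \<open>gradient\<close>
  is a definite description, which carries information only where a derivative exists.\<close>

theorem theorem1p5:
  fixes n :: nat and p :: ereal and q :: real
  assumes "n \<ge> 3"
    and "CARD('n::finite) = n"
    and "CARD('m::finite) = n - 1"
    and "p = \<infinity> \<or>
         (\<exists>K\<^sub>1::nat. K\<^sub>1 \<ge> 1 \<and>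
            p \<in> {ereal ((2 * real K\<^sub>1 + real n - 1) / (2 * real K\<^sub>1)) ..
                 ereal ((2 * real K\<^sub>1 + real n - 2) / (2 * real K\<^sub>1 - 1))})"
    and "1 / p + 1 / ereal q = 1"
  shows
    "(\<forall>x \<in> ball (0 :: real ^ 'n) 1.
        (\<forall>\<phi> \<in> Lp sphere_measure p. poisson_szego_ball \<phi> differentiable (at x)) \<and>
        sharp_inequality (Lp sphere_measure p)
          (\<lambda>\<phi>. norm (gradient (poisson_szego_ball \<phi>) x))
          (Lp_norm sphere_measure p)
          (2 * (real n - 1) *
           (Gamma (real n / 2) * Gamma ((q + 1) / 2)
              * (1 + norm x ^ 2) powr ((real n - 1) * (q - 1))
            / (sqrt pi * Gamma ((q + real n) / 2)
              * (1 - norm x ^ 2) powr (real n * (q - 1) + 1))) powr (1 / q) *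
           (hypergeometric_3F2
              ((real n - 1) * (1 - q) / 2) ((1 - (real n - 1) * (q - 1)) / 2) ((q + 1) / 2)
              (1 / 2) ((q + real n) / 2)
              (4 * norm x ^ 2 / (1 + norm x ^ 2) ^ 2)) powr (1 / q)))
     \<and>
     (\<forall>x \<in> (upper_half_space :: ((real ^ 'm) \<times> real) set).
        (\<forall>\<phi> \<in> Lp lebesgue p. poisson_szego_half_space \<phi> differentiable (at x)) \<and>
        sharp_inequality (Lp lebesgue p)
          (\<lambda>\<phi>. norm (gradient (poisson_szego_half_space \<phi>) x))
          (Lp_norm lebesgue p)
          ((real n - 1) * Gamma (real n / 2)
            / (2 powr ((q - 1) / q) * pi powr ((real n * q - real n + 1) / (2 * q))
               * snd x powr ((real n * (q - 1) + 1) / q)) *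
           (Gamma ((q + 1) / 2) / Gamma ((q + real n) / 2) *
            hypergeometric_3F2
              ((real n - 1) * (1 - q) / 2) ((1 - (real n - 1) * (q - 1)) / 2) ((q + 1) / 2)
              (1 / 2) ((q + real n) / 2) 1) powr (1 / q)))"
proof (intro conjI ballI)
  note exps = conjugate_exponent_cases[OF assms(1,4,5)]
  define s where "s = (real n - 1) * (q - 1)"
  have q: "q \<ge> 1" by (rule exponent_ge_1[OF exps(1)])
  have coeff: "(s gchoose (2 * k)) \<ge> 0" for k
    using exps(2) unfolding s_def by (rule gbinomial_even_nonneg)
  have a1: "(real n - 1) * (1 - q) / 2 = - s / 2" by (simp add: s_def algebra_simps)
  have dimn: "DIM(real ^ 'n) = n" using assms(2) by simp
  have dimm: "DIM((real ^ 'm) \<times> real) = n" using assms(1,3) by simp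
  have n2: "n \<ge> 2" using assms(1) by simp
  {
    fix x :: "real ^ 'n" assume "x \<in> ball 0 1"
    then have x: "norm x < 1" by simp
    have w: "(2 * norm x / (1 + (norm x)\<^sup>2))\<^sup>2 = 4 * norm x ^ 2 / (1 + norm x ^ 2) ^ 2"
      by (simp add: power_divide power_mult_distrib)
    note sharp = sharp_gradient_ball[OF exps(1), where x = x, unfolded dimn, OF n2 x coeff[unfolded s_def], folded s_def]
    show "poisson_szego_ball \<phi> differentiable (at x)" if "\<phi> \<in> Lp sphere_measure p" for \<phi> :: "real ^ 'n \<Rightarrow> real"
      by (rule sharp(1)[OF that])
    show "sharp_inequality (Lp sphere_measure p)
          (\<lambda>\<phi>. norm (gradient (poisson_szego_ball \<phi>) x))
          (Lp_norm sphere_measure p)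
          (2 * (real n - 1) *
           (Gamma (real n / 2) * Gamma ((q + 1) / 2)
              * (1 + norm x ^ 2) powr ((real n - 1) * (q - 1))
            / (sqrt pi * Gamma ((q + real n) / 2)
              * (1 - norm x ^ 2) powr (real n * (q - 1) + 1))) powr (1 / q) *
           (hypergeometric_3F2
              ((real n - 1) * (1 - q) / 2) ((1 - (real n - 1) * (q - 1)) / 2) ((q + 1) / 2)
              (1 / 2) ((q + real n) / 2)
              (4 * norm x ^ 2 / (1 + norm x ^ 2) ^ 2)) powr (1 / q))"
      unfolding ball_constant_eq[OF n2 q norm_ge_zero x, symmetric] a1 unfolding s_def[symmetric] w[symmetric]
      by (rule sharp(2))
  }
  {
    fix x :: "(real ^ 'm) \<times> real" assume "x \<in> upper_half_space"
    then have x: "snd x > 0" by (simp add: upper_half_space_def)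
    note sharp = sharp_gradient_half_space[OF exps(1), where x = x, unfolded dimm, OF x coeff[unfolded s_def], folded s_def]
    show "poisson_szego_half_space \<phi> differentiable (at x)" if "\<phi> \<in> Lp lebesgue p" for \<phi> :: "real ^ 'm \<Rightarrow> real"
      by (rule sharp(1)[OF that])
    show "sharp_inequality (Lp lebesgue p)
          (\<lambda>\<phi>. norm (gradient (poisson_szego_half_space \<phi>) x))
          (Lp_norm lebesgue p)
          ((real n - 1) * Gamma (real n / 2)
            / (2 powr ((q - 1) / q) * pi powr ((real n * q - real n + 1) / (2 * q))
               * snd x powr ((real n * (q - 1) + 1) / q)) *
           (Gamma ((q + 1) / 2) / Gamma ((q + real n) / 2) *
            hypergeometric_3F2
              ((real n - 1) * (1 - q) / 2) ((1 - (real n - 1) * (q - 1)) / 2) ((q + 1) / 2)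
              (1 / 2) ((q + real n) / 2) 1) powr (1 / q))"
      unfolding half_space_constant_eq[OF n2 q x, symmetric] a1 unfolding s_def[symmetric]
      by (rule sharp(2))
  }
qed

end
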